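(* Let $F\in\mathfrak{F}$ and let $L$ be a (possibly killed) Lévy subordinator without drift and with non-zero Lévy measure $\nu_L$ on $(0,\infty]$. Let $(F,L)$ be an admissible pair, i.e. $F\in\mathfrak{F}_L$, and let $H_t=\int_0^\infty -\log\{F(\frac{s}{t}-)\}\,\mathrm{d}L_s$, $t\ge0$. (a) (Integration-by-parts formula) $$H_t=\int_0^\infty -\log\Big(F\Big(\frac{s}{t}-\Big)\Big)\,\mathrm{d}L_s=\int_0^\infty L_{s\,t}\,\mathrm{d}\big(\log(F(s))\big),\quad t>0.$$ (b) (LePage series representation) Let $\{Z_k\}_{k\ge1}$ be an iid sequence drawn from the probability measure $\frac{\Psi_F(z)}{\Psi_H(1)}\,\nu_L(\mathrm{d}z)$ on $(0,\infty]$. Independently, let $\{\epsilon_k\}_{k\ge1}$ be an iid sequence of unit exponential random variables. Then the following equality in distribution holds: $$\{H_t\}_{t\ge0}\stackrel{d}{=}\Big\{-\sum_{k\ge1}\log\Big[F\Big(\frac{(\epsilon_1+\ldots+\epsilon_k)\,\Psi_F(Z_k)}{t\,\Psi_H(1)}-\Big)^{Z_k}\Big]\Big\}_{t\ge0}.$$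
   Context: $\mathfrak{F}$ is the set of distribution functions $F$ of random variables $X\in[0,\infty)$ with $\mathbb{E}[X]=\int_0^\infty(1-F(s))\,\mathrm{d}s\in(0,\infty)$. For $F\in\mathfrak{F}$, $\Psi_F(x):=\int_0^\infty(1-F(s)^x)\,\mathrm{d}s$, $x\ge0$ (with $\Psi_F(\infty):=\lim_{x\to\infty}\Psi_F(x)$). $\mathfrak{F}_L:=\{F\in\mathfrak{F}:\int_{(0,\infty]}\Psi_F(y)\,\nu_L(\mathrm{d}y)<\infty\}$; the pair $(F,L)$ is called admissible if $H_t$ is not almost surely equal to $\infty\cdot\mathbf{1}_{\{t>0\}}$, which is equivalent to $F\in\mathfrak{F}_L$. The function $\Psi_H(x):=-\log\mathbb{E}[e^{-xH_1}]=\int_{(0,\infty]}\Psi_F(xy)\,\nu_L(\mathrm{d}y)$, $x\ge0$, is the Bernstein function of the infinitely divisible random variable $H_1$. A (possibly killed) Lévy subordinator without drift is a non-decreasing, almost surely right-continuous, $[0,\infty]$-valued process $L=\{L_t\}_{t\ge0}$ with $L_0=0$ and independent and stationary increments (possibly jumping to the absorbing state $\infty$), whose law is determined by $\mathbb{E}[e^{-xL_t}]=e^{-t\Psi_L(x)}$, $\Psi_L(x)=\int_{(0,\infty]}(1-e^{-ux})\,\nu_L(\mathrm{d}u)$, $x\ge0$, where the Lévy measure $\nu_L$ satisfies $\int\min\{u,1\}\,\nu_L(\mathrm{d}u)<\infty$. Integrals with respect to $L$ and $\log F$ are pathwise Riemann–Stieltjes integrals (improper at $0$ and $\infty$) with values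 in $[0,\infty]$; $F(x-):=\lim_{u\nearrow x}F(u)$. Conventions: $1/0:=\infty$, $F(\infty)=F(\infty-):=1$ (so $H_0=0$), $\exp(-\infty):=0$, $0\cdot\infty:=0$, $-\log0:=\infty$; powers $F(x)^z$ with $z\in(0,\infty]$ are read as $\exp(-z\cdot(-\log F(x)))$. Equality in distribution of processes means equality of all finite-dimensional distributions. *)

theory Defs
  imports "HOL-Probability.Probability"
begin

subsection \<open>Extended logarithm, exponential and powers\<close>

definition elog :: "real \<Rightarrow> ereal" where
  "elog p = (if p = 0 then -\<infinity> else ereal (ln p))"

definition neg_log :: "real \<Rightarrow> ennreal" where
  "neg_log p = e2ennreal (- elog p)"

definition exp_neg :: "ennreal \<Rightarrow> real" where
  "exp_neg y = (if y = \<infinity> then 0 else exp (- enn2real y))"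

text \<open>The power \<open>p\<^sup>z\<close> for \<open>p \<in> [0,1]\<close> and \<open>z \<in> [0,\<infinity>]\<close>. Since \<open>0 * \<infinity> = 0\<close> in
  \<^typ>\<open>ennreal\<close>, both \<open>0\<^sup>0 = 1\<close> and \<open>1\<^sup>\<infinity> = 1\<close>.\<close>

definition df_power :: "real \<Rightarrow> ennreal \<Rightarrow> real" where
  "df_power p z = exp_neg (z * neg_log p)"

subsection \<open>Pathwise Riemann--Stieltjes integrals with values in \<open>[0,\<infinity>]\<close>\<close>

text \<open>The increment of a non-decreasing function with values in \<open>[-\<infinity>,\<infinity>]\<close>. It is zero
  wherever the function is constant, also if the constant is infinite; in \<^typ>\<open>ereal\<close>
  the difference \<open>\<infinity> - \<infinity>\<close> would be \<open>\<infinity>\<close>.\<close>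

definition rs_incr :: "(real \<Rightarrow> ereal) \<Rightarrow> real \<Rightarrow> real \<Rightarrow> ennreal" where
  "rs_incr G u v = (if G v = G u then 0 else e2ennreal (G v - G u))"

definition rs_sum ::
    "(real \<Rightarrow> ennreal) \<Rightarrow> (real \<Rightarrow> ereal) \<Rightarrow> (real \<times> real set) set \<Rightarrow> ennreal" where
  "rs_sum f G p = (\<Sum>(x, k)\<in>p. f x * rs_incr G (Inf k) (Sup k))"

text \<open>Tagged partitions of \<open>[a,b]\<close> as their mesh tends to zero. In contrast to the
  gauges of \<^const>\<open>division_filter\<close>, the bound on the mesh does not depend on the tags.\<close>

definition mesh_filter :: "real \<Rightarrow> real \<Rightarrow> (real \<times> real set) set filter" where
  "mesh_filter a b = (INF \<delta>\<in>{0<..}.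
     principal {p. p tagged_division_of {a..b} \<and> (\<forall>(x, k)\<in>p. diameter k < \<delta>)})"

definition has_RS_integral_on ::
    "(real \<Rightarrow> ennreal) \<Rightarrow> (real \<Rightarrow> ereal) \<Rightarrow> real \<Rightarrow> real \<Rightarrow> ennreal \<Rightarrow> bool" where
  "has_RS_integral_on f G a b I \<longleftrightarrow> (rs_sum f G \<longlongrightarrow> I) (mesh_filter a b)"

text \<open>The integral over \<open>(0,\<infinity>)\<close>, improper at both ends: the integrals over \<open>[a,b]\<close> have to
  exist for all small enough \<open>a > 0\<close> and all large enough \<open>b\<close>, and to converge as
  \<open>a\<close> decreases to \<open>0\<close> and \<open>b\<close> tends to \<open>\<infinity>\<close>.\<close>

definition has_RS_integral :: "(real \<Rightarrow> ennreal) \<Rightarrow> (real \<Rightarrow> ereal) \<Rightarrow> ennreal \<Rightarrow> bool" where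
  "has_RS_integral f G I \<longleftrightarrow>
     (\<exists>J. (\<forall>\<^sub>F (a, b) in at_right 0 \<times>\<^sub>F at_top. has_RS_integral_on f G a b (J a b)) \<and>
          ((\<lambda>(a, b). J a b) \<longlongrightarrow> I) (at_right 0 \<times>\<^sub>F at_top))"

definition RS_integral :: "(real \<Rightarrow> ennreal) \<Rightarrow> (real \<Rightarrow> ereal) \<Rightarrow> ennreal" where
  "RS_integral f G = (THE I. has_RS_integral f G I)"

subsection \<open>Distribution functions\<close>

definition dist_fun :: "(real \<Rightarrow> real) \<Rightarrow> bool" where
  "dist_fun F \<longleftrightarrow> (\<exists>\<mu>. real_distribution \<mu> \<and> F = cdf \<mu> \<and> (AE x in \<mu>. 0 \<le> x) \<and>
     0 < (\<integral>\<^sup>+x. ennreal x \<partial>\<mu>) \<and> (\<integral>\<^sup>+x. ennreal x \<partial>\<mu>) < \<infinity>)"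

definition df_left :: "(real \<Rightarrow> real) \<Rightarrow> ennreal \<Rightarrow> real" where
  "df_left F x = (if x = \<infinity> then 1 else Lim (at_left (enn2real x)) F)"

definition Psi_fin :: "(real \<Rightarrow> real) \<Rightarrow> real \<Rightarrow> ennreal" where
  "Psi_fin F x = (\<integral>\<^sup>+s\<in>{0..}. ennreal (1 - df_power (F s) (ennreal x)) \<partial>lborel)"

definition Psi :: "(real \<Rightarrow> real) \<Rightarrow> ennreal \<Rightarrow> ennreal" where
  "Psi F x = (if x = \<infinity> then Lim at_top (Psi_fin F) else Psi_fin F (enn2real x))"

subsection \<open>Subordinators\<close>

text \<open>A measure on \<open>(0,\<infinity>]\<close> is represented by a Borel measure on \<^typ>\<open>ennreal\<close>
  that does not charge \<open>0\<close>.\<close>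

definition levy_measure :: "ennreal measure \<Rightarrow> bool" where
  "levy_measure \<nu> \<longleftrightarrow> sets \<nu> = sets borel \<and> emeasure \<nu> {0} = 0 \<and> (\<integral>\<^sup>+u. min u 1 \<partial>\<nu>) < \<infinity>"

definition Psi_L :: "ennreal measure \<Rightarrow> real \<Rightarrow> ennreal" where
  "Psi_L \<nu> x = (\<integral>\<^sup>+u. ennreal (1 - exp_neg (u * ennreal x)) \<partial>\<nu>)"

definition past_algebra ::
    "'a measure \<Rightarrow> (real \<Rightarrow> 'a \<Rightarrow> ennreal) \<Rightarrow> real \<Rightarrow> 'a set set" where
  "past_algebra M L s =
     sigma_sets (space M) {L u -` B \<inter> space M | u B. u \<in> {0..s} \<and> B \<in> sets borel}"

text \<open>For a process that may be killed, the increment \<open>L\<^bsub>s+h\<^esub> - L\<^bsub>s\<^esub>\<close> only makes sense on the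
  event \<open>L\<^bsub>s\<^esub> < \<infinity>\<close>. Independence and stationarity of the increments mean that on this event
  the increment is independent of the past up to time \<open>s\<close> and distributed like \<open>L\<^bsub>h\<^esub>\<close>
  (where \<open>\<infinity>\<close> is a possible value). If the process is never killed this is the usual notion.\<close>

definition indep_stat_increments :: "'a measure \<Rightarrow> (real \<Rightarrow> 'a \<Rightarrow> ennreal) \<Rightarrow> bool" where
  "indep_stat_increments M L \<longleftrightarrow>
     (\<forall>s\<ge>0. \<forall>h\<ge>0. \<forall>A\<in>past_algebra M L s. \<forall>B\<in>sets borel.
        measure M {\<omega>\<in>space M. \<omega> \<in> A \<and> L s \<omega> < \<infinity> \<and> L (s + h) \<omega> - L s \<omega> \<in> B} =
        measure M {\<omega>\<in>space M. \<omega> \<in> A \<and> L s \<omega> < \<infinity>} * measure M {\<omega>\<in>space M. L h \<omega> \<in> B})"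

text \<open>A possibly killed subordinator without drift and with \<open>\<nu>\<close> as its Levy measure.\<close>

definition levy_subordinator ::
    "'a measure \<Rightarrow> (real \<Rightarrow> 'a \<Rightarrow> ennreal) \<Rightarrow> ennreal measure \<Rightarrow> bool" where
  "levy_subordinator M L \<nu> \<longleftrightarrow>
     prob_space M \<and> levy_measure \<nu> \<and>
     (\<forall>t\<ge>0. L t \<in> borel_measurable M) \<and>
     (\<forall>\<omega>\<in>space M. L 0 \<omega> = 0) \<and>
     (\<forall>\<omega>\<in>space M. mono_on {0..} (\<lambda>t. L t \<omega>)) \<and>
     (AE \<omega> in M. \<forall>t\<ge>0. continuous (at_right t) (\<lambda>t. L t \<omega>)) \<and>
     indep_stat_increments M L \<and>
     (\<forall>t\<ge>0. \<forall>x\<ge>0.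
        prob_space.expectation M (\<lambda>\<omega>. exp_neg (ennreal x * L t \<omega>)) = exp_neg (ennreal t * Psi_L \<nu> x))"

definition dist_fun_L :: "ennreal measure \<Rightarrow> (real \<Rightarrow> real) \<Rightarrow> bool" where
  "dist_fun_L \<nu> F \<longleftrightarrow> dist_fun F \<and> (\<integral>\<^sup>+y. Psi F y \<partial>\<nu>) < \<infinity>"

text \<open>In \<^typ>\<open>ennreal\<close> we have \<open>s / 0 = \<infinity>\<close> for \<open>s > 0\<close>, so that the integrand vanishes on \<open>(0,\<infinity>)\<close>
  for \<open>t = 0\<close>.\<close>

definition H_integrand :: "(real \<Rightarrow> real) \<Rightarrow> real \<Rightarrow> real \<Rightarrow> ennreal" where
  "H_integrand F t s = neg_log (df_left F (ennreal s / ennreal t))"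

definition H_process ::
    "(real \<Rightarrow> real) \<Rightarrow> (real \<Rightarrow> 'a \<Rightarrow> ennreal) \<Rightarrow> real \<Rightarrow> 'a \<Rightarrow> ennreal" where
  "H_process F L t \<omega> = RS_integral (H_integrand F t) (\<lambda>s. enn2ereal (L s \<omega>))"

text \<open>As the integral defining the process exists only almost surely, its values are random
  variables on the completion of the probability space.\<close>

definition Psi_H ::
    "'a measure \<Rightarrow> (real \<Rightarrow> real) \<Rightarrow> (real \<Rightarrow> 'a \<Rightarrow> ennreal) \<Rightarrow> real \<Rightarrow> ennreal" where
  "Psi_H M F L x =
     neg_log (prob_space.expectation (completion M) (\<lambda>\<omega>. exp_neg (ennreal x * H_process F L 1 \<omega>)))"

subsection \<open>Equality in distribution of processes\<close>

definition same_fdd :: "'i set \<Rightarrow> 'a measure \<Rightarrow> ('i \<Rightarrow> 'a \<Rightarrow> 'c::topological_space) \<Rightarrow>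
    'b measure \<Rightarrow> ('i \<Rightarrow> 'b \<Rightarrow> 'c) \<Rightarrow> bool" where
  "same_fdd T M X N Y \<longleftrightarrow>
     (\<forall>t\<in>T. X t \<in> borel_measurable M) \<and> (\<forall>t\<in>T. Y t \<in> borel_measurable N) \<and>
     (\<forall>J. finite J \<and> J \<subseteq> T \<longrightarrow>
        distr M (\<Pi>\<^sub>M t\<in>J. borel) (\<lambda>\<omega>. \<lambda>t\<in>J. X t \<omega>) =
        distr N (\<Pi>\<^sub>M t\<in>J. borel) (\<lambda>\<omega>. \<lambda>t\<in>J. Y t \<omega>))"

text \<open>Independence of two sequences as wholes. Their values may have different types, so
  \<^const>\<open>prob_space.indep_var\<close> does not apply.\<close>

definition indep_sequences :: "'b measure \<Rightarrow> (nat \<Rightarrow> 'b \<Rightarrow> 'c::topological_space) \<Rightarrow>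
    (nat \<Rightarrow> 'b \<Rightarrow> 'd::topological_space) \<Rightarrow> bool" where
  "indep_sequences N X Y \<longleftrightarrow> prob_space.indep_set N
     (sets (vimage_algebra (space N) (\<lambda>\<omega> k. X k \<omega>) (\<Pi>\<^sub>M k\<in>UNIV. borel)))
     (sets (vimage_algebra (space N) (\<lambda>\<omega> k. Y k \<omega>) (\<Pi>\<^sub>M k\<in>UNIV. borel)))"

text \<open>The sequences start at index \<open>0\<close>, so the \<open>k\<close>-th partial sum is \<open>\<epsilon>\<^sub>0 + \<dots> + \<epsilon>\<^sub>k\<close>.\<close>

definition lepage_series :: "(real \<Rightarrow> real) \<Rightarrow> ennreal \<Rightarrow> (nat \<Rightarrow> 'b \<Rightarrow> ennreal) \<Rightarrow>
    (nat \<Rightarrow> 'b \<Rightarrow> real) \<Rightarrow> real \<Rightarrow> 'b \<Rightarrow> ennreal" where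
  "lepage_series F c Z \<epsilon> t \<omega> =
     (\<Sum>k. neg_log (df_power
        (df_left F (ennreal (\<Sum>i\<le>k. \<epsilon> i \<omega>) * Psi F (Z k \<omega>) / (ennreal t * c))) (Z k \<omega>)))"

end

theory Submission
  imports Defs "HOL-Real_Asymp.Real_Asymp"
begin

text \<open>
  Both parts rest on turning Stieltjes integrals into Lebesgue integrals over the \<^emph>\<open>levels\<close>
  of the integrator. If \<open>G\<close> is non-decreasing and \<open>G\<inverse> y = inf {s > 0. y < G s}\<close>, then the
  increment of \<open>G\<close> over a cell is the length of the set of levels \<open>y\<close> that \<open>G\<close> crosses in
  this cell. A Riemann--Stieltjes sum is thus the integral over \<open>y\<close> of the value of \<open>f\<close> at the
  tag of the cell in which \<open>y\<close> is crossed, and this tag tends to \<open>G\<inverse> y\<close> with the mesh. Fatou's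
  lemma and dominated convergence give the limit \<open>\<integral> f (G\<inverse> y) dy\<close> if \<open>f\<close> and \<open>G\<close> do not jump
  together (\<open>rs_limit\<close>). Infinite increments, of \<open>L\<close> when it is killed and of \<open>log F\<close>
  where \<open>F\<close> leaves \<open>0\<close>, are level sets of infinite length.

  Part (a). For fixed \<open>t\<close> a subordinator almost surely does not jump at any of the countably many
  scaled jump times of \<open>F\<close>. Domination can only fail at the two ends of the support of \<open>F\<close>: below
  the lower end the integrand \<open>-log F\<close> is infinite, and beyond the upper end it vanishes where
  \<open>L\<close> may be infinite. It does not fail if \<open>L\<close> neither leaves \<open>0\<close> exactly at the first of these
  times nor is killed exactly at the second one, which again holds almost surely. These
  conditions form the locale \<open>compatible_path\<close>. On such a path the two integrals exist and are,
  for \<open>t = 1\<close>, the areas of the sets of all \<open>(y, x)\<close> with \<open>x < 0\<close> and \<open>log F (L\<inverse> y) < x\<close>, and with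
  \<open>y < L ((log F)\<inverse> x)\<close>, respectively. The sets differ by a null set (\<open>inverse_relation\<close>), so
  Tonelli's theorem is the integration by parts.

  Part (b). A combination \<open>\<Sum> x\<^sub>j H\<^sub>t\<^sub>j\<close> with \<open>x\<^sub>j \<ge> 0\<close> is the integral \<open>\<integral> g dL\<close> of a non-increasing
  function \<open>g\<close>. Its lower dyadic sums converge, and independent increments yield
  \<open>E exp (-\<integral> g dL) = exp (-\<integral>\<integral> (1 - e\<^sup>-\<^sup>u\<^sup>g\<^sup>(\<^sup>s\<^sup>)) ds \<nu>(du))\<close> (\<open>laplace_H\<close>). For \<open>g = -log F\<close> this identifies
  \<open>\<Psi>\<^sub>H(1)\<close> as \<open>\<integral> \<Psi>\<^sub>F d\<nu>\<close>. The points \<open>(\<epsilon>\<^sub>1 + \<dots> + \<epsilon>\<^sub>k, Z\<^sub>k)\<close> form a marked Poisson process, and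
  \<open>E exp (-\<Sum> h (\<epsilon>\<^sub>1 + \<dots> + \<epsilon>\<^sub>k, Z\<^sub>k)) = exp (-\<integral> E (1 - e\<^sup>-\<^sup>h\<^sup>(\<^sup>\<gamma>\<^sup>,\<^sup>Z\<^sup>)) d\<gamma>)\<close> (\<open>laplace_marked\<close>). With
  \<open>h (\<gamma>, z) = z g (\<gamma> \<Psi>\<^sub>F(z) / \<Psi>\<^sub>H(1))\<close> the substitution \<open>s = \<gamma> \<Psi>\<^sub>F(z) / \<Psi>\<^sub>H(1)\<close> cancels the density of
  the marks with respect to \<open>\<nu>\<close>, so the two exponents agree. Laplace transforms determine laws
  on powers of \<open>[0,\<infinity>]\<close> (\<open>joint_laplace_unique\<close>).
\<close>

section \<open>Extended exponential and logarithm\<close>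

lemma exp_neg_0 [simp]: "exp_neg 0 = 1"
  by (simp add: exp_neg_def)

lemma exp_neg_top [simp]: "exp_neg \<top> = 0"
  by (simp add: exp_neg_def)

lemma exp_neg_ennreal: "0 \<le> x \<Longrightarrow> exp_neg (ennreal x) = exp (- x)"
  by (simp add: exp_neg_def)

lemma exp_neg_nonneg [simp]: "0 \<le> exp_neg y"
  by (simp add: exp_neg_def)

lemma exp_neg_le_1 [simp]: "exp_neg y \<le> 1"
  by (simp add: exp_neg_def)

lemma exp_neg_add: "exp_neg (x + y) = exp_neg x * exp_neg y"
  by (cases x; cases y) (auto simp: exp_neg_def exp_add[symmetric] exp_minus_inverse
      simp flip: ennreal_plus)

lemma exp_neg_sum: "finite A \<Longrightarrow> exp_neg (\<Sum>i\<in>A. f i) = (\<Prod>i\<in>A. exp_neg (f i))"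
  by (induction A rule: finite_induct) (auto simp: exp_neg_add)

lemma exp_neg_of_nat_mult: "exp_neg (of_nat n * y) = exp_neg y ^ n"
  by (induction n) (auto simp: exp_neg_add distrib_right)

lemma exp_neg_less_iff: "exp_neg x < exp_neg y \<longleftrightarrow> y < x"
  by (cases x; cases y) (auto simp: exp_neg_def ennreal_less_iff top_unique less_top[symmetric])

lemma exp_neg_le_iff: "exp_neg x \<le> exp_neg y \<longleftrightarrow> y \<le> x"
  by (meson exp_neg_less_iff not_le)

lemma neg_log_exp_neg [simp]: "neg_log (exp_neg y) = y"
  by (cases y) (auto simp: neg_log_def exp_neg_def elog_def simp flip: ennreal.abs_eq)

lemma exp_neg_neg_log: "0 \<le> p \<Longrightarrow> p \<le> 1 \<Longrightarrow> exp_neg (neg_log p) = p"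
  by (auto simp: neg_log_def exp_neg_def elog_def simp flip: ennreal.abs_eq)

text \<open>The map \<open>y \<mapsto> e\<^sup>-\<^sup>y\<close> is an order-reversing bijection of \<open>[0,\<infinity>]\<close> onto \<open>[0,1]\<close> with inverse
  \<^const>\<open>neg_log\<close>. Continuity in both directions follows from the order alone; it allows to
  work with bounded real functions in place of functions with values in \<open>[0,\<infinity>]\<close>.\<close>

lemma exp_neg_less_eq_iff: "0 \<le> p \<Longrightarrow> p \<le> 1 \<Longrightarrow> exp_neg y < p \<longleftrightarrow> neg_log p < y"
  by (metis exp_neg_less_iff exp_neg_neg_log)

lemma less_exp_neg_iff: "0 \<le> p \<Longrightarrow> p \<le> 1 \<Longrightarrow> p < exp_neg y \<longleftrightarrow> y < neg_log p"
  by (metis exp_neg_less_iff exp_neg_neg_log)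

lemma neg_log_1 [simp]: "neg_log 1 = 0"
  using neg_log_exp_neg[of 0] by simp

lemma neg_log_0 [simp]: "neg_log 0 = \<top>"
  using neg_log_exp_neg[of \<top>] by simp

lemma neg_log_mono: "0 \<le> p \<Longrightarrow> p \<le> q \<Longrightarrow> q \<le> 1 \<Longrightarrow> neg_log q \<le> neg_log p"
  by (metis exp_neg_le_iff exp_neg_neg_log order_trans)

lemma elog_eq: "0 \<le> p \<Longrightarrow> p \<le> 1 \<Longrightarrow> elog p = - enn2ereal (neg_log p)"
  by (auto simp: neg_log_def elog_def enn2ereal_e2ennreal)

lemma tendsto_exp_neg:
  assumes "(f \<longlongrightarrow> y) A" shows "((\<lambda>x. exp_neg (f x)) \<longlongrightarrow> exp_neg y) A"
proof (rule order_tendstoI)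
  fix a assume a: "a < exp_neg y"
  show "\<forall>\<^sub>F x in A. a < exp_neg (f x)"
  proof (cases "a < 0")
    case True
    then have "a < exp_neg (f x)" for x using exp_neg_nonneg[of "f x"] by linarith
    then show ?thesis by simp
  next
    case False
    with a have "0 \<le> a" "a \<le> 1" using exp_neg_le_1[of y] by linarith+
    with a order_tendstoD(2)[OF assms, of "neg_log a"] show ?thesis by (simp add: less_exp_neg_iff)
  qed
next
  fix a assume a: "exp_neg y < a"
  show "\<forall>\<^sub>F x in A. exp_neg (f x) < a"
  proof (cases "1 < a")
    case True
    then have "exp_neg (f x) < a" for x using exp_neg_le_1[of "f x"] by linarith
    then show ?thesis by simp
  next
    case False
    with a have "0 \<le> a" "a \<le> 1" using exp_neg_nonneg[of y] by linarith+
    with a order_tendstoD(1)[OF assms, of "neg_log a"] show ?thesis by (simp add: exp_neg_less_eq_iff)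
  qed
qed

lemma tendsto_neg_log:
  assumes "(f \<longlongrightarrow> p) A" "\<And>x. 0 \<le> f x \<and> f x \<le> 1" "0 \<le> p" "p \<le> 1"
  shows "((\<lambda>x. neg_log (f x)) \<longlongrightarrow> neg_log p) A"
proof (rule order_tendstoI)
  fix a assume "a < neg_log p"
  then have "p < exp_neg a" using assms by (simp add: less_exp_neg_iff)
  then show "\<forall>\<^sub>F x in A. a < neg_log (f x)"
    using order_tendstoD(2)[OF assms(1), of "exp_neg a"] assms(2) by (simp add: less_exp_neg_iff)
next
  fix a assume "neg_log p < a"
  then have "exp_neg a < p" using assms by (simp add: exp_neg_less_eq_iff)
  then show "\<forall>\<^sub>F x in A. neg_log (f x) < a"
    using order_tendstoD(1)[OF assms(1), of "exp_neg a"] assms(2) by (simp add: exp_neg_less_eq_iff)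
qed

lemma tendsto_elog:
  assumes "(f \<longlongrightarrow> p) A" "\<And>x. 0 \<le> f x \<and> f x \<le> 1" "0 \<le> p" "p \<le> 1"
  shows "((\<lambda>x. elog (f x)) \<longlongrightarrow> elog p) A"
proof -
  have "((\<lambda>x. - enn2ereal (neg_log (f x))) \<longlongrightarrow> - enn2ereal (neg_log p)) A"
    by (intro tendsto_uminus_ereal tendsto_enn2erealI tendsto_neg_log assms)
  then show ?thesis using assms by (simp add: elog_eq)
qed

lemma tendsto_from_exp_neg:
  assumes "((\<lambda>x. exp_neg (f x)) \<longlongrightarrow> exp_neg y) A" shows "(f \<longlongrightarrow> y) A"
  using tendsto_neg_log[OF assms] by simp

lemma exp_neg_nat_tendsto: "(\<lambda>n. exp_neg (ennreal (real n) * y)) \<longlonglongrightarrow> exp_neg (\<top> * y)"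
proof (cases "y = 0")
  case False
  then have "exp_neg y < 1" using exp_neg_less_iff[of y 0] by (simp add: zero_less_iff_neq_zero)
  then have "(\<lambda>n. exp_neg y ^ n) \<longlonglongrightarrow> 0" by (intro LIMSEQ_power_zero) simp
  then show ?thesis using False
    by (simp add: ennreal_of_nat_eq_real_of_nat[symmetric] exp_neg_of_nat_mult ennreal_top_mult)
qed simp

lemma borel_measurable_exp_neg [measurable]: "exp_neg \<in> borel_measurable borel"
  by (intro borel_measurable_continuous_onI) (auto simp: continuous_on_def intro!: tendsto_exp_neg)

lemma borel_measurable_neg_log [measurable]: "neg_log \<in> borel_measurable borel"
  unfolding neg_log_def elog_def by measurable

section \<open>Riemann--Stieltjes integrals over levels\<close>

text \<open>The right-continuous inverse. Only positive arguments count, because the integrals are taken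
  over \<open>(0,\<infinity>)\<close>.\<close>

definition gen_inv :: "(real \<Rightarrow> ereal) \<Rightarrow> real \<Rightarrow> real" where
  "gen_inv G y = Inf {s. 0 < s \<and> ereal y < G s}"

text \<open>The levels that are crossed at some time in \<open>(0,\<infinity>)\<close>; for the other levels \<^const>\<open>gen_inv\<close>
  has no meaning.\<close>

definition level_range :: "(real \<Rightarrow> ereal) \<Rightarrow> real set" where
  "level_range G = {y. (\<exists>s>0. G s \<le> ereal y) \<and> (\<exists>s>0. ereal y < G s)}"

text \<open>The prospective value of the improper integral \<open>\<integral>\<^sub>(\<^sub>0\<^sub>,\<^sub>\<infinity>\<^sub>) f dG\<close>.\<close>

definition stieltjes :: "(real \<Rightarrow> ennreal) \<Rightarrow> (real \<Rightarrow> ereal) \<Rightarrow> ennreal" where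
  "stieltjes f G = (\<integral>\<^sup>+y. f (gen_inv G y) * indicator (level_range G) y \<partial>lborel)"

lemma gen_inv_bounds:
  assumes "mono G" "0 \<le> u" "G u \<le> ereal y" "ereal y < G v" "u \<le> v"
  shows "u \<le> gen_inv G y" "gen_inv G y \<le> v"
proof -
  have v: "0 < v" using assms by (metis leD less_le_trans linorder_not_less order_less_le)
  have *: "u \<le> s" if "0 < s" "ereal y < G s" for s
    using that assms by (meson leD le_less_trans less_le_trans linorder_linear monoD)
  show "u \<le> gen_inv G y" unfolding gen_inv_def
    by (rule cInf_greatest) (use * v assms in auto)
  show "gen_inv G y \<le> v" unfolding gen_inv_def
    by (rule cInf_lower) (use v assms in \<open>auto intro!: bdd_belowI[of _ 0]\<close>)
qed

lemma less_gen_inv_imp: "0 < s \<Longrightarrow> s < gen_inv G y \<Longrightarrow> G s \<le> ereal y"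
  unfolding gen_inv_def
  by (rule ccontr) (use cInf_lower[of s "{s. 0 < s \<and> ereal y < G s}"] in \<open>force intro!: bdd_belowI[of _ 0]\<close>)

lemma gen_inv_less_imp:
  assumes "mono G" "0 < v" "ereal y < G v" "gen_inv G y < s" shows "ereal y < G s"
proof -
  have "bdd_below {s. 0 < s \<and> ereal y < G s}" by (auto intro!: bdd_belowI[of _ 0])
  then have "\<exists>r\<in>{s. 0 < s \<and> ereal y < G s}. r < s"
    using assms cInf_less_iff[of "{s. 0 < s \<and> ereal y < G s}" s]
    by (auto simp: gen_inv_def)
  then obtain r where "ereal y < G r" "r < s" by auto
  with monoD[OF assms(1), of r s] show ?thesis by auto
qed

lemma level_rangeD:
  assumes "y \<in> level_range G"
  obtains u v where "0 < u" "0 < v" "G u \<le> ereal y" "ereal y < G v"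
  using assms by (auto simp: level_range_def)

lemma gen_inv_pos:
  assumes "mono G" "y \<in> level_range G" shows "0 < gen_inv G y"
proof -
  obtain u v where *: "0 < u" "0 < v" "G u \<le> ereal y" "ereal y < G v"
    using level_rangeD[OF assms(2)] .
  then have "u \<le> v" using assms(1) by (meson leD le_less_trans linorder_linear monoD order_trans)
  with gen_inv_bounds(1)[OF assms(1), of u y v] * show ?thesis by simp
qed

text \<open>The sublevel sets of the inverse are unions of the open half-lines \<open>{y. y < G s}\<close>, except
  for the levels above all values of \<open>G\<close>, where the inverse is the constant \<open>Inf {}\<close>.\<close>

lemma borel_measurable_gen_inv [measurable]: "gen_inv G \<in> borel_measurable borel"
  unfolding borel_measurable_iff_less
proof
  fix c
  define A where "A d = {y. \<exists>s. 0 < s \<and> s < d \<and> ereal y < G s}" for d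
  have op: "open {y. ereal y < z}" for z :: ereal
    by (cases z) (auto simp: open_lessThan simp flip: lessThan_def)
  have A: "open (\<Union>d. A d)" "open (A c)"
    unfolding A_def using op by (auto intro!: open_Collect_ex open_Collect_conj open_UN)
  have "{y. gen_inv G y < c} = A c \<union> (if Inf {} < c then - (\<Union>d. A d) else {})" 
  proof (intro set_eqI)
    fix y
    show "y \<in> {y. gen_inv G y < c} \<longleftrightarrow> y \<in> A c \<union> (if Inf {} < c then - (\<Union>d. A d) else {})"
    proof (cases "{s. 0 < s \<and> ereal y < G s} = {}")
      case True
      then have "y \<notin> (\<Union>d. A d)" "y \<notin> A c" by (auto simp: A_def)
      moreover have "gen_inv G y = Inf {}" unfolding gen_inv_def True ..
      ultimately show ?thesis by simp
    next
      case False
      then have "y \<in> (\<Union>d. A d)" by (auto simp: A_def) (meson gt_ex)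
      moreover have "gen_inv G y < c \<longleftrightarrow> y \<in> A c"
        unfolding gen_inv_def using False
        by (subst cInf_less_iff) (auto simp: A_def intro!: bdd_belowI[of _ 0])
      ultimately show ?thesis by auto
    qed
  qed
  also have "\<dots> \<in> sets borel"
    using borel_open[OF A(2)] borel_comp[OF borel_open[OF A(1)]] by (simp del: Compl_UN)
  finally show "{w \<in> space borel. gen_inv G w < c} \<in> sets borel" by simp
qed

lemma level_range_borel [measurable]: "level_range G \<in> sets borel" if "mono G"
proof -
  have "is_interval {y. \<exists>s>0. G s \<le> ereal y}" "is_interval {y. \<exists>s>0. ereal y < G s}"
    unfolding is_interval_1
    by (auto, meson ereal_less_eq(3) order_trans, meson ereal_less_eq(3) order_le_less_trans)
  then have "{y. \<exists>s>0. G s \<le> ereal y} \<inter> {y. \<exists>s>0. ereal y < G s} \<in> sets borel"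
    by (intro sets.Int real_interval_borel_measurable)
  then show ?thesis by (simp add: level_range_def Int_def)
qed

text \<open>If \<open>G\<close> is continuous at \<open>c\<close>, then the single level \<open>G c\<close> is crossed at \<open>c\<close>. So only countably
  many levels are crossed in a countable set of continuity points of \<open>G\<close>.\<close>

lemma AE_gen_inv_notin:
  assumes G: "mono G" and D: "countable D" and cont: "\<And>c. c \<in> D \<Longrightarrow> 0 < c \<Longrightarrow> isCont G c"
  shows "AE y in lborel. y \<in> level_range G \<longrightarrow> gen_inv G y \<notin> D"
proof -
  have *: "ereal y = G (gen_inv G y)" if y: "y \<in> level_range G" "gen_inv G y \<in> D" for y
  proof -
    define c where "c = gen_inv G y"
    have c: "0 < c" "isCont G c" using gen_inv_pos[OF G] y cont by (auto simp: c_def)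
    obtain v where v: "0 < v" "ereal y < G v" using y(1) by (auto simp: level_range_def)
    have "G c \<le> ereal y"
    proof (rule tendsto_upperbound)
      show "(G \<longlongrightarrow> G c) (at_left c)" using c(2) by (simp add: continuous_at_imp_continuous_at_within isCont_def filterlim_at_split)
      show "\<forall>\<^sub>F s in at_left c. G s \<le> ereal y"
        using eventually_at_left_real[OF c(1)] by eventually_elim (auto intro!: less_gen_inv_imp simp: c_def)
    qed simp
    moreover have "ereal y \<le> G c"
    proof (rule tendsto_lowerbound)
      show "(G \<longlongrightarrow> G c) (at_right c)" using c(2) by (simp add: isCont_def filterlim_at_split)
      show "\<forall>\<^sub>F s in at_right c. ereal y \<le> G s"
        using eventually_at_right_less[of c] by eventually_elim (auto intro!: less_imp_le gen_inv_less_imp[OF G v] simp: c_def)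
    qed simp
    ultimately show ?thesis by (simp add: c_def)
  qed
  have "countable ((\<lambda>c. real_of_ereal (G c)) ` D)" using D by simp
  then have "AE y in lborel. y \<notin> (\<lambda>c. real_of_ereal (G c)) ` D"
    by (intro AE_not_in countable_imp_null_set_lborel)
  then show ?thesis
  proof eventually_elim
    fix y assume y: "y \<notin> (\<lambda>c. real_of_ereal (G c)) ` D"
    show "y \<in> level_range G \<longrightarrow> gen_inv G y \<notin> D"
      using y *[of y] by (metis image_eqI real_of_ereal.simps(1))
  qed
qed

lemma emeasure_lborel_half_lines: "emeasure lborel {a::real..} = \<infinity>" "emeasure lborel {..<a::real} = \<infinity>"
proof -
  have "emeasure lborel {a::real..} \<ge> of_nat n" "emeasure lborel {..<a} \<ge> of_nat n" for n
    using emeasure_mono[of "{a..a+real n}" "{a..}" lborel] emeasure_mono[of "{a-real n..<a}" "{..<a}" lborel]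
    by (simp_all add: ennreal_of_nat_eq_real_of_nat subset_eq)
  then show "emeasure lborel {a::real..} = \<infinity>" "emeasure lborel {..<a::real} = \<infinity>"
    by (metis ennreal_Ex_less_of_nat infinity_ennreal_def leD top.not_eq_extremum)+
qed

text \<open>The value \<open>0\<close> of \<^const>\<open>rs_incr\<close> for an infinite constant is what makes this hold without
  exception: no real level is crossed there.\<close>

lemma rs_incr_eq:
  assumes "G u \<le> G v"
  shows "rs_incr G u v = emeasure lborel {y. G u \<le> ereal y \<and> ereal y < G v}"
proof (cases "G u"; cases "G v")
  fix r s assume *: "G u = ereal r" "G v = ereal s"
  then have "{y. G u \<le> ereal y \<and> ereal y < G v} = {r..<s}" by auto
  then show ?thesis using * assms by (simp add: rs_incr_def flip: ennreal.abs_eq)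
next
  fix r assume *: "G u = ereal r" "G v = \<infinity>"
  then have "{y. G u \<le> ereal y \<and> ereal y < G v} = {r..}" by auto
  then show ?thesis using * emeasure_lborel_half_lines(1)[of r] by (simp add: rs_incr_def)
next
  fix r assume *: "G u = -\<infinity>" "G v = ereal r"
  then have "{y. G u \<le> ereal y \<and> ereal y < G v} = {..<r}" by auto
  then show ?thesis using * emeasure_lborel_half_lines(2)[of r] by (simp add: rs_incr_def)
qed (use assms in \<open>auto simp: rs_incr_def\<close>)

text \<open>The representation of a Riemann--Stieltjes sum as an integral over levels. The cells are
  described by a telescoping property only, so that the lemma serves for tagged divisions as
  well as for dyadic grids. Applied to the indicator \<open>h s = [y < G s]\<close>, telescoping says that
  each level between \<open>G a\<close> and \<open>G b\<close> is crossed in exactly one cell.\<close>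

lemma rs_cells:
  fixes f :: "real \<Rightarrow> ennreal" and G :: "real \<Rightarrow> ereal"
  assumes G: "mono G" and I: "finite I" and a: "0 \<le> a"
    and cells: "\<And>i. i \<in> I \<Longrightarrow> a \<le> u i \<and> u i \<le> v i \<and> v i \<le> b"
    and tele: "\<And>h::real \<Rightarrow> real. (\<Sum>i\<in>I. h (v i) - h (u i)) = h b - h a"
  obtains \<phi> where "\<phi> \<in> borel_measurable lborel"
    "(\<Sum>i\<in>I. f (x i) * rs_incr G (u i) (v i)) = (\<integral>\<^sup>+y. \<phi> y \<partial>lborel)"
    "\<And>y. \<not> (G a \<le> ereal y \<and> ereal y < G b) \<Longrightarrow> \<phi> y = 0"
    "\<And>y. G a \<le> ereal y \<Longrightarrow> ereal y < G b \<Longrightarrow>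
       \<exists>i\<in>I. \<phi> y = f (x i) \<and> u i \<le> gen_inv G y \<and> gen_inv G y \<le> v i"
proof
  define C where "C i = {y. G (u i) \<le> ereal y \<and> ereal y < G (v i)}" for i
  define \<phi> where "\<phi> y = (\<Sum>i\<in>I. f (x i) * indicator (C i) y)" for y
  have [measurable]: "C i \<in> sets borel" for i unfolding C_def by measurable
  show "\<phi> \<in> borel_measurable lborel" unfolding \<phi>_def by measurable
  show "(\<Sum>i\<in>I. f (x i) * rs_incr G (u i) (v i)) = (\<integral>\<^sup>+y. \<phi> y \<partial>lborel)"
    unfolding \<phi>_def
    by (subst nn_integral_sum)
      (auto simp: nn_integral_cmult_indicator rs_incr_eq C_def monoD[OF G] cells intro!: sum.cong)
  show "\<phi> y = 0" if "\<not> (G a \<le> ereal y \<and> ereal y < G b)" for y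
  proof -
    have "y \<notin> C i" if "i \<in> I" for i
      using cells[OF that] \<open>\<not> _\<close> monoD[OF G, of a "u i"] monoD[OF G, of "v i" b]
      by (auto simp: C_def intro: order_trans less_le_trans)
    then show ?thesis by (simp add: \<phi>_def)
  qed
  show "\<exists>i\<in>I. \<phi> y = f (x i) \<and> u i \<le> gen_inv G y \<and> gen_inv G y \<le> v i"
    if y: "G a \<le> ereal y" "ereal y < G b" for y
  proof -
    \<comment> \<open>\<open>h (v i) - h (u i)\<close> is \<open>1\<close> if \<open>y\<close> is crossed in the cell \<open>i\<close> and \<open>0\<close> otherwise\<close>
    define h :: "real \<Rightarrow> real" where "h s = of_bool (ereal y < G s)" for s
    have "h (v i) - h (u i) = of_bool (y \<in> C i)" if "i \<in> I" for i
      using cells[OF that] monoD[OF G, of "u i" "v i"] by (auto simp: h_def C_def not_less)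
    then have "(\<Sum>i\<in>I. of_bool (y \<in> C i)) = h b - h a"
      using tele[of h] by simp
    also have "\<dots> = 1" using y by (simp add: h_def)
    finally have "real (card {i\<in>I. y \<in> C i}) = 1"
      using I by (simp add: sum.If_cases of_bool_def Int_def)
    then have "card {i\<in>I. y \<in> C i} = 1" by simp
    then obtain j where j: "{i\<in>I. y \<in> C i} = {j}" by (rule card_1_singletonE)
    have "\<phi> y = (\<Sum>i\<in>{i\<in>I. y \<in> C i}. f (x i))"
      unfolding \<phi>_def sum.inter_filter[OF I] by (intro sum.cong) (auto simp: indicator_def)
    then have "\<phi> y = f (x j)" by (simp add: j)
    moreover have "j \<in> I" "y \<in> C j" using j by auto
    ultimately show ?thesis
      using gen_inv_bounds[OF G, of "u j" y "v j"] cells[of j] a by (auto simp: C_def)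
  qed
qed

lemma eventually_mesh_filter:
  "eventually P (mesh_filter a b) \<longleftrightarrow>
    (\<exists>\<delta>>0. \<forall>p. p tagged_division_of {a..b} \<and> (\<forall>(x, k)\<in>p. diameter k < \<delta>) \<longrightarrow> P p)"
  unfolding mesh_filter_def
proof (subst eventually_INF_base)
  fix d e :: real assume "d \<in> {0<..}" "e \<in> {0<..}"
  then show "\<exists>x\<in>{0<..}. principal {p. p tagged_division_of {a..b} \<and> (\<forall>(x', k)\<in>p. diameter k < x)}
     \<le> inf (principal {p. p tagged_division_of {a..b} \<and> (\<forall>(x, k)\<in>p. diameter k < d)})
           (principal {p. p tagged_division_of {a..b} \<and> (\<forall>(x, k)\<in>p. diameter k < e)})"
    by (intro bexI[of _ "min d e"]) auto
qed (auto simp: eventually_principal)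

text \<open>The mesh filter has a countable base. Limits along it are limits along sequences, for which
  Fatou's lemma and dominated convergence are available.\<close>

lemma mesh_filter_tendstoI:
  fixes g :: "_ \<Rightarrow> 'b::topological_space"
  assumes "\<And>p. (\<And>n. p n tagged_division_of {a..b}) \<Longrightarrow>
      (\<And>n x k. (x, k) \<in> p n \<Longrightarrow> diameter k < 1 / real (Suc n)) \<Longrightarrow> (\<lambda>n. g (p n)) \<longlonglongrightarrow> I"
  shows "(g \<longlongrightarrow> I) (mesh_filter a b)"
proof (rule ccontr)
  assume "\<not> (g \<longlongrightarrow> I) (mesh_filter a b)"
  then obtain S where S: "open S" "I \<in> S" "\<not> eventually (\<lambda>p. g p \<in> S) (mesh_filter a b)"
    unfolding tendsto_def by auto
  have "\<exists>p. p tagged_division_of {a..b} \<and> (\<forall>(x, k)\<in>p. diameter k < 1 / real (Suc n)) \<and> g p \<notin> S" for n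
    using S(3) unfolding eventually_mesh_filter by (auto dest: spec[of _ "1 / real (Suc n)"])
  then obtain p where p: "\<And>n. p n tagged_division_of {a..b}"
      "\<And>n. \<forall>(x, k)\<in>p n. diameter k < 1 / real (Suc n)" "\<And>n. g (p n) \<notin> S"
    by metis
  have "(\<lambda>n. g (p n)) \<longlonglongrightarrow> I" using p by (intro assms) (auto dest!: bspec)
  with S have "eventually (\<lambda>n. g (p n) \<in> S) sequentially" by (auto simp: tendsto_def)
  with p(3) show False by simp
qed

lemma mesh_filter_neq_bot: "a \<le> b \<Longrightarrow> mesh_filter a b \<noteq> bot"
proof -
  have "\<exists>p. p tagged_division_of {a..b} \<and> (\<forall>(x, k)\<in>p. diameter k < \<delta>)" if "\<delta> > 0" for \<delta>
  proof -
    have "gauge (\<lambda>x::real. ball x (\<delta> / 3))" using that by (auto simp: gauge_def)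
    then obtain p where p: "p tagged_division_of (cbox a b)" "(\<lambda>x. ball x (\<delta> / 3)) fine p"
      by (rule fine_division_exists)
    have "diameter k < \<delta>" if "(x, k) \<in> p" for x k
    proof -
      have "diameter k \<le> diameter (ball x (\<delta>/3))"
        using p(2) that by (intro diameter_subset) (auto simp: fine_def)
      then show ?thesis using \<open>\<delta> > 0\<close> by simp
    qed
    with p show ?thesis by auto
  qed
  then show ?thesis unfolding trivial_limit_def eventually_mesh_filter by blast
qed

lemma nn_integral_le_liminf_AE:
  assumes "\<And>n. \<phi> n \<in> borel_measurable M" "AE y in M. (\<lambda>n. \<phi> n y) \<longlonglongrightarrow> (h y :: ennreal)"
  shows "(\<integral>\<^sup>+y. h y \<partial>M) \<le> liminf (\<lambda>n. \<integral>\<^sup>+y. \<phi> n y \<partial>M)"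
proof -
  have "(\<integral>\<^sup>+y. h y \<partial>M) = (\<integral>\<^sup>+y. liminf (\<lambda>n. \<phi> n y) \<partial>M)"
    using assms(2) by (intro nn_integral_cong_AE, eventually_elim) (simp add: lim_imp_Liminf)
  also have "\<dots> \<le> liminf (\<lambda>n. \<integral>\<^sup>+y. \<phi> n y \<partial>M)" by (rule nn_integral_liminf) fact
  finally show ?thesis .
qed

text \<open>Together with the preceding lemma this is how lower sums are handled: they stay below the
  integral and Fatou's lemma gives the other bound.\<close>

lemma tendsto_of_le_liminf:
  fixes I :: ennreal
  assumes "I \<le> liminf X" "\<And>n. X n \<le> I" shows "X \<longlonglongrightarrow> I"
proof (rule Liminf_eq_Limsup)
  have "limsup X \<le> I" using assms(2) by (intro Limsup_bounded) auto
  moreover have "liminf X \<le> limsup X" by (rule Liminf_le_Limsup) simp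
  ultimately show "liminf X = I" "limsup X = I" using assms(1) by auto
qed simp

text \<open>The integral over a compact interval. The alternative in the last assumption is unavoidable:
  if the limit is infinite, Fatou's lemma suffices; otherwise the values of \<open>f\<close> near the crossing
  time have to be dominated, since \<open>f\<close> or the increments of \<open>G\<close> may be infinite.\<close>

lemma rs_limit:
  fixes f :: "real \<Rightarrow> ennreal" and G :: "real \<Rightarrow> ereal"
  assumes G: "mono G" and ab: "0 < a" "a \<le> b"
    and cont: "AE y in lborel. y \<in> level_range G \<longrightarrow> isCont f (gen_inv G y)"
    and dom: "(\<integral>\<^sup>+y. f (gen_inv G y) * indicator {y. G a \<le> ereal y \<and> ereal y < G b} y \<partial>lborel) = \<infinity> \<or>
      (\<exists>\<delta>>0. \<exists>w\<in>borel_measurable lborel. (\<integral>\<^sup>+y. w y \<partial>lborel) < \<infinity> \<and>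
         (\<forall>x y. G a \<le> ereal y \<longrightarrow> ereal y < G b \<longrightarrow> a \<le> x \<longrightarrow> x \<le> b \<longrightarrow>
            \<bar>x - gen_inv G y\<bar> < \<delta> \<longrightarrow> f x \<le> w y))"
  shows "has_RS_integral_on f G a b
    (\<integral>\<^sup>+y. f (gen_inv G y) * indicator {y. G a \<le> ereal y \<and> ereal y < G b} y \<partial>lborel)"
  (is "has_RS_integral_on f G a b ?I")
  unfolding has_RS_integral_on_def
proof (rule mesh_filter_tendstoI)
  fix p assume p: "\<And>n. p n tagged_division_of {a..b}"
    and mesh: "\<And>n x k. (x, k) \<in> p n \<Longrightarrow> diameter k < 1 / real (Suc n)"
  have "\<exists>\<phi>. \<phi> \<in> borel_measurable lborel \<and> rs_sum f G (p n) = (\<integral>\<^sup>+y. \<phi> y \<partial>lborel) \<and>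
     (\<forall>y. \<not> (G a \<le> ereal y \<and> ereal y < G b) \<longrightarrow> \<phi> y = 0) \<and>
     (\<forall>y. G a \<le> ereal y \<longrightarrow> ereal y < G b \<longrightarrow>
       (\<exists>x\<in>{a..b}. \<phi> y = f x \<and> \<bar>x - gen_inv G y\<bar> < 1 / real (Suc n)))" for n
  proof -
    have cell: "fst i \<in> snd i" "snd i = {Inf (snd i)..Sup (snd i)}" "a \<le> Inf (snd i)"
        "Inf (snd i) \<le> Sup (snd i)" "Sup (snd i) \<le> b" "Sup (snd i) - Inf (snd i) < 1 / real (Suc n)"
      if "i \<in> p n" for i
    proof -
      obtain x k where i: "i = (x, k)" by (cases i)
      have xk: "(x, k) \<in> p n" using that unfolding i .
      obtain c d where k: "k = cbox c d" using tagged_division_ofD(4)[OF p[of n] xk] by blast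
      have x: "x \<in> k" "k \<subseteq> {a..b}" using tagged_division_ofD(2,3)[OF p[of n] xk] by auto
      then have cd: "c \<le> d" using k by auto
      then have Ik: "Inf k = c" "Sup k = d" "k = {c..d}" "diameter k = d - c" using k by auto
      have "diameter k < 1 / real (Suc n)" by (rule mesh[OF xk])
      then show "fst i \<in> snd i" "snd i = {Inf (snd i)..Sup (snd i)}" "a \<le> Inf (snd i)"
        "Inf (snd i) \<le> Sup (snd i)" "Sup (snd i) \<le> b" "Sup (snd i) - Inf (snd i) < 1 / real (Suc n)"
        using x cd unfolding i fst_conv snd_conv Ik(1,2) Ik(4) by (simp_all add: Ik(3))
    qed
    obtain \<phi> where \<phi>: "\<phi> \<in> borel_measurable lborel"
      "(\<Sum>i\<in>p n. f (fst i) * rs_incr G (Inf (snd i)) (Sup (snd i))) = (\<integral>\<^sup>+y. \<phi> y \<partial>lborel)"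
      "\<And>y. \<not> (G a \<le> ereal y \<and> ereal y < G b) \<Longrightarrow> \<phi> y = 0"
      "\<And>y. G a \<le> ereal y \<Longrightarrow> ereal y < G b \<Longrightarrow>
         \<exists>i\<in>p n. \<phi> y = f (fst i) \<and> Inf (snd i) \<le> gen_inv G y \<and> gen_inv G y \<le> Sup (snd i)"
    proof (rule rs_cells[OF G, of "p n" a "\<lambda>i. Inf (snd i)" "\<lambda>i. Sup (snd i)" b f fst])
      show "finite (p n)" using p by (rule tagged_division_of_finite)
      show "(\<Sum>i\<in>p n. h (Sup (snd i)) - h (Inf (snd i))) = h b - h a" for h :: "real \<Rightarrow> real"
        using additive_tagged_division_1[OF ab(2) p[of n], of h] by (simp add: case_prod_beta)
    qed (use ab cell in auto)
    have "\<exists>x\<in>{a..b}. \<phi> y = f x \<and> \<bar>x - gen_inv G y\<bar> < 1 / real (Suc n)"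
      if y: "G a \<le> ereal y" "ereal y < G b" for y
    proof -
      obtain i where i: "i \<in> p n" "\<phi> y = f (fst i)" "Inf (snd i) \<le> gen_inv G y" "gen_inv G y \<le> Sup (snd i)"
        using \<phi>(4)[OF y] by auto
      have "fst i \<in> {Inf (snd i)..Sup (snd i)}" using cell(1,2)[OF i(1)] by metis
      with cell(3-6)[OF i(1)] i show ?thesis by (intro bexI[of _ "fst i"]) auto
    qed
    moreover have "rs_sum f G (p n) = (\<integral>\<^sup>+y. \<phi> y \<partial>lborel)"
      using \<phi>(2) by (simp add: rs_sum_def case_prod_beta)
    ultimately show ?thesis using \<phi>(1,3) by blast
  qed
  then obtain \<phi> where \<phi>: "\<And>n. \<phi> n \<in> borel_measurable lborel"
     "\<And>n. rs_sum f G (p n) = (\<integral>\<^sup>+y. \<phi> n y \<partial>lborel)"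
     "\<And>n y. \<not> (G a \<le> ereal y \<and> ereal y < G b) \<Longrightarrow> \<phi> n y = 0"
     "\<And>n y. G a \<le> ereal y \<Longrightarrow> ereal y < G b \<Longrightarrow>
       \<exists>x\<in>{a..b}. \<phi> n y = f x \<and> \<bar>x - gen_inv G y\<bar> < 1 / real (Suc n)"
    by metis
  note [measurable] = \<phi>(1)
  define h where "h y = f (gen_inv G y) * indicator {y. G a \<le> ereal y \<and> ereal y < G b} y" for y
  have lim: "AE y in lborel. (\<lambda>n. \<phi> n y) \<longlonglongrightarrow> h y"
    using cont
  proof eventually_elim
    fix y assume c: "y \<in> level_range G \<longrightarrow> isCont f (gen_inv G y)"
    show "(\<lambda>n. \<phi> n y) \<longlonglongrightarrow> h y"
    proof (cases "G a \<le> ereal y \<and> ereal y < G b")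
      case False
      then show ?thesis using \<phi>(3) by (auto simp: h_def)
    next
      case True
      then have "y \<in> level_range G" using ab by (auto simp: level_range_def intro: less_le_trans)
      with c have c: "isCont f (gen_inv G y)" by simp
      obtain x where x: "\<And>n. \<phi> n y = f (x n)" "\<And>n. \<bar>x n - gen_inv G y\<bar> < 1 / real (Suc n)"
        using \<phi>(4)[of y] True by metis
      have "(\<lambda>n. x n - gen_inv G y) \<longlonglongrightarrow> 0"
        by (rule Lim_null_comparison[OF _ LIMSEQ_inverse_real_of_nat])
          (use x(2) in \<open>auto intro!: always_eventually less_imp_le simp: inverse_eq_divide\<close>)
      then have "x \<longlonglongrightarrow> gen_inv G y" by (simp add: LIM_zero_iff)
      from isCont_tendsto_compose[OF c this] show ?thesis using True by (simp add: x h_def)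
    qed
  qed
  have fatou: "?I \<le> liminf (\<lambda>n. \<integral>\<^sup>+y. \<phi> n y \<partial>lborel)"
    using nn_integral_le_liminf_AE[OF \<phi>(1) lim] by (simp add: h_def[abs_def])
  show "(\<lambda>n. rs_sum f G (p n)) \<longlonglongrightarrow> ?I"
    unfolding \<phi>(2)
  proof (cases "?I = \<infinity>")
    case True
    show "(\<lambda>n. \<integral>\<^sup>+y. \<phi> n y \<partial>lborel) \<longlonglongrightarrow> ?I"
      by (rule tendsto_of_le_liminf[OF fatou]) (simp add: True)
  next
    case False
    then obtain \<delta> w where w: "0 < \<delta>" "w \<in> borel_measurable lborel" "(\<integral>\<^sup>+y. w y \<partial>lborel) < \<infinity>"
      "\<And>x y. G a \<le> ereal y \<Longrightarrow> ereal y < G b \<Longrightarrow> a \<le> x \<Longrightarrow> x \<le> b \<Longrightarrow>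
            \<bar>x - gen_inv G y\<bar> < \<delta> \<Longrightarrow> f x \<le> w y"
      using dom False by auto
    obtain N where N: "1 / real (Suc N) < \<delta>" using w(1) nat_approx_posE by blast
    have "(\<lambda>n. \<integral>\<^sup>+y. \<phi> (n + N) y \<partial>lborel) \<longlonglongrightarrow> (\<integral>\<^sup>+y. liminf (\<lambda>n. \<phi> n y) \<partial>lborel)"
    proof (rule nn_integral_dominated_convergence[where w = w])
      show "AE y in lborel. \<phi> (n + N) y \<le> w y" for n
      proof (intro always_eventually allI)
        fix y show "\<phi> (n + N) y \<le> w y"
        proof (cases "G a \<le> ereal y \<and> ereal y < G b")
          case True
          then obtain x where x: "x \<in> {a..b}" "\<phi> (n + N) y = f x" "\<bar>x - gen_inv G y\<bar> < 1 / real (Suc (n + N))"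
            using \<phi>(4)[of y "n + N"] by auto
          have "1 / real (Suc (n + N)) \<le> 1 / real (Suc N)" by (simp add: frac_le)
          with x N w(4)[of y x] True show ?thesis by auto
        qed (use \<phi>(3) in auto)
      qed
      show "AE y in lborel. (\<lambda>n. \<phi> (n + N) y) \<longlonglongrightarrow> liminf (\<lambda>n. \<phi> n y)"
        using lim
      proof eventually_elim
        fix y assume l: "(\<lambda>n. \<phi> n y) \<longlonglongrightarrow> h y"
        then have "liminf (\<lambda>n. \<phi> n y) = h y" by (simp add: lim_imp_Liminf)
        then show "(\<lambda>n. \<phi> (n + N) y) \<longlonglongrightarrow> liminf (\<lambda>n. \<phi> n y)"
          using LIMSEQ_ignore_initial_segment[OF l, of N] by simp
      qed
    qed (use w in auto)
    moreover have "(\<integral>\<^sup>+y. liminf (\<lambda>n. \<phi> n y) \<partial>lborel) = ?I"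
      using lim by (intro nn_integral_cong_AE, eventually_elim) (simp add: lim_imp_Liminf h_def)
    ultimately show "(\<lambda>n. \<integral>\<^sup>+y. \<phi> n y \<partial>lborel) \<longlonglongrightarrow> ?I"
      using LIMSEQ_offset[of "\<lambda>n. \<integral>\<^sup>+y. \<phi> n y \<partial>lborel" N] by simp
  qed
qed

text \<open>As the interval grows, so does the range of levels, and monotone convergence applies.\<close>

lemma rs_improper:
  fixes f :: "real \<Rightarrow> ennreal" and G :: "real \<Rightarrow> ereal"
  assumes G: "mono G" and meas: "(\<lambda>y. f (gen_inv G y)) \<in> borel_measurable lborel"
    and ev: "\<forall>\<^sub>F (a, b) in at_right 0 \<times>\<^sub>F at_top. has_RS_integral_on f G a b
      (\<integral>\<^sup>+y. f (gen_inv G y) * indicator {y. G a \<le> ereal y \<and> ereal y < G b} y \<partial>lborel)"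
  shows "has_RS_integral f G (stieltjes f G)"
proof -
  note [measurable] = meas level_range_borel[OF G]
  define R where "R a b = {y. G a \<le> ereal y \<and> ereal y < G b}" for a b
  have [measurable]: "R a b \<in> sets borel" for a b unfolding R_def by measurable
  define J where "J a b = (\<integral>\<^sup>+y. f (gen_inv G y) * indicator (R a b) y \<partial>lborel)" for a b
  have R_mono: "R a b \<subseteq> R a' b'" if "a' \<le> a" "b \<le> b'" for a b a' b'
    using monoD[OF G that(1)] monoD[OF G that(2)] by (auto simp: R_def intro: order_trans less_le_trans)
  have J_mono: "J a b \<le> J a' b'" if "a' \<le> a" "b \<le> b'" for a b a' b'
    unfolding J_def using R_mono[OF that] by (intro nn_integral_mono) (auto simp: indicator_def)
  have J_le: "J a b \<le> stieltjes f G" if "0 < a" "0 < b" for a b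
    unfolding J_def stieltjes_def using that
    by (intro nn_integral_mono) (auto simp: indicator_def R_def level_range_def)
  have inc: "incseq (\<lambda>n y. f (gen_inv G y) * indicator (R (1 / real (Suc n)) (real (Suc n))) y)"
  proof (intro incseq_SucI le_funI)
    fix n y
    have "R (1 / real (Suc n)) (real (Suc n)) \<subseteq> R (1 / real (Suc (Suc n))) (real (Suc (Suc n)))"
      by (intro R_mono) (auto simp: field_simps)
    then show "f (gen_inv G y) * indicator (R (1 / real (Suc n)) (real (Suc n))) y
      \<le> f (gen_inv G y) * indicator (R (1 / real (Suc (Suc n))) (real (Suc (Suc n)))) y"
      by (auto simp: indicator_def)
  qed
  have sup: "stieltjes f G = (SUP n. J (1 / real (Suc n)) (real (Suc n)))"
  proof -
    have "(SUP n. f (gen_inv G y) * indicator (R (1 / real (Suc n)) (real (Suc n))) y)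
        = f (gen_inv G y) * indicator (level_range G) y" for y
    proof (cases "y \<in> level_range G")
      case True
      then obtain u v where uv: "0 < u" "0 < v" "G u \<le> ereal y" "ereal y < G v" by (rule level_rangeD)
      obtain n1 where n1: "1 / real (Suc n1) < u" using uv(1) nat_approx_posE by blast
      obtain n2 where n2: "v < real n2" using reals_Archimedean2 by blast
      define n where "n = max n1 n2"
      have "1 / real (Suc n) \<le> 1 / real (Suc n1)" by (simp add: n_def frac_le)
      then have "y \<in> R (1 / real (Suc n)) (real (Suc n))"
        using monoD[OF G, of "1 / real (Suc n)" u] monoD[OF G, of v "real (Suc n)"] n1 n2 uv
        by (auto simp: R_def n_def intro: order_trans less_le_trans)
      then have "f (gen_inv G y) \<le> (SUP n. f (gen_inv G y) * indicator (R (1 / real (Suc n)) (real (Suc n))) y)"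
        by (intro SUP_upper2[of n]) auto
      moreover have "(SUP n. f (gen_inv G y) * indicator (R (1 / real (Suc n)) (real (Suc n))) y) \<le> f (gen_inv G y)"
        by (intro SUP_least) (auto simp: indicator_def)
      ultimately show ?thesis using True by simp
    next
      case False
      then have "y \<notin> R (1 / real (Suc n)) (real (Suc n))" for n
        by (auto simp: R_def level_range_def dest: spec[of _ "1 / real (Suc n)"] spec[of _ "real (Suc n)"])
      then show ?thesis using False by simp
    qed
    then show ?thesis unfolding stieltjes_def J_def
      by (subst nn_integral_monotone_convergence_SUP[symmetric, OF inc]) (simp_all)
  qed
  have ev_pos: "\<forall>\<^sub>F ab in at_right 0 \<times>\<^sub>F at_top. fst ab \<in> {0<..<\<epsilon>} \<and> B < snd ab" if "0 < \<epsilon>" for \<epsilon> B :: real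
    unfolding eventually_prod_filter
    by (rule exI[of _ "\<lambda>a. a \<in> {0<..<\<epsilon>}"], rule exI[of _ "\<lambda>b. B < b"])
      (use eventually_at_right_real[OF that] eventually_gt_at_top[of B] in auto)
  have "((\<lambda>(a, b). J a b) \<longlongrightarrow> stieltjes f G) (at_right 0 \<times>\<^sub>F at_top)"
  proof (rule order_tendstoI)
    fix c assume "c < stieltjes f G"
    then obtain n where n: "c < J (1 / real (Suc n)) (real (Suc n))" by (auto simp: sup less_SUP_iff)
    have "\<forall>\<^sub>F ab in at_right 0 \<times>\<^sub>F at_top. fst ab \<in> {0<..<1 / real (Suc n)} \<and> real (Suc n) < snd ab"
      by (rule ev_pos) simp
    then show "\<forall>\<^sub>F x in at_right 0 \<times>\<^sub>F at_top. c < (case x of (a, b) \<Rightarrow> J a b)"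
      by eventually_elim (use n J_mono in \<open>auto intro!: less_le_trans[OF n]\<close>)
  next
    fix c assume "stieltjes f G < c"
    then show "\<forall>\<^sub>F x in at_right 0 \<times>\<^sub>F at_top. (case x of (a, b) \<Rightarrow> J a b) < c"
      using ev_pos[of 1 0] by (auto elim!: eventually_mono intro: le_less_trans[OF J_le])
  qed
  moreover have "\<forall>\<^sub>F (a, b) in at_right 0 \<times>\<^sub>F at_top. has_RS_integral_on f G a b (J a b)"
    using ev by (simp add: J_def R_def)
  ultimately show ?thesis unfolding has_RS_integral_def by blast
qed

lemma has_RS_integral_unique:
  assumes "has_RS_integral f G I" "has_RS_integral f G I'" shows "I = I'"
proof -
  obtain J where J: "\<forall>\<^sub>F (a, b) in at_right 0 \<times>\<^sub>F at_top. has_RS_integral_on f G a b (J a b)"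
      "((\<lambda>(a, b). J a b) \<longlongrightarrow> I) (at_right 0 \<times>\<^sub>F at_top)"
    using assms(1) unfolding has_RS_integral_def by blast
  obtain J' where J': "\<forall>\<^sub>F (a, b) in at_right 0 \<times>\<^sub>F at_top. has_RS_integral_on f G a b (J' a b)"
      "((\<lambda>(a, b). J' a b) \<longlongrightarrow> I') (at_right 0 \<times>\<^sub>F at_top)"
    using assms(2) unfolding has_RS_integral_def by blast
  have "\<forall>\<^sub>F ab in at_right 0 \<times>\<^sub>F at_top. (fst ab :: real) < 1 \<and> (1::real) < snd ab"
    unfolding eventually_prod_filter
    by (rule exI[of _ "\<lambda>a. a < (1::real)"], rule exI[of _ "\<lambda>b. (1::real) < b"])
      (use eventually_at_right_real[of 0 1] eventually_gt_at_top[of "1::real"] in \<open>auto elim!: eventually_mono\<close>)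
  with J(1) J'(1) have "\<forall>\<^sub>F x in at_right 0 \<times>\<^sub>F at_top. (case x of (a, b) \<Rightarrow> J' a b) = (case x of (a, b) \<Rightarrow> J a b)"
    by eventually_elim
      (auto simp: has_RS_integral_on_def intro: tendsto_unique[OF mesh_filter_neq_bot[OF less_imp_le[OF less_trans]]])
  with J'(2) have "((\<lambda>(a, b). J a b) \<longlongrightarrow> I') (at_right 0 \<times>\<^sub>F at_top)"
    by (simp cong: tendsto_cong)
  with J(2) show ?thesis by (rule tendsto_unique[rotated]) (simp add: prod_filter_eq_bot)
qed

lemma RS_integral_eq: "has_RS_integral f G I \<Longrightarrow> RS_integral f G = I"
  unfolding RS_integral_def by (blast intro: has_RS_integral_unique)

text \<open>For non-increasing \<open>f\<close> the right end points give the lower sums. The grid of mesh \<open>2\<^sup>-\<^sup>n\<close> has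
  \<open>4\<^sup>n\<close> cells and covers \<open>[0,2\<^sup>n]\<close>, so one limit replaces the limits for the mesh and for both ends.\<close>

definition lower_sum :: "(real \<Rightarrow> ennreal) \<Rightarrow> (real \<Rightarrow> ereal) \<Rightarrow> nat \<Rightarrow> ennreal" where
  "lower_sum f G n = (\<Sum>i<4 ^ n. f (real (Suc i) / 2 ^ n) * rs_incr G (real i / 2 ^ n) (real (Suc i) / 2 ^ n))"

text \<open>The tag never precedes the crossing time and \<open>f\<close> is non-increasing, so the sums are bounded by
  their limit. Right-continuity of \<open>G\<close> at \<open>0\<close> ensures that no level is crossed at \<open>0\<close>.\<close>

lemma lower_sum_tendsto:
  fixes f :: "real \<Rightarrow> ennreal" and G :: "real \<Rightarrow> ereal"
  assumes G: "mono G" and G0: "(G \<longlongrightarrow> G 0) (at_right 0)"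
    and f: "\<And>s s'. 0 < s \<Longrightarrow> s \<le> s' \<Longrightarrow> f s' \<le> f s"
    and cont: "AE y in lborel. y \<in> level_range G \<longrightarrow> isCont f (gen_inv G y)"
  shows "lower_sum f G n \<le> stieltjes f G" "lower_sum f G \<longlonglongrightarrow> stieltjes f G"
proof -
  have "\<exists>\<phi>. \<phi> \<in> borel_measurable lborel \<and> lower_sum f G n = (\<integral>\<^sup>+y. \<phi> y \<partial>lborel) \<and>
     (\<forall>y. \<not> (G 0 \<le> ereal y \<and> ereal y < G (2 ^ n)) \<longrightarrow> \<phi> y = 0) \<and>
     (\<forall>y. G 0 \<le> ereal y \<longrightarrow> ereal y < G (2 ^ n) \<longrightarrow>
       (\<exists>x. \<phi> y = f x \<and> gen_inv G y \<le> x \<and> x \<le> gen_inv G y + 1 / 2 ^ n))" for n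
  proof -
    have "(2 * 2 :: real) ^ n = 2 ^ n * 2 ^ n" by (rule power_mult_distrib)
    then have "real (4 ^ n) = 2 ^ n * 2 ^ n" by simp
    then have four: "real (4 ^ n) / 2 ^ n = 2 ^ n" by (rule ssubst) simp
    obtain \<phi> where \<phi>: "\<phi> \<in> borel_measurable lborel"
      "(\<Sum>i<4^n. f (real (Suc i) / 2 ^ n) * rs_incr G (real i / 2 ^ n) (real (Suc i) / 2 ^ n)) = (\<integral>\<^sup>+y. \<phi> y \<partial>lborel)"
      "\<And>y. \<not> (G 0 \<le> ereal y \<and> ereal y < G (2 ^ n)) \<Longrightarrow> \<phi> y = 0"
      "\<And>y. G 0 \<le> ereal y \<Longrightarrow> ereal y < G (2 ^ n) \<Longrightarrow>
         \<exists>i\<in>{..<4^n}. \<phi> y = f (real (Suc i) / 2 ^ n) \<and> real i / 2 ^ n \<le> gen_inv G y \<and> gen_inv G y \<le> real (Suc i) / 2 ^ n"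
    proof (rule rs_cells[OF G, of "{..<4^n}" 0 "\<lambda>i. real i / 2 ^ n" "\<lambda>i. real (Suc i) / 2 ^ n" "2 ^ n"
          f "\<lambda>i. real (Suc i) / 2 ^ n"])
      show "0 \<le> real i / 2 ^ n \<and> real i / 2 ^ n \<le> real (Suc i) / 2 ^ n \<and> real (Suc i) / 2 ^ n \<le> 2 ^ n"
        if "i \<in> {..<4 ^ n}" for i
      proof -
        have "real (Suc i) \<le> real (4 ^ n)" using that by (subst of_nat_le_iff) auto
        then have "real (Suc i) / 2 ^ n \<le> real (4 ^ n) / 2 ^ n" by (intro divide_right_mono) auto
        then show ?thesis unfolding four by (auto intro!: divide_right_mono)
      qed
      show "(\<Sum>i<4 ^ n. h (real (Suc i) / 2 ^ n) - h (real i / 2 ^ n)) = h (2 ^ n) - h 0" for h :: "real \<Rightarrow> real"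
        using sum_lessThan_telescope[of "\<lambda>i. h (real i / 2 ^ n)" "4 ^ n"] by (simp only: four) simp
    qed auto
    have "\<exists>x. \<phi> y = f x \<and> gen_inv G y \<le> x \<and> x \<le> gen_inv G y + 1 / 2 ^ n"
      if "G 0 \<le> ereal y" "ereal y < G (2 ^ n)" for y
      using \<phi>(4)[OF that] by (force simp: add_divide_distrib)
    with \<phi> show ?thesis unfolding lower_sum_def by blast
  qed
  then obtain \<phi> where \<phi>: "\<And>n. \<phi> n \<in> borel_measurable lborel"
     "\<And>n. lower_sum f G n = (\<integral>\<^sup>+y. \<phi> n y \<partial>lborel)"
     "\<And>n y. \<not> (G 0 \<le> ereal y \<and> ereal y < G (2 ^ n)) \<Longrightarrow> \<phi> n y = 0"
     "\<And>n y. G 0 \<le> ereal y \<Longrightarrow> ereal y < G (2 ^ n) \<Longrightarrow>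
       \<exists>x. \<phi> n y = f x \<and> gen_inv G y \<le> x \<and> x \<le> gen_inv G y + 1 / 2 ^ n"
    by metis
  have ae: "AE y in lborel. G 0 \<le> ereal y \<longrightarrow> (\<exists>s>0. G s \<le> ereal y)"
    using AE_lborel_singleton[of "real_of_ereal (G 0)"]
  proof eventually_elim
    fix y assume y: "y \<noteq> real_of_ereal (G 0)"
    show "G 0 \<le> ereal y \<longrightarrow> (\<exists>s>0. G s \<le> ereal y)"
    proof
      assume "G 0 \<le> ereal y"
      with y have "G 0 < ereal y" by (cases "G 0") auto
      from order_tendstoD(2)[OF G0 this] have "\<forall>\<^sub>F s in at_right 0. 0 < s \<and> G s \<le> ereal y"
        using eventually_at_right_less[of "0::real"] by eventually_elim auto
      then show "\<exists>s>0. G s \<le> ereal y" by (auto dest: eventually_happens)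
    qed
  qed
  define h where "h y = f (gen_inv G y) * indicator (level_range G) y" for y
  have le: "AE y in lborel. \<phi> n y \<le> h y" for n
    using ae
  proof eventually_elim
    fix y assume ae: "G 0 \<le> ereal y \<longrightarrow> (\<exists>s>0. G s \<le> ereal y)"
    show "\<phi> n y \<le> h y"
    proof (cases "G 0 \<le> ereal y \<and> ereal y < G (2 ^ n)")
      case True
      with ae have y: "y \<in> level_range G" by (auto simp: level_range_def intro: exI[of _ "2 ^ n"])
      obtain x where "\<phi> n y = f x" "gen_inv G y \<le> x" using \<phi>(4) True by blast
      with f[OF gen_inv_pos[OF G y]] y show ?thesis by (simp add: h_def)
    qed (use \<phi>(3) in auto)
  qed
  have int_h: "(\<integral>\<^sup>+y. h y \<partial>lborel) = stieltjes f G" by (simp add: h_def stieltjes_def)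
  show up: "lower_sum f G n \<le> stieltjes f G" for n
    unfolding \<phi>(2) int_h[symmetric] by (rule nn_integral_mono_AE[OF le])
  have "AE y in lborel. (\<lambda>n. \<phi> n y) \<longlonglongrightarrow> h y"
    using ae cont
  proof eventually_elim
    fix y assume ae: "G 0 \<le> ereal y \<longrightarrow> (\<exists>s>0. G s \<le> ereal y)"
      and c: "y \<in> level_range G \<longrightarrow> isCont f (gen_inv G y)"
    show "(\<lambda>n. \<phi> n y) \<longlonglongrightarrow> h y"
    proof (cases "y \<in> level_range G")
      case True
      then obtain u v where uv: "0 < u" "0 < v" "G u \<le> ereal y" "ereal y < G v" by (rule level_rangeD)
      have "G 0 \<le> ereal y" using monoD[OF G, of 0 u] uv by (auto intro: order_trans)
      moreover have "\<forall>\<^sub>F n in sequentially. ereal y < G (2 ^ n)"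
      proof -
        obtain N where N: "v < 2 ^ N" using real_arch_pow[of 2 v] by auto
        have "ereal y < G (2 ^ n)" if "N \<le> n" for n
        proof -
          have "(2::real) ^ N \<le> 2 ^ n" using that by simp
          with N have "v \<le> 2 ^ n" by linarith
          from monoD[OF G this] uv(4) show ?thesis by simp
        qed
        then show ?thesis by (auto simp: eventually_sequentially)
      qed
      ultimately have ev: "\<forall>\<^sub>F n in sequentially. \<exists>x. \<phi> n y = f x \<and> gen_inv G y \<le> x \<and> x \<le> gen_inv G y + 1 / 2 ^ n"
        using \<phi>(4) by (auto elim!: eventually_mono)
      have "\<exists>x. (gen_inv G y \<le> x \<and> x \<le> gen_inv G y + 1 / 2 ^ n) \<and>
          ((\<exists>x. \<phi> n y = f x \<and> gen_inv G y \<le> x \<and> x \<le> gen_inv G y + 1 / 2 ^ n) \<longrightarrow> \<phi> n y = f x)" for n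
        by (cases "\<exists>x. \<phi> n y = f x \<and> gen_inv G y \<le> x \<and> x \<le> gen_inv G y + 1 / 2 ^ n")
          (blast, auto intro!: exI[of _ "gen_inv G y"])
      then obtain x where x2: "\<And>n. gen_inv G y \<le> x n \<and> x n \<le> gen_inv G y + 1 / 2 ^ n"
        and x1: "\<And>n. (\<exists>x. \<phi> n y = f x \<and> gen_inv G y \<le> x \<and> x \<le> gen_inv G y + 1 / 2 ^ n) \<longrightarrow> \<phi> n y = f (x n)"
        by metis
      have x: "\<forall>\<^sub>F n in sequentially. \<phi> n y = f (x n)"
        using ev by eventually_elim (use x1 in blast)
      have "x \<longlonglongrightarrow> gen_inv G y"
      proof (rule tendsto_sandwich[where f = "\<lambda>_. gen_inv G y"])
        show "(\<lambda>n. gen_inv G y + 1 / 2 ^ n) \<longlonglongrightarrow> gen_inv G y"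
          using tendsto_add[OF tendsto_const[of "gen_inv G y"] LIMSEQ_divide_realpow_zero[of 2 1]] by simp
      qed (use x2 in auto)
      from isCont_tendsto_compose[OF _ this, of f] c True
      have "(\<lambda>n. f (x n)) \<longlonglongrightarrow> h y" by (simp add: h_def)
      then show ?thesis using x by (simp cong: tendsto_cong)
    next
      case False
      then have "\<phi> n y = 0" for n
        using \<phi>(3)[of y n] ae by (cases "G 0 \<le> ereal y \<and> ereal y < G (2 ^ n)")
          (auto simp: level_range_def intro: exI[of _ "2 ^ n"])
      then show ?thesis using False by (simp add: h_def)
    qed
  qed
  from nn_integral_le_liminf_AE[OF \<phi>(1) this] have "stieltjes f G \<le> liminf (lower_sum f G)"
    by (simp add: int_h \<phi>(2)[symmetric])
  then show "lower_sum f G \<longlonglongrightarrow> stieltjes f G"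
    using up by (rule tendsto_of_le_liminf)
qed

section \<open>Integration by parts along a path\<close>

lemma borel_measurable_mono_ennreal:
  fixes f :: "real \<Rightarrow> ennreal"
  assumes "mono f" shows "f \<in> borel_measurable borel"
proof -
  have "mono (\<lambda>x. - exp_neg (f x))" using assms by (auto simp: mono_def exp_neg_le_iff)
  then have [measurable]: "(\<lambda>x. - exp_neg (f x)) \<in> borel_measurable borel" by (rule borel_measurable_mono)
  have "(\<lambda>x. neg_log (- (- exp_neg (f x)))) \<in> borel_measurable borel" by measurable
  then show ?thesis by simp
qed

text \<open>The exponential transforms \<open>f\<close> into a bounded real function with the same continuity points.\<close>

lemma countable_discont_mono_ennreal:
  fixes f :: "real \<Rightarrow> ennreal"
  assumes "mono f" shows "countable {x. \<not> isCont f x}"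
proof -
  have "mono (\<lambda>x. - exp_neg (f x))" using assms by (auto simp: mono_def exp_neg_le_iff)
  then have "countable {x. \<not> isCont (\<lambda>x. - exp_neg (f x)) x}" by (rule mono_ctble_discont)
  moreover have "isCont f x" if "isCont (\<lambda>x. - exp_neg (f x)) x" for x
    using continuous_minus[OF that] by (auto simp: isCont_def intro: tendsto_from_exp_neg)
  then have "{x. \<not> isCont f x} \<subseteq> {x. \<not> isCont (\<lambda>x. - exp_neg (f x)) x}" by auto
  ultimately show ?thesis using countable_subset by blast
qed

lemma level_emeasure_pos:
  assumes "G u < G v" shows "0 < emeasure lborel {y. G u \<le> ereal y \<and> ereal y < (G v :: ereal)}"
proof -
  obtain p where p: "G u < ereal p" "ereal p < G v" using ereal_dense2[OF assms] by auto
  obtain q where q: "ereal p < ereal q" "ereal q < G v" using ereal_dense2[OF p(2)] by auto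
  have "{p..q} \<subseteq> {y. G u \<le> ereal y \<and> ereal y < G v}"
    using p q by (auto intro: order_trans less_imp_le le_less_trans order.strict_trans1)
       (meson ereal_less_eq(3) le_less_trans less_imp_le order_trans)+
  then have "emeasure lborel {p..q} \<le> emeasure lborel {y. G u \<le> ereal y \<and> ereal y < G v}"
    by (intro emeasure_mono) auto
  moreover have "0 < emeasure lborel {p..q}" using q by simp
  ultimately show ?thesis by (rule less_le_trans[rotated])
qed

lemma has_RS_integral_cong:
  assumes "\<And>s. 0 < s \<Longrightarrow> f s = f' s" "\<And>s. 0 < s \<Longrightarrow> G s = G' s"
  shows "has_RS_integral f G I \<longleftrightarrow> has_RS_integral f' G' I"
proof -
  have *: "has_RS_integral_on f G a b J \<longleftrightarrow> has_RS_integral_on f' G' a b J" if "0 < a" for a b J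
    unfolding has_RS_integral_on_def
  proof (rule tendsto_cong)
    have "rs_sum f G p = rs_sum f' G' p" if p: "p tagged_division_of {a..b}" for p
      unfolding rs_sum_def
    proof (intro sum.cong refl, clarify)
      fix x k assume xk: "(x, k) \<in> p"
      obtain c d where k: "k = cbox c d" using tagged_division_ofD(4)[OF p xk] by blast
      have "x \<in> k" "k \<subseteq> {a..b}" using tagged_division_ofD(2,3)[OF p xk] by auto
      then have "0 < x" "0 < Inf k" "0 < Sup k" using k \<open>0 < a\<close> by auto
      then show "f x * rs_incr G (Inf k) (Sup k) = f' x * rs_incr G' (Inf k) (Sup k)"
        using assms by (simp add: rs_incr_def)
    qed
    then show "\<forall>\<^sub>F p in mesh_filter a b. rs_sum f G p = rs_sum f' G' p"
      unfolding eventually_mesh_filter by (intro exI[of _ 1]) auto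
  qed
  have "\<forall>\<^sub>F ab in at_right 0 \<times>\<^sub>F at_top. 0 < (fst ab :: real)"
    unfolding eventually_prod_filter
    by (rule exI[of _ "\<lambda>a. 0 < (a::real)"], rule exI[of _ "\<lambda>b. True"])
      (use eventually_at_right_less[of "0::real"] in auto)
  then have "(\<forall>\<^sub>F (a, b) in at_right 0 \<times>\<^sub>F at_top. has_RS_integral_on f G a b (J a b)) \<longleftrightarrow>
      (\<forall>\<^sub>F (a, b) in at_right 0 \<times>\<^sub>F at_top. has_RS_integral_on f' G' a b (J a b))" for J
    by (intro eventually_cong) (auto elim!: eventually_mono simp: *)
  then show ?thesis unfolding has_RS_integral_def by simp
qed

lemma eventually_improper:
  assumes "\<forall>\<^sub>F a in at_right (0::real). Q a" "\<forall>\<^sub>F b in at_top. R b"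
    "\<And>a b :: real. 0 < a \<Longrightarrow> a \<le> b \<Longrightarrow> Q a \<Longrightarrow> R b \<Longrightarrow> P a b"
  shows "\<forall>\<^sub>F (a, b) in at_right 0 \<times>\<^sub>F at_top. P a b"
  unfolding eventually_prod_filter
proof (intro exI conjI allI impI)
  show "\<forall>\<^sub>F a in at_right 0. Q a \<and> 0 < a \<and> a < 1"
    using assms(1) eventually_at_right_real[of 0 1] by (auto intro: eventually_conj elim: eventually_elim2)
  show "\<forall>\<^sub>F b in at_top. R b \<and> 1 < b"
    using assms(2) eventually_gt_at_top[of 1] by (rule eventually_conj)
qed (use assms(3) in auto)

text \<open>A distribution function \<open>\<Phi>\<close> on \<open>[0,\<infinity>)\<close> and a path \<open>X\<close> for which both pathwise integrals exist.
  The last three conditions hold almost surely for a subordinator. The first of them excludes common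
  jumps. The other two concern the ends of the support of \<open>\<Phi>\<close>: the path must not leave \<open>0\<close> exactly
  at the lower end, where \<open>-log \<Phi>\<close> ceases to be infinite, and it must not become infinite exactly at
  the upper end, where \<open>-log \<Phi>\<close> becomes \<open>0\<close>. In either case the products \<open>0 * \<infinity>\<close> at this point
  would make the Riemann--Stieltjes sums depend on the tags.\<close>

locale compatible_path =
  fixes \<Phi> :: "real \<Rightarrow> real" and X :: "real \<Rightarrow> ennreal"
  assumes mono_\<Phi>: "mono \<Phi>" and rc_\<Phi>: "\<And>x. continuous (at_right x) \<Phi>"
    and \<Phi>_neg: "\<And>x. x < 0 \<Longrightarrow> \<Phi> x = 0" and \<Phi>_top: "(\<Phi> \<longlongrightarrow> 1) at_top"
    and mono_X: "mono X" and rc_X: "\<And>x. 0 \<le> x \<Longrightarrow> continuous (at_right x) X"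
    and X_0: "\<And>x. x \<le> 0 \<Longrightarrow> X x = 0"
    and no_common_jump: "\<And>c. 0 < c \<Longrightarrow> isCont \<Phi> c \<or> isCont X c"
    and lower_end: "\<And>c. 0 < c \<Longrightarrow> c = Inf {s. 0 < \<Phi> s} \<Longrightarrow> X c = 0 \<Longrightarrow> \<exists>d>c. X d = 0"
    and upper_end: "\<And>c. 0 < c \<Longrightarrow> c = Inf {s. \<Phi> s = 1} \<Longrightarrow> X c = \<top> \<Longrightarrow> \<exists>d<c. X d = \<top>"
begin

definition \<Phi>m :: "real \<Rightarrow> real" where "\<Phi>m s = Lim (at_left s) \<Phi>"
definition f :: "real \<Rightarrow> ennreal" where "f s = neg_log (\<Phi>m s)"
definition G :: "real \<Rightarrow> ereal" where "G s = enn2ereal (X s)"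
definition K :: "real \<Rightarrow> ereal" where "K s = elog (\<Phi> s)"
definition lo :: real where "lo = Inf {s. 0 < \<Phi> s}"
definition up :: real where "up = Inf {s. \<Phi> s = 1}"

lemma \<Phi>_nonneg: "0 \<le> \<Phi> s"
  using monoD[OF mono_\<Phi>, of "min s (-1)" s] \<Phi>_neg[of "min s (-1)"] by simp

lemma \<Phi>_le_1: "\<Phi> s \<le> 1"
proof (rule tendsto_lowerbound[OF \<Phi>_top])
  show "\<forall>\<^sub>F i in at_top. \<Phi> s \<le> \<Phi> i"
    using eventually_ge_at_top[of s] by eventually_elim (rule monoD[OF mono_\<Phi>])
qed simp

lemma tendsto_\<Phi>m: "(\<Phi> \<longlongrightarrow> \<Phi>m s) (at_left s)"
proof -
  have bdd: "bdd_above (\<Phi> ` {..<s})" using \<Phi>_le_1 by (intro bdd_aboveI2)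
  have "(\<Phi> \<longlongrightarrow> Sup (\<Phi> ` {..<s})) (at_left s)"
  proof (rule increasing_tendsto)
    show "\<forall>\<^sub>F n in at_left s. \<Phi> n \<le> Sup (\<Phi> ` {..<s})"
      using eventually_at_left_real[of "s - 1" s] by (auto elim!: eventually_mono intro!: cSup_upper bdd)
    fix x assume "x < Sup (\<Phi> ` {..<s})"
    then obtain u where u: "u < s" "x < \<Phi> u"
      by (subst (asm) less_cSup_iff) (auto intro: bdd)
    show "\<forall>\<^sub>F n in at_left s. x < \<Phi> n"
      using eventually_at_left_real[OF u(1)]
      by eventually_elim (use u monoD[OF mono_\<Phi>, of u] in \<open>auto intro: less_le_trans\<close>)
  qed
  then show ?thesis unfolding \<Phi>m_def by (simp add: tendsto_Lim)
qed

lemma \<Phi>_le_\<Phi>m: "u < s \<Longrightarrow> \<Phi> u \<le> \<Phi>m s"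
  by (rule tendsto_lowerbound[OF tendsto_\<Phi>m])
    (auto intro!: eventually_mono[OF eventually_at_left_real[of u s]] monoD[OF mono_\<Phi>])

lemma \<Phi>m_le: assumes "\<And>u. u < s \<Longrightarrow> \<Phi> u \<le> c" shows "\<Phi>m s \<le> c"
  by (rule tendsto_upperbound[OF tendsto_\<Phi>m])
    (auto intro!: eventually_mono[OF eventually_at_left_real[of "s - 1" s]] assms)

lemma \<Phi>m_le_\<Phi>: "\<Phi>m s \<le> \<Phi> s"
  by (rule \<Phi>m_le) (auto intro: monoD[OF mono_\<Phi>])

lemma \<Phi>m_bounds: "0 \<le> \<Phi>m s" "\<Phi>m s \<le> 1"
  using \<Phi>_le_\<Phi>m[of "s - 1" s] \<Phi>_nonneg[of "s - 1"] \<Phi>m_le_\<Phi>[of s] \<Phi>_le_1[of s] by linarith+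

lemma \<Phi>m_mono: "s \<le> s' \<Longrightarrow> \<Phi>m s \<le> \<Phi>m s'"
  by (rule \<Phi>m_le) (auto intro: \<Phi>_le_\<Phi>m)

lemma f_antimono: "s \<le> s' \<Longrightarrow> f s' \<le> f s"
  unfolding f_def by (intro neg_log_mono \<Phi>m_bounds \<Phi>m_mono)

lemma \<Phi>m_eq: "isCont \<Phi> s \<Longrightarrow> \<Phi>m s = \<Phi> s"
  using tendsto_\<Phi>m[of s] by (auto simp: isCont_def filterlim_at_split intro: tendsto_unique[of "at_left s"])

text \<open>For \<open>s\<close> near \<open>c\<close> the left limit at \<open>s\<close> lies between the values of \<open>\<Phi>\<close> at \<open>s\<close> and at the
  point \<open>s - |s - c|\<close> to its left, and both tend to \<open>\<Phi> c\<close>.\<close>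

lemma isCont_f: assumes "isCont \<Phi> c" shows "isCont f c"
proof -
  have "(\<Phi>m \<longlongrightarrow> \<Phi> c) (at c)"
  proof (rule tendsto_sandwich)
    have "isCont (\<lambda>s. \<Phi> (s - \<bar>s - c\<bar>)) c"
      using isCont_o2[of c "\<lambda>s. s - \<bar>s - c\<bar>" \<Phi>] assms by simp
    then show "((\<lambda>s. \<Phi> (s - \<bar>s - c\<bar>)) \<longlongrightarrow> \<Phi> c) (at c)" by (simp add: isCont_def)
    show "(\<Phi> \<longlongrightarrow> \<Phi> c) (at c)" using assms by (simp add: isCont_def)
    show "\<forall>\<^sub>F s in at c. \<Phi> (s - \<bar>s - c\<bar>) \<le> \<Phi>m s"
      by (auto simp: eventually_at_filter intro!: always_eventually \<Phi>_le_\<Phi>m)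
  qed (simp add: \<Phi>m_le_\<Phi>)
  then have "(f \<longlongrightarrow> neg_log (\<Phi> c)) (at c)"
    unfolding f_def by (rule tendsto_neg_log) (simp_all add: \<Phi>m_bounds \<Phi>_nonneg \<Phi>_le_1)
  then show ?thesis by (simp add: isCont_def f_def \<Phi>m_eq[OF assms])
qed

lemma mono_G: "mono G" by (auto simp: mono_def G_def less_eq_ennreal.rep_eq[symmetric] monoD[OF mono_X])

lemma mono_K: "mono K"
proof (rule monoI)
  fix x y :: real assume "x \<le> y"
  then have "neg_log (\<Phi> y) \<le> neg_log (\<Phi> x)"
    by (intro neg_log_mono \<Phi>_nonneg \<Phi>_le_1 monoD[OF mono_\<Phi>])
  then show "K x \<le> K y" by (simp add: K_def elog_eq \<Phi>_nonneg \<Phi>_le_1 less_eq_ennreal.rep_eq)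
qed

lemma K_le_0: "K s \<le> 0"
  by (simp add: K_def elog_eq \<Phi>_nonneg \<Phi>_le_1)

lemma K_less_iff: "K s < K s' \<longleftrightarrow> \<Phi> s < \<Phi> s'"
  using \<Phi>_nonneg[of s] \<Phi>_nonneg[of s'] by (auto simp: K_def elog_def)

lemma K_minf_iff: "K s = -\<infinity> \<longleftrightarrow> \<Phi> s = 0"
  by (simp add: K_def elog_def)

lemma K_0_iff: "K s = 0 \<longleftrightarrow> \<Phi> s = 1"
  using \<Phi>_nonneg[of s] by (auto simp: K_def elog_def)

lemma isCont_G: "isCont X c \<Longrightarrow> isCont G c"
  by (simp add: isCont_def G_def[abs_def])

lemma isCont_K: "isCont \<Phi> c \<Longrightarrow> isCont K c"
  unfolding isCont_def K_def by (rule tendsto_elog) (simp_all add: \<Phi>_nonneg \<Phi>_le_1)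

lemma countable_discont_\<Phi>: "countable {c. \<not> isCont \<Phi> c}"
  by (rule mono_ctble_discont[OF mono_\<Phi>])

lemma AE_cont_\<Phi>: "AE y in lborel. y \<in> level_range G \<longrightarrow> isCont \<Phi> (gen_inv G y)"
  using AE_gen_inv_notin[OF mono_G countable_discont_\<Phi>] no_common_jump by (auto intro: isCont_G)

lemma AE_cont_X: "AE x in lborel. x \<in> level_range K \<longrightarrow> isCont X (gen_inv K x)"
  using AE_gen_inv_notin[OF mono_K countable_discont_mono_ennreal[OF mono_X]] no_common_jump
  by (auto intro: isCont_K)

lemma borel_X [measurable]: "X \<in> borel_measurable borel"
  by (rule borel_measurable_mono_ennreal[OF mono_X])

lemma borel_\<Phi>m [measurable]: "\<Phi>m \<in> borel_measurable borel"
  by (rule borel_measurable_mono) (auto simp: mono_def intro: \<Phi>m_mono)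

lemma borel_f [measurable]: "f \<in> borel_measurable borel"
  unfolding f_def by measurable

lemma ev_\<Phi>_gt: "p < 1 \<Longrightarrow> \<forall>\<^sub>F b in at_top. p < \<Phi> b"
  by (rule order_tendstoD(1)[OF \<Phi>_top])

lemma \<Phi>_ge_lo: "0 < \<Phi> s \<Longrightarrow> lo \<le> s"
  unfolding lo_def using \<Phi>_neg by (intro cInf_lower bdd_belowI[of _ 0]) (auto simp: not_less[symmetric])

lemma \<Phi>_0_lo: "s < lo \<Longrightarrow> \<Phi> s = 0"
  using \<Phi>_ge_lo[of s] \<Phi>_nonneg[of s] by (auto simp: less_eq_real_def)

lemma lo_nonneg: "0 \<le> lo"
proof -
  obtain s where "0 < \<Phi> s" using eventually_happens[OF ev_\<Phi>_gt[of 0]] by auto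
  then show ?thesis unfolding lo_def using \<Phi>_neg by (intro cInf_greatest) (auto simp: not_less[symmetric])
qed

lemma \<Phi>_pos: assumes "lo < s" shows "0 < \<Phi> s"
proof -
  obtain s' where "0 < \<Phi> s'" using eventually_happens[OF ev_\<Phi>_gt[of 0]] by auto
  then have "\<exists>x\<in>{s. 0 < \<Phi> s}. x < s" using assms cInf_lessD[of "{s. 0 < \<Phi> s}" s] by (auto simp: lo_def)
  then obtain x where "0 < \<Phi> x" "x < s" by auto
  then show ?thesis using monoD[OF mono_\<Phi>, of x s] by linarith
qed

lemma \<Phi>_up:
  assumes "\<Phi> s = 1" shows "\<Phi> up = 1" "up \<le> s" "0 \<le> up" "\<And>u. u < up \<Longrightarrow> \<Phi> u < 1"
proof -
  have bdd: "bdd_below {s. \<Phi> s = 1}" using \<Phi>_neg by (intro bdd_belowI[of _ 0]) (force simp: not_less[symmetric])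
  show "up \<le> s" unfolding up_def using bdd assms by (intro cInf_lower) auto
  show "0 \<le> up" unfolding up_def using assms \<Phi>_neg by (intro cInf_greatest) (force simp: not_less[symmetric])+
  show "\<Phi> u < 1" if "u < up" for u
  proof -
    have "\<Phi> u \<noteq> 1" using that cInf_lower[OF _ bdd, of u] by (auto simp: up_def)
    with \<Phi>_le_1[of u] show ?thesis by simp
  qed
  have "1 \<le> \<Phi> up"
  proof (rule tendsto_lowerbound)
    show "(\<Phi> \<longlongrightarrow> \<Phi> up) (at_right up)" using rc_\<Phi>[of up] by (simp add: continuous_within)
    show "\<forall>\<^sub>F x in at_right up. 1 \<le> \<Phi> x"
      using eventually_at_right_less[of up]
    proof eventually_elim
      fix x assume "up < x"
      then obtain z where "\<Phi> z = 1" "z < x" using cInf_lessD[of "{s. \<Phi> s = 1}" x] assms by (auto simp: up_def)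
      then show "1 \<le> \<Phi> x" using monoD[OF mono_\<Phi>, of z x] by simp
    qed
  qed simp
  with \<Phi>_le_1[of up] show "\<Phi> up = 1" by simp
qed

lemma f_finite: assumes "lo < s" shows "f s < \<top>"
proof -
  have "0 < \<Phi>m s" using \<Phi>_le_\<Phi>m[of "(lo + s) / 2" s] \<Phi>_pos[of "(lo + s) / 2"] assms by auto
  then show ?thesis using less_exp_neg_iff[of 0 \<top>] exp_neg_less_eq_iff[of "\<Phi>m s" \<top>] \<Phi>m_bounds[of s]
    by (simp add: f_def)
qed

lemma f_top: "s \<le> lo \<Longrightarrow> f s = \<top>"
  using \<Phi>m_le[of s 0] \<Phi>_0_lo \<Phi>m_bounds(1)[of s] by (simp add: f_def)

lemma f_pos: assumes "\<Phi> s < 1" shows "0 < f s"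
  using assms \<Phi>m_le_\<Phi>[of s] \<Phi>m_bounds[of s] less_exp_neg_iff[of "\<Phi>m s" 0] by (simp add: f_def)

lemma f_0: assumes "\<Phi> u = 1" "u < s" shows "f s = 0"
  using \<Phi>_le_\<Phi>m[OF assms(2)] \<Phi>m_bounds(2)[of s] assms by (simp add: f_def)

lemma ev_X_less: assumes "0 \<le> c" "X c < x" shows "\<forall>\<^sub>F d in at_right c. X d < x"
  using rc_X[OF assms(1)] assms(2) by (auto simp: continuous_within intro: order_tendstoD(2))

lemma X_finite_beyond: assumes "0 \<le> c" "X c < \<top>" obtains d where "c < d" "X d < \<top>"
proof -
  have "\<forall>\<^sub>F d in at_right c. X d < \<top> \<and> c < d"
    using ev_X_less[OF assms] eventually_at_right_less[of c] by eventually_elim simp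
  then show ?thesis using that eventually_happens[of _ "at_right c"] by auto
qed

lemma X_up_finite:
  assumes "\<Phi> b = 1" "\<And>c. 0 < c \<Longrightarrow> c \<le> b \<Longrightarrow> X c = \<top> \<Longrightarrow> \<Phi> c = 1"
  obtains d where "up < d" "X d < \<top>"
proof -
  have "X up \<noteq> \<top>"
  proof
    assume *: "X up = \<top>"
    then have "0 < up" using X_0[of up] by (auto simp: not_less[symmetric])
    with upper_end[OF this _ *] obtain d where d: "d < up" "X d = \<top>" by (auto simp: up_def)
    then have "0 < d" using X_0[of d] by (auto simp: not_less[symmetric])
    with d \<Phi>_up[OF assms(1)] assms(2)[of d] show False by force
  qed
  then show ?thesis using X_finite_beyond[of up] \<Phi>_up(3)[OF assms(1)] that by (auto simp: less_top)
qed

text \<open>The integral is infinite if the path grows below the lower end of the support, or if it is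
  killed before the upper end. In all other cases the integrand is dominated: near the lower end
  the path still vanishes, so crossing times stay away from it, and if the path is killed at all
  then this happens strictly after the upper end, where the integrand vanishes.\<close>

lemma has_RS_integral_on_wrt_path:
  assumes ab: "0 < a" "a \<le> b"
    and b: "\<And>c. 0 < c \<Longrightarrow> X c = \<top> \<Longrightarrow> \<Phi> c < 1 \<Longrightarrow> c \<le> b \<Longrightarrow> a < c \<and> X a < \<top>"
    and a: "0 < lo \<Longrightarrow> X lo \<noteq> 0 \<Longrightarrow> a < lo \<and> X a < X lo \<and> lo < b"
  shows "has_RS_integral_on f G a b
    (\<integral>\<^sup>+y. f (gen_inv G y) * indicator {y. G a \<le> ereal y \<and> ereal y < G b} y \<partial>lborel)"
proof (rule rs_limit[OF mono_G ab])
  let ?R = "{y. G a \<le> ereal y \<and> ereal y < G b}"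
  let ?I = "\<integral>\<^sup>+y. f (gen_inv G y) * indicator ?R y \<partial>lborel"
  show "AE y in lborel. y \<in> level_range G \<longrightarrow> isCont f (gen_inv G y)"
    using AE_cont_\<Phi> by eventually_elim (auto intro: isCont_f)
  have bound: "\<kappa> * emeasure lborel {y. G u \<le> ereal y \<and> ereal y < G v} \<le> ?I"
    if "a \<le> u" "u \<le> v" "v \<le> b" "\<kappa> \<le> f v" for u v \<kappa>
  proof -
    have "\<kappa> * emeasure lborel {y. G u \<le> ereal y \<and> ereal y < G v} =
        (\<integral>\<^sup>+y. \<kappa> * indicator {y. G u \<le> ereal y \<and> ereal y < G v} y \<partial>lborel)"
      by (simp add: nn_integral_cmult_indicator)
    also have "\<dots> \<le> ?I"
    proof (rule nn_integral_mono)
      fix y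
      show "\<kappa> * indicator {y. G u \<le> ereal y \<and> ereal y < G v} y \<le> f (gen_inv G y) * indicator ?R y"
      proof (cases "G u \<le> ereal y \<and> ereal y < G v")
        case True
        then have "gen_inv G y \<le> v" using gen_inv_bounds[OF mono_G, of u y v] that ab by auto
        then have "\<kappa> \<le> f (gen_inv G y)" using f_antimono that(4) order_trans by blast
        moreover have "y \<in> ?R" using True monoD[OF mono_G that(1)] monoD[OF mono_G that(3)] by auto
        ultimately show ?thesis using True by simp
      qed simp
    qed
    finally show ?thesis .
  qed
  have inf1: "?I = \<infinity>" if "0 < lo" "X lo \<noteq> 0"
  proof -
    have "G a < G lo" using a[OF that] by (simp add: G_def less_ennreal.rep_eq)
    from level_emeasure_pos[of G a lo, OF this] bound[of a lo \<top>] a[OF that] f_top[of lo] show ?thesis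
      by (auto simp: ennreal_top_mult top_unique split: if_splits)
  qed
  have inf2: "?I = \<infinity>" if c: "0 < c" "X c = \<top>" "\<Phi> c < 1" "c \<le> b" for c
  proof -
    have ac: "a < c" "X a < \<top>" using b[OF c(1-3) c(4)] by auto
    have "emeasure lborel {y. G a \<le> ereal y \<and> ereal y < G c} = rs_incr G a c"
      using ac by (intro rs_incr_eq[symmetric] monoD[OF mono_G]) simp
    also have "\<dots> = \<infinity>" using ac c(2) by (cases "X a") (auto simp: rs_incr_def G_def)
    finally show ?thesis using bound[of a c "f c"] ac c f_pos[OF c(3)] by (auto simp: ennreal_mult_top top_unique split: if_splits)
  qed
  have dom: "\<exists>\<delta>>0. \<exists>w\<in>borel_measurable lborel. (\<integral>\<^sup>+y. w y \<partial>lborel) < \<infinity> \<and>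
         (\<forall>x y. G a \<le> ereal y \<longrightarrow> ereal y < G b \<longrightarrow> a \<le> x \<longrightarrow> x \<le> b \<longrightarrow>
            \<bar>x - gen_inv G y\<bar> < \<delta> \<longrightarrow> f x \<le> w y)"
    if lo: "lo = 0 \<or> X lo = 0" and fin: "\<And>c. 0 < c \<Longrightarrow> c \<le> b \<Longrightarrow> X c = \<top> \<Longrightarrow> \<Phi> c = 1"
  proof -
    have "\<exists>\<kappa><\<top>. \<exists>\<delta>>0. \<forall>x y. y \<in> ?R \<longrightarrow> a \<le> x \<longrightarrow> \<bar>x - gen_inv G y\<bar> < \<delta> \<longrightarrow> f x \<le> \<kappa>"
    proof (cases "lo = 0")
      case True
      then show ?thesis using f_finite[of a] ab f_antimono[of a] by (intro exI[of _ "f a"]) (auto intro: exI[of _ 1])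
    next
      case False
      with lo lo_nonneg have "0 < lo" "X lo = 0" by auto
      then obtain d where d: "lo < d" "X d = 0" using lower_end[of lo] by (auto simp: lo_def)
      show ?thesis
      proof (intro exI[of _ "f ((lo + d) / 2)"] exI[of _ "(d - lo) / 2"] conjI allI impI)
        fix x y assume y: "y \<in> ?R" and x: "\<bar>x - gen_inv G y\<bar> < (d - lo) / 2"
        have "0 \<le> ereal y" using y order_trans[OF enn2ereal_nonneg[of "X a"], of "ereal y"] by (simp add: G_def)
        then have "G d \<le> ereal y" using d by (simp add: G_def zero_ennreal.rep_eq)
        moreover have "d \<le> b"
        proof (rule ccontr)
          assume "\<not> d \<le> b"
          then have "G b \<le> G d" by (intro monoD[OF mono_G]) simp
          with y \<open>G d \<le> ereal y\<close> show False by auto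
        qed
        ultimately have "d \<le> gen_inv G y"
          using gen_inv_bounds(1)[OF mono_G, of d y b] y d \<open>0 < lo\<close> by auto
        then show "f x \<le> f ((lo + d) / 2)" using x by (intro f_antimono) (auto simp: field_simps abs_if split: if_splits)
      qed (use d f_finite[of "(lo + d) / 2"] in auto)
    qed
    then obtain \<kappa> \<delta>1 where \<kappa>: "\<kappa> < \<top>" "0 < \<delta>1"
      "\<And>x y. y \<in> ?R \<Longrightarrow> a \<le> x \<Longrightarrow> \<bar>x - gen_inv G y\<bar> < \<delta>1 \<Longrightarrow> f x \<le> \<kappa>" by blast
    have fin_level: "\<kappa> * emeasure lborel {y. G a \<le> ereal y \<and> ereal y < G d} < \<infinity>" if "X d < \<top>" for d
    proof -
      have "emeasure lborel {y. G a \<le> ereal y \<and> ereal y < G d} \<le> emeasure lborel {0..enn2real (X d)}"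
      proof (intro emeasure_mono subsetI)
        fix y assume "y \<in> {y. G a \<le> ereal y \<and> ereal y < G d}"
        then have "0 \<le> ereal y" "ereal y < enn2ereal (X d)"
          using order_trans[OF enn2ereal_nonneg[of "X a"], of "ereal y"] by (simp_all add: G_def)
        then show "y \<in> {0..enn2real (X d)}" using that by (cases "X d") (auto simp: enn2ereal_ennreal)
      qed simp
      also have "\<dots> < \<infinity>" by simp
      finally show ?thesis using \<kappa>(1) by (simp add: ennreal_mult_less_top)
    qed
    show ?thesis
    proof (cases "X b < \<top>")
      case True
      with fin_level[OF True] \<kappa> show ?thesis
        by (intro exI[of _ \<delta>1] conjI bexI[of _ "\<lambda>y. \<kappa> * indicator ?R y"])
          (auto simp: nn_integral_cmult_indicator)
    next
      case False
      then have "\<Phi> b = 1" using fin[of b] ab by (simp flip: top.not_eq_extremum)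
      obtain d where d: "up < d" "X d < \<top>" by (rule X_up_finite[of b]) (use fin \<open>\<Phi> b = 1\<close> in auto)
      let ?S = "{y. G a \<le> ereal y \<and> ereal y < G d}"
      have "f x \<le> \<kappa> * indicator ?S y"
        if "G a \<le> ereal y" "ereal y < G b" "a \<le> x" "x \<le> b" "\<bar>x - gen_inv G y\<bar> < min \<delta>1 ((d - up) / 2)" for x y
      proof (cases "ereal y < G d")
        case True
        then show ?thesis using \<kappa>(3)[of y x] that by simp
      next
        case False
        then have "d \<le> b" using that(2) monoD[OF mono_G, of b d] by (cases "d \<le> b") auto
        then have "d \<le> gen_inv G y"
          using gen_inv_bounds(1)[OF mono_G, of d y b] False that d \<Phi>_up(3)[OF \<open>\<Phi> b = 1\<close>] by auto
        then have "up < x" using that(5) d by (auto simp: abs_if field_simps split: if_splits)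
        then show ?thesis using f_0[OF \<Phi>_up(1)[OF \<open>\<Phi> b = 1\<close>]] by simp
      qed
      with fin_level[OF d(2)] \<kappa>(2) d show ?thesis
        by (intro exI[of _ "min \<delta>1 ((d - up) / 2)"] conjI bexI[of _ "\<lambda>y. \<kappa> * indicator ?S y"])
          (auto simp: nn_integral_cmult_indicator)
    qed
  qed
  show "?I = \<infinity> \<or> (\<exists>\<delta>>0. \<exists>w\<in>borel_measurable lborel. (\<integral>\<^sup>+y. w y \<partial>lborel) < \<infinity> \<and>
         (\<forall>x y. G a \<le> ereal y \<longrightarrow> ereal y < G b \<longrightarrow> a \<le> x \<longrightarrow> x \<le> b \<longrightarrow>
            \<bar>x - gen_inv G y\<bar> < \<delta> \<longrightarrow> f x \<le> w y))"
  proof (cases "?I = \<infinity>")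
    case False
    then have "\<not> (0 < lo \<and> X lo \<noteq> 0)" and c: "\<not> (\<exists>c>0. c \<le> b \<and> X c = \<top> \<and> \<Phi> c < 1)"
      using inf1 inf2 by blast+
    then have "lo = 0 \<or> X lo = 0" using lo_nonneg by auto
    moreover have "\<Phi> c = 1" if "0 < c" "c \<le> b" "X c = \<top>" for c
      using c that \<Phi>_le_1[of c] by (auto simp: less_le)
    ultimately show ?thesis using dom by blast
  qed simp
qed

lemma has_RS_integral_wrt_path: "has_RS_integral f G (stieltjes f G)"
proof (rule rs_improper[OF mono_G])
  show "(\<lambda>y. f (gen_inv G y)) \<in> borel_measurable lborel" by measurable
  show "\<forall>\<^sub>F (a, b) in at_right 0 \<times>\<^sub>F at_top. has_RS_integral_on f G a b
    (\<integral>\<^sup>+y. f (gen_inv G y) * indicator {y. G a \<le> ereal y \<and> ereal y < G b} y \<partial>lborel)"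
  proof (rule eventually_improper)
    have "\<forall>\<^sub>F a in at_right 0. X a < \<top>" using ev_X_less[of 0 \<top>] X_0[of 0] by simp
    moreover have "\<forall>\<^sub>F a in at_right 0. 0 < lo \<longrightarrow> X lo \<noteq> 0 \<longrightarrow> a < lo \<and> X a < X lo"
    proof (cases "0 < lo \<and> X lo \<noteq> 0")
      case True
      then have "\<forall>\<^sub>F a in at_right 0. X a < X lo" using ev_X_less[of 0 "X lo"] X_0[of 0] by (simp add: zero_less_iff_neq_zero)
      moreover have "\<forall>\<^sub>F a in at_right 0. a < lo" using eventually_at_right_real[of 0 lo] True by (auto elim: eventually_mono)
      ultimately show ?thesis by eventually_elim simp
    qed auto
    ultimately show "\<forall>\<^sub>F a in at_right 0. X a < \<top> \<and> (0 < lo \<longrightarrow> X lo \<noteq> 0 \<longrightarrow> a < lo \<and> X a < X lo)"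
      by (rule eventually_conj)
    show "\<forall>\<^sub>F b in at_top. lo < b" by (rule eventually_gt_at_top)
    fix a b :: real
    assume *: "0 < a" "a \<le> b" "X a < \<top> \<and> (0 < lo \<longrightarrow> X lo \<noteq> 0 \<longrightarrow> a < lo \<and> X a < X lo)" "lo < b"
    then have "a < c" if "X c = \<top>" for c using monoD[OF mono_X, of c a] that by (auto simp: not_less[symmetric] top_unique)
    with * show "has_RS_integral_on f G a b
      (\<integral>\<^sup>+y. f (gen_inv G y) * indicator {y. G a \<le> ereal y \<and> ereal y < G b} y \<partial>lborel)"
      by (intro has_RS_integral_on_wrt_path) auto
  qed
qed

lemma less_K_imp_neg: "ereal y < K s \<Longrightarrow> y < 0"
  using less_le_trans[OF _ K_le_0[of s], of "ereal y"] by simp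

text \<open>The same cases with the roles exchanged: now the path is the integrand, and \<open>log \<Phi>\<close> has an
  infinite increment at the lower end of the support.\<close>

lemma has_RS_integral_on_wrt_log_cdf:
  assumes ab: "0 < a" "a \<le> b"
    and q1: "\<exists>c>0. X c = \<top> \<and> \<Phi> c < 1 \<Longrightarrow> \<exists>c. a \<le> c \<and> c \<le> b \<and> X c = \<top> \<and> \<Phi> c < \<Phi> b"
    and q2: "0 < lo \<Longrightarrow> X lo \<noteq> 0 \<Longrightarrow> a < lo \<and> lo < b"
  shows "has_RS_integral_on X K a b
    (\<integral>\<^sup>+y. X (gen_inv K y) * indicator {y. K a \<le> ereal y \<and> ereal y < K b} y \<partial>lborel)"
proof (rule rs_limit[OF mono_K ab AE_cont_X])
  let ?R = "{y. K a \<le> ereal y \<and> ereal y < K b}"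
  let ?I = "\<integral>\<^sup>+y. X (gen_inv K y) * indicator ?R y \<partial>lborel"
  have bound: "\<kappa> * emeasure lborel {y. K u \<le> ereal y \<and> ereal y < K b} \<le> ?I"
    if "a \<le> u" "u \<le> b" "\<And>y. K u \<le> ereal y \<Longrightarrow> ereal y < K b \<Longrightarrow> \<kappa> \<le> X (gen_inv K y)" for u \<kappa>
  proof -
    have "\<kappa> * emeasure lborel {y. K u \<le> ereal y \<and> ereal y < K b} =
        (\<integral>\<^sup>+y. \<kappa> * indicator {y. K u \<le> ereal y \<and> ereal y < K b} y \<partial>lborel)"
      by (simp add: nn_integral_cmult_indicator)
    also have "\<dots> \<le> ?I"
      using that(3) monoD[OF mono_K that(1)] by (intro nn_integral_mono) (auto simp: indicator_def)
    finally show ?thesis .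
  qed
  have inf2: "?I = \<infinity>" if ex: "\<exists>c>0. X c = \<top> \<and> \<Phi> c < 1"
  proof -
    obtain c where c: "a \<le> c" "c \<le> b" "X c = \<top>" "\<Phi> c < \<Phi> b" using q1[OF ex] by auto
    have "\<top> * emeasure lborel {y. K c \<le> ereal y \<and> ereal y < K b} \<le> ?I"
    proof (rule bound[OF c(1,2)])
      fix y assume "K c \<le> ereal y" "ereal y < K b"
      then have "c \<le> gen_inv K y" using gen_inv_bounds(1)[OF mono_K, of c y b] ab c by simp
      then show "\<top> \<le> X (gen_inv K y)" using monoD[OF mono_X, of c "gen_inv K y"] c by simp
    qed
    with level_emeasure_pos[of K c b] c show ?thesis
      by (auto simp: K_less_iff ennreal_top_mult top_unique split: if_splits)
  qed
  have inf1: "?I = \<infinity>" if lo: "0 < lo" "X lo \<noteq> 0"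
  proof -
    have alb: "a < lo" "lo < b" using q2[OF lo] by auto
    have "X lo * emeasure lborel {y. K a \<le> ereal y \<and> ereal y < K b} \<le> ?I"
    proof (rule bound[OF order_refl ab(2)])
      fix y assume y: "K a \<le> ereal y" "ereal y < K b"
      have "lo \<le> gen_inv K y"
        unfolding gen_inv_def
      proof (rule cInf_greatest)
        show "{s. 0 < s \<and> ereal y < K s} \<noteq> {}" using y ab by (auto intro!: exI[of _ b])
        fix s assume "s \<in> {s. 0 < s \<and> ereal y < K s}"
        then have "K s \<noteq> -\<infinity>" by auto
        then show "lo \<le> s" using \<Phi>_nonneg[of s] by (intro \<Phi>_ge_lo) (auto simp: K_minf_iff)
      qed
      then show "X lo \<le> X (gen_inv K y)" by (rule monoD[OF mono_X])
    qed
    moreover have "emeasure lborel {y. K a \<le> ereal y \<and> ereal y < K b} = \<infinity>"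
    proof -
      have "emeasure lborel {y. K a \<le> ereal y \<and> ereal y < K b} = rs_incr K a b"
        using ab by (intro rs_incr_eq[symmetric] monoD[OF mono_K])
      moreover have "K a = -\<infinity>" "K b \<noteq> -\<infinity>"
        using \<Phi>_0_lo[OF alb(1)] \<Phi>_pos[OF alb(2)] by (auto simp: K_minf_iff)
      ultimately show ?thesis using K_le_0[of b] by (cases "K b") (auto simp: rs_incr_def)
    qed
    ultimately show ?thesis using lo by (auto simp: ennreal_mult_top top_unique split: if_splits)
  qed
  have dom: "\<exists>\<delta>>0. \<exists>w\<in>borel_measurable lborel. (\<integral>\<^sup>+y. w y \<partial>lborel) < \<infinity> \<and>
         (\<forall>x y. K a \<le> ereal y \<longrightarrow> ereal y < K b \<longrightarrow> a \<le> x \<longrightarrow> x \<le> b \<longrightarrow>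
            \<bar>x - gen_inv K y\<bar> < \<delta> \<longrightarrow> X x \<le> w y)"
    if lo: "lo = 0 \<or> X lo = 0" and fin: "\<And>c. 0 < c \<Longrightarrow> X c = \<top> \<Longrightarrow> \<Phi> c = 1"
  proof -
    have "\<exists>\<kappa><\<top>. \<exists>\<delta>>0. \<forall>x y. y \<in> ?R \<longrightarrow> x \<le> b \<longrightarrow> \<bar>x - gen_inv K y\<bar> < \<delta> \<longrightarrow> X x \<le> \<kappa>"
    proof (cases "X b < \<top>")
      case True
      then show ?thesis using monoD[OF mono_X, of _ b] by (intro exI[of _ "X b"]) (auto intro: exI[of _ 1])
    next
      case False
      then have "\<Phi> b = 1" using fin[of b] ab by (simp flip: top.not_eq_extremum)
      obtain d where d: "up < d" "X d < \<top>" by (rule X_up_finite[of b]) (use fin \<open>\<Phi> b = 1\<close> in auto)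
      show ?thesis
      proof (intro exI[of _ "X d"] exI[of _ "d - up"] conjI allI impI)
        fix x y assume y: "y \<in> ?R" and x: "\<bar>x - gen_inv K y\<bar> < d - up"
        have Kup: "K up = 0" using \<Phi>_up(1)[OF \<open>\<Phi> b = 1\<close>] by (simp add: K_0_iff)
        then have y0: "ereal y < K up" using y less_K_imp_neg[of y b] by simp
        then have "a \<le> up" using y monoD[OF mono_K, of up a] by (cases "a \<le> up") auto
        then have "gen_inv K y \<le> up" using gen_inv_bounds(2)[OF mono_K, of a y up] y y0 ab by auto
        then show "X x \<le> X d" using x by (intro monoD[OF mono_X]) auto
      qed (use d in auto)
    qed
    then obtain \<kappa> \<delta>1 where \<kappa>: "\<kappa> < \<top>" "0 < \<delta>1"
      "\<And>x y. y \<in> ?R \<Longrightarrow> x \<le> b \<Longrightarrow> \<bar>x - gen_inv K y\<bar> < \<delta>1 \<Longrightarrow> X x \<le> \<kappa>" by blast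
    have fin_level: "\<kappa> * emeasure lborel {y. K m \<le> ereal y \<and> ereal y < K b} < \<infinity>" if m: "K m \<noteq> -\<infinity>" for m
    proof -
      have "emeasure lborel {y. K m \<le> ereal y \<and> ereal y < K b} \<le> emeasure lborel {real_of_ereal (K m)..0}"
      proof (intro emeasure_mono subsetI)
        fix y assume "y \<in> {y. K m \<le> ereal y \<and> ereal y < K b}"
        then have "K m \<le> ereal y" "y < 0" using less_K_imp_neg[of y b] by auto
        then show "y \<in> {real_of_ereal (K m)..0}" using m K_le_0[of m] by (cases "K m") auto
      qed simp
      also have "\<dots> < \<infinity>" by (simp add: emeasure_lborel_Icc_eq)
      finally show ?thesis using \<kappa>(1) by (simp add: ennreal_mult_less_top)
    qed
    show ?thesis
    proof (cases "K a = -\<infinity>")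
      case False
      with fin_level[of a] \<kappa> show ?thesis
        by (intro exI[of _ \<delta>1] conjI bexI[of _ "\<lambda>y. \<kappa> * indicator ?R y"])
          (auto simp: nn_integral_cmult_indicator)
    next
      case True
      then have alo: "a \<le> lo" using \<Phi>_pos[of a] by (cases "a \<le> lo") (auto simp: K_minf_iff)
      with lo ab obtain d where d: "lo < d" "X d = 0" using lower_end[of lo] by (auto simp: lo_def)
      define m where "m = (lo + d) / 2"
      have m: "lo < m" "m < d" "K m \<noteq> -\<infinity>" using d \<Phi>_pos[of m] by (auto simp: m_def K_minf_iff)
      let ?S = "{y. K m \<le> ereal y \<and> ereal y < K b}"
      have "X x \<le> \<kappa> * indicator ?S y"
        if y: "K a \<le> ereal y" "ereal y < K b" "a \<le> x" "x \<le> b" "\<bar>x - gen_inv K y\<bar> < min \<delta>1 (d - m)" for x y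
      proof (cases "K m \<le> ereal y")
        case True
        then show ?thesis using \<kappa>(3)[of y x] that by simp
      next
        case False
        then have "gen_inv K y \<le> m" using gen_inv_bounds(2)[OF mono_K, of a y m] y ab alo m by auto
        then have "x \<le> d" using that(5) by auto
        then show ?thesis using monoD[OF mono_X, of x d] d by simp
      qed
      with fin_level[OF m(3)] \<kappa>(2) m show ?thesis
        by (intro exI[of _ "min \<delta>1 (d - m)"] conjI bexI[of _ "\<lambda>y. \<kappa> * indicator ?S y"])
          (auto simp: nn_integral_cmult_indicator)
    qed
  qed
  show "?I = \<infinity> \<or> (\<exists>\<delta>>0. \<exists>w\<in>borel_measurable lborel. (\<integral>\<^sup>+y. w y \<partial>lborel) < \<infinity> \<and>
         (\<forall>x y. K a \<le> ereal y \<longrightarrow> ereal y < K b \<longrightarrow> a \<le> x \<longrightarrow> x \<le> b \<longrightarrow>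
            \<bar>x - gen_inv K y\<bar> < \<delta> \<longrightarrow> X x \<le> w y))"
  proof (cases "?I = \<infinity>")
    case False
    then have "\<not> (0 < lo \<and> X lo \<noteq> 0)" and c: "\<not> (\<exists>c>0. X c = \<top> \<and> \<Phi> c < 1)"
      using inf1 inf2 by blast+
    then have "lo = 0 \<or> X lo = 0" using lo_nonneg by auto
    moreover have "\<Phi> c = 1" if "0 < c" "X c = \<top>" for c
      using c that \<Phi>_le_1[of c] by (auto simp: less_le)
    ultimately show ?thesis using dom by blast
  qed simp
qed

lemma has_RS_integral_wrt_log_cdf: "has_RS_integral X K (stieltjes X K)"
proof (rule rs_improper[OF mono_K])
  show "(\<lambda>y. X (gen_inv K y)) \<in> borel_measurable lborel" by measurable
  obtain c where c: "(\<exists>c>0. X c = \<top> \<and> \<Phi> c < 1) \<Longrightarrow> 0 < c \<and> X c = \<top> \<and> \<Phi> c < 1" by blast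
  show "\<forall>\<^sub>F (a, b) in at_right 0 \<times>\<^sub>F at_top. has_RS_integral_on X K a b
    (\<integral>\<^sup>+y. X (gen_inv K y) * indicator {y. K a \<le> ereal y \<and> ereal y < K b} y \<partial>lborel)"
  proof (rule eventually_improper)
    have ev: "\<forall>\<^sub>F a in at_right 0. 0 < d \<longrightarrow> a < d" for d :: real
      using eventually_at_right_real[of 0 d] by (cases "0 < d") (auto elim: eventually_mono)
    show "\<forall>\<^sub>F a in at_right 0. (0 < c \<longrightarrow> a < c) \<and> (0 < lo \<longrightarrow> a < lo)"
      using ev[of c] ev[of lo] by (rule eventually_conj)
    show "\<forall>\<^sub>F b in at_top. lo < b \<and> c < b \<and> (\<Phi> c < 1 \<longrightarrow> \<Phi> c < \<Phi> b)"
    proof -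
      have "\<forall>\<^sub>F b in at_top. \<Phi> c < 1 \<longrightarrow> \<Phi> c < \<Phi> b" using ev_\<Phi>_gt[of "\<Phi> c"] by (cases "\<Phi> c < 1") auto
      with eventually_gt_at_top[of lo] eventually_gt_at_top[of c] show ?thesis by eventually_elim simp
    qed
    fix a b :: real
    assume *: "0 < a" "a \<le> b" "(0 < c \<longrightarrow> a < c) \<and> (0 < lo \<longrightarrow> a < lo)"
      "lo < b \<and> c < b \<and> (\<Phi> c < 1 \<longrightarrow> \<Phi> c < \<Phi> b)"
    then show "has_RS_integral_on X K a b
      (\<integral>\<^sup>+y. X (gen_inv K y) * indicator {y. K a \<le> ereal y \<and> ereal y < K b} y \<partial>lborel)"
      using c by (intro has_RS_integral_on_wrt_log_cdf exI[of _ c]) auto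
  qed
qed

text \<open>The integrands are themselves lengths, which turns both integrals into areas.\<close>

lemma neg_log_eq_emeasure:
  assumes "0 \<le> p" "p \<le> 1" shows "emeasure lborel {x. x < 0 \<and> elog p < ereal x} = neg_log p"
proof (cases "p = 0")
  case True
  then have "{x. x < 0 \<and> elog p < ereal x} = {..<0}" by (auto simp: elog_def)
  with True show ?thesis using emeasure_lborel_half_lines(2)[of 0] by simp
next
  case False
  then have "{x. x < 0 \<and> elog p < ereal x} = {ln p<..<0}" by (auto simp: elog_def)
  with False assms show ?thesis by (simp add: neg_log_def elog_def flip: ennreal.abs_eq)
qed

lemma ennreal_eq_emeasure: "emeasure lborel {y. 0 \<le> y \<and> ereal y < enn2ereal c} = c"
proof (cases c)
  case (real r)
  then have "{y. 0 \<le> y \<and> ereal y < enn2ereal c} = {0..<r}" by (auto simp: enn2ereal_ennreal)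
  with real show ?thesis by simp
next
  case top
  then have "{y. 0 \<le> y \<and> ereal y < enn2ereal c} = {0..}" by auto
  with top show ?thesis using emeasure_lborel_half_lines(1)[of 0] by simp
qed

lemma borel_elog: "elog \<in> borel_measurable borel"
  unfolding elog_def by measurable

lemma level_K_iff: 
  assumes "0 < s" "K s \<le> ereal x" shows "x \<in> level_range K \<longleftrightarrow> x < 0"
proof
  assume "x \<in> level_range K"
  then show "x < 0" by (auto simp: level_range_def intro: less_K_imp_neg)
next
  assume x: "x < 0"
  then have "\<forall>\<^sub>F b in at_top. exp x < \<Phi> b \<and> 0 < b"
    using ev_\<Phi>_gt[of "exp x"] eventually_gt_at_top[of "0::real"] by (auto intro: eventually_conj)
  then obtain b where b: "exp x < \<Phi> b" "0 < b" by (auto dest: eventually_happens)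
  then have pos: "0 < \<Phi> b" using exp_gt_zero[of x] by linarith
  then have "x < ln (\<Phi> b)" using b ln_less_cancel_iff[of "exp x" "\<Phi> b"] by simp
  with pos have "x < ln (\<Phi> b)" "\<Phi> b \<noteq> 0" by auto
  then have "ereal x < K b" by (simp add: K_def elog_def)
  with assms b show "x \<in> level_range K" by (auto simp: level_range_def)
qed

text \<open>Both sides say, up to the boundary case, that the path \<open>X\<close> crosses the level \<open>y\<close> before
  \<open>log \<Phi>\<close> crosses the level \<open>x\<close>.\<close>

lemma inverse_relation:
  assumes y: "y \<in> level_range G" and cont: "isCont \<Phi> (gen_inv G y)" and x: "ereal x \<noteq> K (gen_inv G y)"
  shows "x < 0 \<and> K (gen_inv G y) < ereal x \<longleftrightarrow> x \<in> level_range K \<and> ereal y < G (gen_inv K x)"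
proof -
  define c where "c = gen_inv G y"
  obtain v where v: "0 < v" "ereal y < G v" using y by (auto simp: level_range_def)
  have c: "0 < c" unfolding c_def by (rule gen_inv_pos[OF mono_G y])
  have K: "(K \<longlongrightarrow> K c) (at_left c)" "(K \<longlongrightarrow> K c) (at_right c)"
    using isCont_K[OF cont] by (auto simp: isCont_def c_def filterlim_at_split)
  show ?thesis unfolding c_def[symmetric]
  proof
    assume *: "x < 0 \<and> K c < ereal x"
    then have lev: "x \<in> level_range K" using level_K_iff[of c x] c by auto
    then obtain v' where v': "0 < v'" "ereal x < K v'" by (auto simp: level_range_def)
    have "\<forall>\<^sub>F s in at_right c. K s < ereal x \<and> c < s"
      using order_tendstoD(2)[OF K(2), of "ereal x"] * eventually_at_right_less[of c] by (auto intro: eventually_conj)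
    then obtain s where s: "K s < ereal x" "c < s" using eventually_happens[of _ "at_right c"] by auto
    have "s \<le> v'" using s v' monoD[OF mono_K, of v' s] by (cases "s \<le> v'") auto
    then have "s \<le> gen_inv K x" using gen_inv_bounds(1)[OF mono_K, of s x v'] s v' c by auto
    then have "ereal y < G (gen_inv K x)"
      using gen_inv_less_imp[OF mono_G v] s by (auto simp: c_def)
    with lev show "x \<in> level_range K \<and> ereal y < G (gen_inv K x)" by simp
  next
    assume *: "x \<in> level_range K \<and> ereal y < G (gen_inv K x)"
    then have x0: "x < 0" by (auto simp: level_range_def intro: less_K_imp_neg)
    have "K c < ereal x"
    proof (rule ccontr)
      assume "\<not> K c < ereal x"
      with x have "ereal x < K c" by (auto simp: c_def)
      have "\<forall>\<^sub>F s in at_left c. ereal x < K s \<and> s \<in> {0<..<c}"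
        using order_tendstoD(1)[OF K(1) \<open>ereal x < K c\<close>] eventually_at_left_real[OF c] by (rule eventually_conj)
      then obtain s where s: "ereal x < K s" "0 < s" "s < c" using eventually_happens[of _ "at_left c"] by auto
      have "gen_inv K x \<le> s" unfolding gen_inv_def
        using s by (intro cInf_lower) (auto intro!: bdd_belowI[of _ 0])
      then have "G (gen_inv K x) \<le> ereal y"
        using gen_inv_pos[OF mono_K] * s by (intro less_gen_inv_imp) (auto simp: c_def)
      with * show False by auto
    qed
    with x0 show "x < 0 \<and> K c < ereal x" by simp
  qed
qed

text \<open>The double integrals of the indicators of the two sets in \<open>inverse_relation\<close>; for almost
  every \<open>y\<close> their sections differ in at most one point.\<close>

theorem integration_by_parts: "stieltjes f G = stieltjes X K"
proof -
  note [measurable] = borel_elog level_range_borel[OF mono_G] level_range_borel[OF mono_K]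
  define SA where "SA = {p \<in> space (lborel \<Otimes>\<^sub>M lborel). fst p \<in> level_range G \<and> snd p < 0 \<and>
    elog (\<Phi>m (gen_inv G (fst p))) < ereal (snd p)}"
  define SB where "SB = {p \<in> space (lborel \<Otimes>\<^sub>M lborel). snd p \<in> level_range K \<and> 0 \<le> fst p \<and>
    ereal (fst p) < enn2ereal (X (gen_inv K (snd p)))}"
  have [measurable]: "SA \<in> sets (lborel \<Otimes>\<^sub>M lborel)" unfolding SA_def by measurable
  have [measurable]: "SB \<in> sets (lborel \<Otimes>\<^sub>M lborel)" unfolding SB_def by measurable
  define A where "A y x = (indicator SA (y, x) :: ennreal)" for y x :: real
  define B where "B y x = (indicator SB (y, x) :: ennreal)" for y x :: real
  have [measurable]: "(\<lambda>p. B (fst p) (snd p)) \<in> borel_measurable (lborel \<Otimes>\<^sub>M lborel)"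
    unfolding B_def prod.collapse by measurable
  have A_iff: "A y x = (if y \<in> level_range G \<and> x < 0 \<and> elog (\<Phi>m (gen_inv G y)) < ereal x then 1 else 0)" for y x
    by (simp add: A_def SA_def space_pair_measure)
  have B_iff: "B y x = (if x \<in> level_range K \<and> 0 \<le> y \<and> ereal y < enn2ereal (X (gen_inv K x)) then 1 else 0)" for y x
    by (simp add: B_def SB_def space_pair_measure)
  have "stieltjes f G = (\<integral>\<^sup>+y. (\<integral>\<^sup>+x. A y x \<partial>lborel) \<partial>lborel)"
    unfolding stieltjes_def
  proof (rule nn_integral_cong)
    fix y
    have "(\<integral>\<^sup>+x. A y x \<partial>lborel) = (\<integral>\<^sup>+x. indicator (level_range G) y *
        indicator {x. x < 0 \<and> elog (\<Phi>m (gen_inv G y)) < ereal x} x \<partial>lborel)"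
      by (intro nn_integral_cong) (auto simp: A_iff)
    also have "\<dots> = indicator (level_range G) y * f (gen_inv G y)"
      by (simp add: nn_integral_cmult_indicator neg_log_eq_emeasure \<Phi>m_bounds f_def)
    finally show "f (gen_inv G y) * indicator (level_range G) y = (\<integral>\<^sup>+x. A y x \<partial>lborel)"
      by (simp add: mult.commute)
  qed
  also have "\<dots> = (\<integral>\<^sup>+y. (\<integral>\<^sup>+x. B y x \<partial>lborel) \<partial>lborel)"
  proof (rule nn_integral_cong_AE)
    show "AE y in lborel. (\<integral>\<^sup>+x. A y x \<partial>lborel) = (\<integral>\<^sup>+x. B y x \<partial>lborel)"
      using AE_cont_\<Phi> AE_lborel_singleton[of 0]
    proof eventually_elim
      fix y assume c: "y \<in> level_range G \<longrightarrow> isCont \<Phi> (gen_inv G y)" and "y \<noteq> (0::real)"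
      show "(\<integral>\<^sup>+x. A y x \<partial>lborel) = (\<integral>\<^sup>+x. B y x \<partial>lborel)"
      proof (cases "y \<in> level_range G")
        case True
        then have "0 \<le> y" by (auto simp: level_range_def G_def dest: order_trans[OF enn2ereal_nonneg])
        have "AE x in lborel. A y x = B y x"
          using AE_lborel_singleton[of "real_of_ereal (K (gen_inv G y))"]
        proof eventually_elim
          fix x assume "x \<noteq> real_of_ereal (K (gen_inv G y))"
          then have "ereal x \<noteq> K (gen_inv G y)" by (metis real_of_ereal.simps(1))
          from inverse_relation[OF True _ this] c True \<open>0 \<le> y\<close> show "A y x = B y x"
            by (auto simp: A_iff B_iff K_def[symmetric] G_def[symmetric] \<Phi>m_eq)
        qed
        then show ?thesis by (rule nn_integral_cong_AE)
      next
        case False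
        have "B y x = 0" for x
        proof (rule ccontr)
          assume "B y x \<noteq> 0"
          then have x: "x \<in> level_range K" "0 < y" "ereal y < G (gen_inv K x)"
            using \<open>y \<noteq> 0\<close> by (auto simp: B_iff G_def split: if_splits)
          have "\<forall>\<^sub>F s in at_right 0. X s < ennreal y \<and> 0 < s"
            using ev_X_less[of 0 "ennreal y"] x X_0[of 0] eventually_at_right_less[of "0::real"]
            by (auto intro: eventually_conj)
          then obtain s where s: "X s < ennreal y" "0 < s" using eventually_happens[of _ "at_right (0::real)"] by auto
          then have "G s \<le> ereal y" using x by (auto simp: G_def less_ennreal.rep_eq enn2ereal_ennreal)
          with s x gen_inv_pos[OF mono_K x(1)] have "y \<in> level_range G" by (auto simp: level_range_def)
          with False show False ..
        qed
        then show ?thesis using False by (simp add: A_iff)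
      qed
    qed
  qed
  also have "\<dots> = (\<integral>\<^sup>+x. (\<integral>\<^sup>+y. B y x \<partial>lborel) \<partial>lborel)"
    by (rule lborel_pair.Fubini'[of B, symmetric]) (simp add: case_prod_beta')
  also have "\<dots> = stieltjes X K"
    unfolding stieltjes_def
  proof (rule nn_integral_cong)
    fix x
    have "(\<integral>\<^sup>+y. B y x \<partial>lborel) = (\<integral>\<^sup>+y. indicator (level_range K) x *
        indicator {y. 0 \<le> y \<and> ereal y < enn2ereal (X (gen_inv K x))} y \<partial>lborel)"
      by (intro nn_integral_cong) (auto simp: B_iff)
    also have "\<dots> = indicator (level_range K) x * X (gen_inv K x)"
      by (simp add: nn_integral_cmult_indicator ennreal_eq_emeasure)
    finally show "(\<integral>\<^sup>+y. B y x \<partial>lborel) = X (gen_inv K x) * indicator (level_range K) x"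
      by (simp add: mult.commute)
  qed
  finally show ?thesis .
qed

lemma lower_sum_tendsto_path: "lower_sum f G \<longlonglongrightarrow> stieltjes f G"
proof (rule lower_sum_tendsto(2)[OF mono_G])
  show "(G \<longlongrightarrow> G 0) (at_right 0)"
    using rc_X[of 0] by (simp add: G_def[abs_def] continuous_within)
  show "AE y in lborel. y \<in> level_range G \<longrightarrow> isCont f (gen_inv G y)"
    using AE_cont_\<Phi> by eventually_elim (auto intro: isCont_f)
qed (rule f_antimono)

end

section \<open>Almost sure properties of the subordinator\<close>

definition nonneg_cdf :: "(real \<Rightarrow> real) \<Rightarrow> bool" where
  "nonneg_cdf F \<longleftrightarrow> mono F \<and> (\<forall>x. continuous (at_right x) F) \<and> (\<forall>x<0. F x = 0) \<and> (F \<longlongrightarrow> 1) at_top"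

lemma nonneg_cdf_dist_fun: "dist_fun F \<Longrightarrow> nonneg_cdf F"
proof -
  assume "dist_fun F"
  then obtain \<mu> where \<mu>: "real_distribution \<mu>" "F = cdf \<mu>" "AE x in \<mu>. 0 \<le> x"
    by (auto simp: dist_fun_def)
  interpret real_distribution \<mu> by fact
  have "F x = 0" if "x < 0" for x
  proof -
    have "AE y in \<mu>. y \<notin> {..x}" using \<mu>(3) by eventually_elim (use that in auto)
    then show ?thesis using AE_iff_measurable[of "{..x}" \<mu> "\<lambda>y. y \<notin> {..x}"]
      by (simp add: \<mu>(2) cdf_def measure_def atMost_def)
  qed
  then show "nonneg_cdf F"
    unfolding nonneg_cdf_def \<mu>(2)
    by (auto intro: monoI cdf_nondecreasing cdf_is_right_cont cdf_lim_at_top_prob)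
qed

lemma nonneg_cdf_scale:
  assumes F: "nonneg_cdf F" and t: "0 < t" shows "nonneg_cdf (\<lambda>s. F (s / t))"
  unfolding nonneg_cdf_def
proof (intro conjI allI impI)
  show "mono (\<lambda>s. F (s / t))" using F t by (auto simp: nonneg_cdf_def mono_def divide_right_mono)
  show "F (x / t) = 0" if "x < 0" for x using F t that by (auto simp: nonneg_cdf_def divide_neg_pos)
  show "((\<lambda>s. F (s / t)) \<longlongrightarrow> 1) at_top"
  proof (rule filterlim_compose[of F])
    show "(F \<longlongrightarrow> 1) at_top" using F by (simp add: nonneg_cdf_def)
    show "filterlim (\<lambda>s. s / t) at_top at_top"
      using filterlim_tendsto_pos_mult_at_top[OF tendsto_const[of "1 / t"] _ filterlim_ident] t
      by (simp add: field_simps)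
  qed
  fix x
  have "filterlim (\<lambda>s. s / t) (at_right (x / t)) (at_right x)"
    unfolding filterlim_at using t
    by (auto intro!: tendsto_divide tendsto_ident_at eventually_mono[OF eventually_at_right_less[of x]] simp: divide_strict_right_mono)
  moreover have "(F \<longlongrightarrow> F (x / t)) (at_right (x / t))" using F by (simp add: nonneg_cdf_def continuous_within)
  ultimately show "continuous (at_right x) (\<lambda>s. F (s / t))"
    unfolding continuous_within by (rule filterlim_compose[rotated])
qed

text \<open>A decreasing sequence that stays above \<open>Z\<close> and whose means tend to the mean of \<open>Z\<close> converges
  to \<open>Z\<close>. All almost sure statements on the subordinator at a fixed time are instances: the means
  are Laplace transforms, which are continuous in time.\<close>

lemma (in prob_space) AE_tendsto_of_expectation:
  fixes Y :: "nat \<Rightarrow> 'a \<Rightarrow> real"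
  assumes [measurable]: "\<And>n. Y n \<in> borel_measurable M" "Z \<in> borel_measurable M"
    and Z: "\<And>n \<omega>. \<omega> \<in> space M \<Longrightarrow> 0 \<le> Z \<omega> \<and> Z \<omega> \<le> Y n \<omega> \<and> Y n \<omega> \<le> 1"
    and dec: "\<And>n \<omega>. \<omega> \<in> space M \<Longrightarrow> Y (Suc n) \<omega> \<le> Y n \<omega>"
    and lim: "(\<lambda>n. expectation (Y n)) \<longlonglongrightarrow> expectation Z"
  shows "AE \<omega> in M. (\<lambda>n. Y n \<omega>) \<longlonglongrightarrow> Z \<omega>"
proof -
  define W where "W \<omega> = lim (\<lambda>n. Y n \<omega>)" for \<omega>
  have conv: "(\<lambda>n. Y n \<omega>) \<longlonglongrightarrow> W \<omega>" if "\<omega> \<in> space M" for \<omega>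
  proof -
    have "Y n \<omega> \<ge> 0" for n using Z[OF that, of n] by linarith
    moreover have "decseq (\<lambda>n. Y n \<omega>)" using dec[OF that] by (rule decseq_SucI)
    ultimately obtain l where "(\<lambda>n. Y n \<omega>) \<longlonglongrightarrow> l"
      using decseq_convergent[of "\<lambda>n. Y n \<omega>" 0] by blast
    then have "convergent (\<lambda>n. Y n \<omega>)" by (rule convergentI)
    then show ?thesis by (simp add: W_def convergent_LIMSEQ_iff)
  qed
  have [measurable]: "W \<in> borel_measurable M"
    unfolding W_def by measurable
  have W: "Z \<omega> \<le> W \<omega>" "0 \<le> W \<omega>" "W \<omega> \<le> 1" if "\<omega> \<in> space M" for \<omega>
  proof -
    show "Z \<omega> \<le> W \<omega>" by (rule LIMSEQ_le_const[OF conv[OF that]]) (use Z[OF that] in auto)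
    then show "0 \<le> W \<omega>" using Z[OF that, of 0] by linarith
    show "W \<omega> \<le> 1" by (rule LIMSEQ_le_const2[OF conv[OF that]]) (use Z[OF that] in auto)
  qed
  have "(\<lambda>n. expectation (Y n)) \<longlonglongrightarrow> expectation W"
  proof (rule integral_dominated_convergence[where w = "\<lambda>_. 1"])
    show "AE \<omega> in M. norm (Y n \<omega>) \<le> 1" for n
      by (rule AE_I2) (use Z in \<open>smt (verit) real_norm_def\<close>)
  qed (auto intro!: AE_I2 conv)
  with lim have eq: "expectation W = expectation Z" by (rule LIMSEQ_unique[rotated])
  have int: "integrable M W" "integrable M Z"
  proof -
    show "integrable M W" by (rule integrable_const_bound[of _ 1]) (auto intro!: AE_I2 simp: W)
    show "integrable M Z"
    proof (rule integrable_const_bound[of _ 1])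
      have "norm (Z \<omega>) \<le> 1" if "\<omega> \<in> space M" for \<omega> using Z[OF that, of 0] by auto
      then show "AE \<omega> in M. norm (Z \<omega>) \<le> 1" by (rule AE_I2)
    qed measurable
  qed
  have "(\<integral>\<omega>. W \<omega> - Z \<omega> \<partial>M) = 0" using eq int by simp
  then have "AE \<omega> in M. W \<omega> - Z \<omega> = 0"
    using integral_nonneg_eq_0_iff_AE[of M "\<lambda>\<omega>. W \<omega> - Z \<omega>"] int W by (auto intro!: AE_I2)
  with AE_space show ?thesis by eventually_elim (use conv in force)
qed

text \<open>The Laplace exponent, extended to the argument \<open>\<infinity>\<close>. The extension is needed because the
  integrand \<open>-log F\<close> may be infinite; its value at \<open>\<infinity>\<close> is the total mass of \<open>\<nu>\<close>.\<close>

definition Psi_ext :: "ennreal measure \<Rightarrow> ennreal \<Rightarrow> ennreal" where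
  "Psi_ext \<nu> x = (\<integral>\<^sup>+u. ennreal (1 - exp_neg (u * x)) \<partial>\<nu>)"

lemma exp_neg_mult_tendsto:
  assumes "0 < c" "s \<longlonglongrightarrow> c" "\<And>n. 0 < s n"
  shows "(\<lambda>n. exp_neg (ennreal (s n) * p)) \<longlonglongrightarrow> exp_neg (ennreal c * p)"
proof (cases p)
  case (real r)
  have "(\<lambda>n. exp (- (s n * r))) \<longlonglongrightarrow> exp (- (c * r))" by (intro tendsto_intros assms)
  then show ?thesis using real assms less_imp_le[OF assms(3)]
    by (simp add: ennreal_mult[symmetric] exp_neg_ennreal)
next
  case top
  moreover have "ennreal (s n) \<noteq> 0" "ennreal c \<noteq> 0" for n
    using assms(1) assms(3)[of n] by (simp_all add: ennreal_eq_0_iff)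
  ultimately show ?thesis by (simp add: ennreal_mult_top)
qed

locale subordinator =
  fixes M :: "'a measure" and L :: "real \<Rightarrow> 'a \<Rightarrow> ennreal" and \<nu> :: "ennreal measure"
  assumes levy: "levy_subordinator M L \<nu>"
begin

sublocale prob_space M using levy by (simp add: levy_subordinator_def)

lemma meas_L [measurable]: "0 \<le> t \<Longrightarrow> L t \<in> borel_measurable M"
  using levy by (simp add: levy_subordinator_def)

lemma L_0: "\<omega> \<in> space M \<Longrightarrow> L 0 \<omega> = 0"
  using levy by (simp add: levy_subordinator_def)

lemma mono_L: "\<omega> \<in> space M \<Longrightarrow> 0 \<le> s \<Longrightarrow> s \<le> t \<Longrightarrow> L s \<omega> \<le> L t \<omega>"
  using levy by (auto simp: levy_subordinator_def mono_on_def)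

lemma AE_rc_L: "AE \<omega> in M. \<forall>t\<ge>0. continuous (at_right t) (\<lambda>t. L t \<omega>)"
  using levy by (simp add: levy_subordinator_def)

lemma sets_\<nu> [measurable_cong, simp]: "sets \<nu> = sets borel"
  using levy by (simp add: levy_subordinator_def levy_measure_def)

lemma laplace_fin:
  "0 \<le> t \<Longrightarrow> 0 \<le> x \<Longrightarrow> expectation (\<lambda>\<omega>. exp_neg (ennreal x * L t \<omega>)) = exp_neg (ennreal t * Psi_ext \<nu> (ennreal x))"
  using levy by (auto simp: levy_subordinator_def Psi_L_def Psi_ext_def)

lemma Psi_ext_mono: "x \<le> y \<Longrightarrow> Psi_ext \<nu> x \<le> Psi_ext \<nu> y"
  unfolding Psi_ext_def
  by (intro nn_integral_mono ennreal_leI diff_left_mono) (auto simp: exp_neg_le_iff intro: mult_left_mono)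

text \<open>At \<open>x = \<infinity>\<close> this is the probability of \<open>{L t = 0}\<close>, the limit of the Laplace transform.\<close>

lemma laplace:
  assumes t: "0 \<le> t"
  shows "expectation (\<lambda>\<omega>. exp_neg (x * L t \<omega>)) = exp_neg (ennreal t * Psi_ext \<nu> x)"
proof (cases x)
  case (real r)
  then show ?thesis using laplace_fin[OF t, of r] by simp
next
  case top
  have [measurable]: "L t \<in> borel_measurable M" using t by measurable
  have "(\<lambda>n. expectation (\<lambda>\<omega>. exp_neg (ennreal (real n) * L t \<omega>))) \<longlonglongrightarrow> expectation (\<lambda>\<omega>. exp_neg (\<top> * L t \<omega>))"
    by (rule integral_dominated_convergence[where w = "\<lambda>_. 1"]) (auto intro: exp_neg_nat_tendsto)
  moreover have "(\<lambda>n. Psi_ext \<nu> (ennreal (real n))) \<longlonglongrightarrow> Psi_ext \<nu> \<top>"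
    unfolding Psi_ext_def
  proof (rule nn_integral_LIMSEQ)
    show "incseq (\<lambda>n u. ennreal (1 - exp_neg (u * ennreal (real n))))"
      by (intro incseq_SucI le_funI ennreal_leI diff_left_mono)
        (auto simp: exp_neg_le_iff intro!: mult_left_mono ennreal_leI)
    show "(\<lambda>n. ennreal (1 - exp_neg (u * ennreal (real n)))) \<longlonglongrightarrow> ennreal (1 - exp_neg (u * \<top>))" for u
      using exp_neg_nat_tendsto[of u] by (intro tendsto_ennrealI tendsto_intros) (simp add: mult.commute)
  qed measurable
  then have "(\<lambda>n. exp_neg (ennreal t * Psi_ext \<nu> (ennreal (real n)))) \<longlonglongrightarrow> exp_neg (ennreal t * Psi_ext \<nu> \<top>)"
    by (intro tendsto_exp_neg ennreal_tendsto_cmult) auto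
  ultimately show ?thesis using top t
    by (simp add: laplace_fin LIMSEQ_unique)
qed

text \<open>The survival probability is the limit of the Laplace transform at \<open>0\<close>. All that matters of the
  killing rate \<open>q\<close> is that the probability depends continuously on time.\<close>

lemma expectation_finite:
  obtains q where "\<And>t. 0 \<le> t \<Longrightarrow> expectation (\<lambda>\<omega>. of_bool (L t \<omega> < \<top>)) = exp_neg (ennreal t * q)"
proof
  fix t :: real assume t: "0 \<le> t"
  have [measurable]: "L t \<in> borel_measurable M" using t by measurable
  have conv: "(\<lambda>n. exp_neg (ennreal (1 / real (Suc n)) * y)) \<longlonglongrightarrow> of_bool (y < \<top>)" for y
  proof (cases y)
    case (real r)
    have "(\<lambda>n. exp (- (r / real (Suc n)))) \<longlonglongrightarrow> exp (- 0)"
      by (intro tendsto_intros lim_const_over_n[THEN LIMSEQ_Suc])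
    moreover have "exp_neg (ennreal (1 / real (Suc n)) * ennreal r) = exp (- (r / real (Suc n)))" for n
      using real by (subst ennreal_mult[symmetric]) (auto simp: exp_neg_ennreal)
    ultimately show ?thesis using real by simp
  qed (simp add: ennreal_mult_top)
  have "(\<lambda>n. expectation (\<lambda>\<omega>. exp_neg (ennreal (1 / real (Suc n)) * L t \<omega>))) \<longlonglongrightarrow> expectation (\<lambda>\<omega>. of_bool (L t \<omega> < \<top>))"
  proof (rule integral_dominated_convergence[where w = "\<lambda>_. 1"])
    show "AE \<omega> in M. (\<lambda>n. exp_neg (ennreal (1 / real (Suc n)) * L t \<omega>)) \<longlonglongrightarrow> of_bool (L t \<omega> < \<top>)"
      by (rule AE_I2) (rule conv)
  qed auto
  moreover have "(\<lambda>n. Psi_ext \<nu> (ennreal (1 / real (Suc n)))) \<longlonglongrightarrow> (INF n. Psi_ext \<nu> (ennreal (1 / real (Suc n))))"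
    by (intro LIMSEQ_INF decseq_SucI Psi_ext_mono ennreal_leI) (simp add: field_simps)
  then have "(\<lambda>n. exp_neg (ennreal t * Psi_ext \<nu> (ennreal (1 / real (Suc n))))) \<longlonglongrightarrow>
      exp_neg (ennreal t * (INF n. Psi_ext \<nu> (ennreal (1 / real (Suc n)))))"
    by (intro tendsto_exp_neg ennreal_tendsto_cmult) auto
  ultimately show "expectation (\<lambda>\<omega>. of_bool (L t \<omega> < \<top>)) = exp_neg (ennreal t * (INF n. Psi_ext \<nu> (ennreal (1 / real (Suc n)))))"
    using t by (simp add: laplace LIMSEQ_unique)
qed

text \<open>A subordinator has no fixed jump times.\<close>

lemma AE_left_limit:
  assumes c: "0 < c" shows "AE \<omega> in M. ((\<lambda>s. L s \<omega>) \<longlongrightarrow> L c \<omega>) (at_left c)"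
proof -
  define s where "s n = c - c / real (n + 2)" for n :: nat
  have s: "0 < s n" "s n < c" "s n \<le> s (Suc n)" for n
    using c by (auto simp: s_def field_simps add_pos_nonneg add_nonneg_pos)
  have s_lim: "s \<longlonglongrightarrow> c"
  proof -
    have "(\<lambda>n. c - c / real (n + 2)) \<longlonglongrightarrow> c - 0"
      by (intro tendsto_intros LIMSEQ_ignore_initial_segment[OF lim_const_over_n])
    then show ?thesis by (simp add: s_def[abs_def])
  qed
  have [measurable]: "L (s n) \<in> borel_measurable M" "L c \<in> borel_measurable M" for n
    using s[of n] c by (auto intro!: meas_L)
  have "AE \<omega> in M. (\<lambda>n. exp_neg (L (s n) \<omega>)) \<longlonglongrightarrow> exp_neg (L c \<omega>)"
  proof (rule AE_tendsto_of_expectation)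
    show "(\<lambda>n. expectation (\<lambda>\<omega>. exp_neg (L (s n) \<omega>))) \<longlonglongrightarrow> expectation (\<lambda>\<omega>. exp_neg (L c \<omega>))"
      using exp_neg_mult_tendsto[OF c s_lim s(1), of "Psi_ext \<nu> 1"] laplace[of _ 1] s(1) c
      by (simp add: less_imp_le)
  qed (use s s(1,2)[THEN less_imp_le] c in \<open>auto simp: exp_neg_le_iff intro!: mono_L\<close>)
  with AE_space show ?thesis
  proof eventually_elim
    fix \<omega> assume \<omega>: "\<omega> \<in> space M" and lim: "(\<lambda>n. exp_neg (L (s n) \<omega>)) \<longlonglongrightarrow> exp_neg (L c \<omega>)"
    show "((\<lambda>s. L s \<omega>) \<longlongrightarrow> L c \<omega>) (at_left c)"
    proof (rule increasing_tendsto)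
      show "\<forall>\<^sub>F s in at_left c. L s \<omega> \<le> L c \<omega>"
        using eventually_at_left_real[OF c] by eventually_elim (auto intro!: mono_L \<omega>)
      fix x assume "x < L c \<omega>"
      then have "exp_neg (L c \<omega>) < exp_neg x" by (simp add: exp_neg_less_iff)
      from order_tendstoD(2)[OF lim this] obtain n where "exp_neg (L (s n) \<omega>) < exp_neg x"
        by (auto dest: eventually_happens)
      then have x: "x < L (s n) \<omega>" by (simp add: exp_neg_less_iff)
      show "\<forall>\<^sub>F s in at_left c. x < L s \<omega>"
        using eventually_at_left_real[OF s(2)[of n]]
        by eventually_elim (use s(1)[of n] in \<open>auto intro!: less_le_trans[OF x] mono_L \<omega>\<close>)
    qed
  qed
qed

text \<open>The indicator of \<open>{L s = 0}\<close> is \<open>e\<^sup>-\<^sup>\<infinity>\<^sup>L\<^sup>(\<^sup>s\<^sup>)\<close>, so the argument for left limits applies from the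
  right; convergence of indicators means that they are eventually equal.\<close>

lemma AE_zero_beyond:
  assumes c: "0 < c" shows "AE \<omega> in M. L c \<omega> = 0 \<longrightarrow> (\<exists>d>c. L d \<omega> = 0)"
proof -
  define s where "s n = c + c / real (Suc n)" for n :: nat
  have s: "0 < s n" "c < s n" "s (Suc n) \<le> s n" for n
    using c by (auto simp: s_def field_simps add_pos_nonneg add_nonneg_pos)
  have s_lim: "s \<longlonglongrightarrow> c"
  proof -
    have "(\<lambda>n. c + c / real (Suc n)) \<longlonglongrightarrow> c + 0"
      by (intro tendsto_intros LIMSEQ_Suc[OF lim_const_over_n])
    then show ?thesis by (simp add: s_def[abs_def])
  qed
  have [measurable]: "L (s n) \<in> borel_measurable M" "L c \<in> borel_measurable M" for n
    using s[of n] c by (auto intro!: meas_L)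
  have "AE \<omega> in M. (\<lambda>n. 1 - exp_neg (\<top> * L (s n) \<omega>)) \<longlonglongrightarrow> 1 - exp_neg (\<top> * L c \<omega>)"
  proof (rule AE_tendsto_of_expectation)
    have "(\<lambda>n. 1 - expectation (\<lambda>\<omega>. exp_neg (\<top> * L (s n) \<omega>))) \<longlonglongrightarrow> 1 - expectation (\<lambda>\<omega>. exp_neg (\<top> * L c \<omega>))"
      using exp_neg_mult_tendsto[OF c s_lim s(1), of "Psi_ext \<nu> \<top>"] laplace[of _ \<top>] s(1) c
      by (intro tendsto_intros) (simp add: less_imp_le)
    moreover have "integrable M (\<lambda>\<omega>. exp_neg (\<top> * L (s n) \<omega>))" "integrable M (\<lambda>\<omega>. exp_neg (\<top> * L c \<omega>))" for n
      by (rule integrable_const_bound[of _ 1], auto)+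
    ultimately show "(\<lambda>n. expectation (\<lambda>\<omega>. 1 - exp_neg (\<top> * L (s n) \<omega>))) \<longlonglongrightarrow> expectation (\<lambda>\<omega>. 1 - exp_neg (\<top> * L c \<omega>))"
      by (simp add: prob_space)
  qed (use s s(1,2)[THEN less_imp_le] c in \<open>auto simp: exp_neg_le_iff intro!: mult_left_mono mono_L\<close>)
  with AE_space show ?thesis
  proof eventually_elim
    fix \<omega> assume \<omega>: "\<omega> \<in> space M" and lim: "(\<lambda>n. 1 - exp_neg (\<top> * L (s n) \<omega>)) \<longlonglongrightarrow> 1 - exp_neg (\<top> * L c \<omega>)"
    show "L c \<omega> = 0 \<longrightarrow> (\<exists>d>c. L d \<omega> = 0)"
    proof
      assume "L c \<omega> = 0"
      with order_tendstoD(2)[OF lim, of 1] obtain n where "1 - exp_neg (\<top> * L (s n) \<omega>) < 1"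
        by (auto dest: eventually_happens)
      then have "L (s n) \<omega> = 0" by (cases "L (s n) \<omega> = 0") (auto simp: ennreal_top_mult)
      with s show "\<exists>d>c. L d \<omega> = 0" by blast
    qed
  qed
qed

text \<open>Left-continuity at \<open>c\<close> does not exclude an explosion, with \<open>L s\<close> finite before \<open>c\<close> and tending
  to \<open>\<infinity>\<close>; survival probabilities do.\<close>

lemma AE_killed_before:
  assumes c: "0 < c" shows "AE \<omega> in M. L c \<omega> = \<top> \<longrightarrow> (\<exists>d>0. d < c \<and> L d \<omega> = \<top>)"
proof -
  define s where "s n = c - c / real (n + 2)" for n :: nat
  have s: "0 < s n" "s n < c" "s n \<le> s (Suc n)" for n
    using c by (auto simp: s_def field_simps add_pos_nonneg add_nonneg_pos)
  have s_lim: "s \<longlonglongrightarrow> c"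
  proof -
    have "(\<lambda>n. c - c / real (n + 2)) \<longlonglongrightarrow> c - 0"
      by (intro tendsto_intros LIMSEQ_ignore_initial_segment[OF lim_const_over_n])
    then show ?thesis by (simp add: s_def[abs_def])
  qed
  have [measurable]: "L (s n) \<in> borel_measurable M" "L c \<in> borel_measurable M" for n
    using s[of n] c by (auto intro!: meas_L)
  obtain q where q: "\<And>t. 0 \<le> t \<Longrightarrow> expectation (\<lambda>\<omega>. of_bool (L t \<omega> < \<top>)) = exp_neg (ennreal t * q)"
    using expectation_finite by blast
  have "AE \<omega> in M. (\<lambda>n. of_bool (L (s n) \<omega> < \<top>) :: real) \<longlonglongrightarrow> of_bool (L c \<omega> < \<top>)"
  proof (rule AE_tendsto_of_expectation)
    have e: "expectation (\<lambda>\<omega>. of_bool (L (s n) \<omega> < \<top>)) = exp_neg (ennreal (s n) * q)"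
      "expectation (\<lambda>\<omega>. of_bool (L c \<omega> < \<top>)) = exp_neg (ennreal c * q)" for n
      using q[of "s n"] q[of c] s(1)[of n] c by simp_all
    show "(\<lambda>n. expectation (\<lambda>\<omega>. of_bool (L (s n) \<omega> < \<top>))) \<longlonglongrightarrow> expectation (\<lambda>\<omega>. of_bool (L c \<omega> < \<top>) :: real)"
      using exp_neg_mult_tendsto[OF c s_lim s(1), of q] by (simp only: e)
  next
    fix n \<omega> assume \<omega>: "\<omega> \<in> space M"
    have "L (s n) \<omega> \<le> L c \<omega>" "L (s n) \<omega> \<le> L (s (Suc n)) \<omega>"
      using s s(1,2)[THEN less_imp_le] c by (auto intro!: mono_L \<omega>)
    then show "0 \<le> (of_bool (L c \<omega> < \<top>) :: real) \<and> (of_bool (L c \<omega> < \<top>) :: real) \<le> of_bool (L (s n) \<omega> < \<top>) \<and> (of_bool (L (s n) \<omega> < \<top>) :: real) \<le> 1"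
      "(of_bool (L (s (Suc n)) \<omega> < \<top>) :: real) \<le> of_bool (L (s n) \<omega> < \<top>)"
      by (auto dest: le_less_trans)
  qed measurable
  with AE_space show ?thesis
  proof eventually_elim
    fix \<omega> assume \<omega>: "\<omega> \<in> space M" and lim: "(\<lambda>n. of_bool (L (s n) \<omega> < \<top>) :: real) \<longlonglongrightarrow> of_bool (L c \<omega> < \<top>)"
    show "L c \<omega> = \<top> \<longrightarrow> (\<exists>d>0. d < c \<and> L d \<omega> = \<top>)"
    proof
      assume "L c \<omega> = \<top>"
      with order_tendstoD(2)[OF lim, of 1] obtain n where "(of_bool (L (s n) \<omega> < \<top>) :: real) < 1"
        by (auto dest: eventually_happens)
      then have "L (s n) \<omega> = \<top>" by (auto simp flip: top.not_eq_extremum split: if_splits)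
      with s show "\<exists>d>0. d < c \<and> L d \<omega> = \<top>" by blast
    qed
  qed
qed

text \<open>The conditions at fixed times are used at the countably many jumps of \<open>F\<close> and at the two ends
  of its support. The path is extended by \<open>0\<close> to negative times. Scaling the path rather than \<open>F\<close>
  covers the second integral of the integration by parts.\<close>

lemma AE_compatible_path:
  assumes F: "nonneg_cdf F" and t: "0 < t"
  shows "AE \<omega> in M. compatible_path F (\<lambda>s. L (max 0 (t * s)) \<omega>)"
proof -
  define D where "D = {c. 0 < c \<and> \<not> isCont F c}"
  have D: "countable D"
    by (rule countable_subset[of _ "{c. \<not> isCont F c}"])
      (use F in \<open>auto simp: D_def nonneg_cdf_def intro: mono_ctble_discont\<close>)
  have 1: "AE \<omega> in M. \<forall>c\<in>D. ((\<lambda>s. L s \<omega>) \<longlongrightarrow> L (t * c) \<omega>) (at_left (t * c))"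
    using AE_left_limit t by (subst AE_ball_countable[OF D]) (auto simp: D_def)
  have 2: "AE \<omega> in M. 0 < c \<longrightarrow> L (t * c) \<omega> = 0 \<longrightarrow> (\<exists>d>t * c. L d \<omega> = 0)" for c
    using AE_zero_beyond[of "t * c"] t by (cases "0 < c") auto
  have 3: "AE \<omega> in M. 0 < c \<longrightarrow> L (t * c) \<omega> = \<top> \<longrightarrow> (\<exists>d>0. d < t * c \<and> L d \<omega> = \<top>)" for c
    using AE_killed_before[of "t * c"] t by (cases "0 < c") auto
  show ?thesis
    using AE_space AE_rc_L 1 2[of "Inf {s. 0 < F s}"] 3[of "Inf {s. F s = 1}"]
  proof eventually_elim
    fix \<omega> assume \<omega>: "\<omega> \<in> space M" and rc: "\<forall>t\<ge>0. continuous (at_right t) (\<lambda>t. L t \<omega>)"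
      and lc: "\<forall>c\<in>D. ((\<lambda>s. L s \<omega>) \<longlongrightarrow> L (t * c) \<omega>) (at_left (t * c))"
      and lo: "0 < Inf {s. 0 < F s} \<longrightarrow> L (t * Inf {s. 0 < F s}) \<omega> = 0 \<longrightarrow> (\<exists>d>t * Inf {s. 0 < F s}. L d \<omega> = 0)"
      and up: "0 < Inf {s. F s = 1} \<longrightarrow> L (t * Inf {s. F s = 1}) \<omega> = \<top> \<longrightarrow> (\<exists>d>0. d < t * Inf {s. F s = 1} \<and> L d \<omega> = \<top>)"
    let ?X = "\<lambda>s. L (max 0 (t * s)) \<omega>"
    have rcX: "(?X \<longlongrightarrow> ?X x) (at_right x)" if "0 \<le> x" for x
    proof -
      have "filterlim (\<lambda>s. max 0 (t * s)) (at_right (t * x)) (at_right x)"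
        unfolding filterlim_at
      proof
        show "((\<lambda>s. max 0 (t * s)) \<longlongrightarrow> t * x) (at_right x)"
          by (rule tendsto_eq_rhs[OF tendsto_max[OF tendsto_const tendsto_mult[OF tendsto_const tendsto_ident_at]]])
            (use that t in simp)
        show "\<forall>\<^sub>F s in at_right x. max 0 (t * s) \<in> {t * x<..} \<and> max 0 (t * s) \<noteq> t * x"
          using eventually_at_right_less[of x] by eventually_elim (use that t in \<open>auto simp: max_def mult_pos_pos\<close>)
      qed
      moreover have "((\<lambda>s. L s \<omega>) \<longlongrightarrow> L (t * x) \<omega>) (at_right (t * x))"
        using rc that t by (simp add: continuous_within)
      ultimately have "(?X \<longlongrightarrow> L (t * x) \<omega>) (at_right x)" by (rule filterlim_compose[rotated])
      then show ?thesis using that t by (simp add: max_def)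
    qed
    have lcX: "(?X \<longlongrightarrow> ?X x) (at_left x)" if "x \<in> D" for x
    proof -
      have x: "0 < x" using that by (simp add: D_def)
      have "filterlim (\<lambda>s. max 0 (t * s)) (at_left (t * x)) (at_left x)"
        unfolding filterlim_at
      proof
        show "((\<lambda>s. max 0 (t * s)) \<longlongrightarrow> t * x) (at_left x)"
          by (rule tendsto_eq_rhs[OF tendsto_max[OF tendsto_const tendsto_mult[OF tendsto_const tendsto_ident_at]]])
            (use x t in simp)
        show "\<forall>\<^sub>F s in at_left x. max 0 (t * s) \<in> {..<t * x} \<and> max 0 (t * s) \<noteq> t * x"
          using eventually_at_left_real[OF x] by eventually_elim (use x t in \<open>auto simp: max_def mult_pos_pos\<close>)
      qed
      from filterlim_compose[OF lc[rule_format, OF that] this]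
      show ?thesis using x t by (simp add: max_def)
    qed
    show "compatible_path F ?X"
    proof
      show "mono F" "(F \<longlongrightarrow> 1) at_top" using F by (auto simp: nonneg_cdf_def)
      show "continuous (at_right x) F" for x using F by (auto simp: nonneg_cdf_def)
      show "F x = 0" if "x < 0" for x using F that by (auto simp: nonneg_cdf_def)
      show "mono ?X" using t by (auto simp: mono_def intro!: mono_L[OF \<omega>] max.mono)
      show "continuous (at_right x) ?X" if "0 \<le> x" for x using rcX[OF that] by (simp add: continuous_within)
      show "?X x = 0" if "x \<le> 0" for x
        using L_0[OF \<omega>] mult_nonneg_nonpos[of t x] that t by (simp add: max_absorb1)
      show "isCont F c \<or> isCont ?X c" if "0 < c" for c
        using rcX[of c] lcX[of c] that by (auto simp: D_def isCont_def filterlim_at_split)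
      show "\<exists>d>c. ?X d = 0" if h: "0 < c" "c = Inf {s. 0 < F s}" "?X c = 0" for c
      proof -
        have "L (t * c) \<omega> = 0" using h t by (simp add: max_def)
        then obtain d where "t * c < d" "L d \<omega> = 0" using lo[folded h(2)] h by auto
        moreover have "0 < d" using \<open>t * c < d\<close> h t by (meson less_trans mult_pos_pos)
        ultimately show ?thesis using t by (intro exI[of _ "d / t"]) (auto simp: field_simps)
      qed
      show "\<exists>d<c. ?X d = \<top>" if h: "0 < c" "c = Inf {s. F s = 1}" "?X c = \<top>" for c
      proof -
        have "L (t * c) \<omega> = \<top>" using h t by (simp add: max_def)
        then obtain d where "0 < d" "d < t * c" "L d \<omega> = \<top>" using up[folded h(2)] h by auto
        then show ?thesis using t by (intro exI[of _ "d / t"]) (auto simp: field_simps)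
      qed
    qed
  qed
qed

end

section \<open>The integral process and its Laplace transform\<close>

lemma gen_inv_scale:
  assumes t: "0 < t" and y: "y \<in> level_range G"
  shows "gen_inv (\<lambda>s. G (s / t)) y = t * gen_inv G y"
proof (rule antisym)
  let ?S = "{s. 0 < s \<and> ereal y < G s}" and ?S' = "{s. 0 < s \<and> ereal y < G (s / t)}"
  have ne: "?S \<noteq> {}" using y by (auto simp: level_range_def)
  then obtain s where "s \<in> ?S" by blast
  then have "t * s \<in> ?S'" using t by simp
  then have ne': "?S' \<noteq> {}" by blast
  have bdd: "bdd_below ?S" "bdd_below ?S'" by (auto intro!: bdd_belowI[of _ 0])
  have "Inf ?S' / t \<le> Inf ?S"
  proof (rule cInf_greatest[OF ne])
    fix s assume "s \<in> ?S"
    then have "Inf ?S' \<le> t * s" using t by (intro cInf_lower bdd) auto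
    then show "Inf ?S' / t \<le> s" using t by (simp add: field_simps)
  qed
  then show "gen_inv (\<lambda>s. G (s / t)) y \<le> t * gen_inv G y"
    using t by (simp add: gen_inv_def field_simps)
  have "t * Inf ?S \<le> Inf ?S'"
  proof (rule cInf_greatest[OF ne'])
    fix s assume "s \<in> ?S'"
    then have "Inf ?S \<le> s / t" using t by (intro cInf_lower bdd) auto
    then show "t * Inf ?S \<le> s" using t by (simp add: field_simps)
  qed
  then show "t * gen_inv G y \<le> gen_inv (\<lambda>s. G (s / t)) y" by (simp add: gen_inv_def)
qed

lemma level_range_scale:
  assumes "0 < t" shows "level_range (\<lambda>s. G (s / t)) = level_range G"
proof -
  have "(\<exists>s>0. P (s / t)) \<longleftrightarrow> (\<exists>s>0. P s)" for P
  proof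
    assume "\<exists>s>0. P (s / t)"
    then show "\<exists>s>0. P s" using assms divide_pos_pos by blast
  next
    assume "\<exists>s>0. P s"
    then obtain s where "0 < s" "P s" by blast
    then show "\<exists>s>0. P (s / t)" using assms by (intro exI[of _ "t * s"]) simp
  qed
  from this[of "\<lambda>s. G s \<le> ereal _"] this[of "\<lambda>s. ereal _ < G s"] show ?thesis
    unfolding level_range_def by simp
qed

text \<open>The integration by parts relates \<open>L\<close> to \<open>F(\<sqdot> / t)\<close>, while the theorem asks for an integral of
  the scaled path \<open>s \<mapsto> L (s t)\<close> with respect to \<open>log F\<close>.\<close>

lemma stieltjes_scale:
  assumes "0 < t" shows "stieltjes X (\<lambda>s. G (s / t)) = stieltjes (\<lambda>s. X (t * s)) G"
  unfolding stieltjes_def level_range_scale[OF assms]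
  by (intro nn_integral_cong) (auto simp: indicator_def gen_inv_scale[OF assms])

lemma ennreal_div_real: "0 \<le> s \<Longrightarrow> 0 < t \<Longrightarrow> ennreal s / ennreal t = ennreal (s / t)"
  by (rule divide_ennreal)

lemma H_integrand_eq:
  assumes F: "nonneg_cdf F" and "0 < t" "0 < s"
  shows "H_integrand F t s = neg_log (Lim (at_left s) (\<lambda>s. F (s / t)))"
proof -
  interpret compatible_path F "\<lambda>_. 0"
    by unfold_locales (use F in \<open>auto simp: nonneg_cdf_def mono_def intro: gt_ex\<close>)
  have "filterlim (\<lambda>s. s / t) (at_left (s / t)) (at_left s)"
    unfolding filterlim_at using assms
    by (auto intro!: tendsto_divide tendsto_ident_at eventually_mono[OF eventually_at_left_real[of 0 s]] simp: divide_strict_right_mono)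
  from filterlim_compose[OF tendsto_\<Phi>m this]
  have "Lim (at_left s) (\<lambda>s. F (s / t)) = \<Phi>m (s / t)" by (intro tendsto_Lim) auto
  moreover have "df_left F (ennreal s / ennreal t) = \<Phi>m (s / t)"
    using assms by (simp add: df_left_def ennreal_div_real \<Phi>m_def)
  ultimately show ?thesis by (simp add: H_integrand_def)
qed

text \<open>At \<open>t = 0\<close> the integrand vanishes on \<open>(0,\<infinity>)\<close>, which lets this time take part in all that
  follows.\<close>

lemma H_integrand_0: "0 < s \<Longrightarrow> H_integrand F 0 s = 0"
proof -
  assume "0 < s"
  then have "ennreal s / ennreal 0 = \<top>" by (simp add: ennreal_divide_zero)
  then show ?thesis by (simp add: H_integrand_def df_left_def)
qed

lemma H_integrand_antimono:
  assumes F: "nonneg_cdf F" and "0 \<le> t" "0 < s" "s \<le> s'"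
  shows "H_integrand F t s' \<le> H_integrand F t s"
proof (cases "t = 0")
  case True
  then show ?thesis using assms by (simp add: H_integrand_0)
next
  case False
  with assms have t: "0 < t" by simp
  interpret compatible_path "\<lambda>s. F (s / t)" "\<lambda>_. 0"
    by unfold_locales (use nonneg_cdf_scale[OF F t] in \<open>auto simp: nonneg_cdf_def mono_def intro: gt_ex\<close>)
  show ?thesis using f_antimono[OF assms(4)] assms t by (simp add: H_integrand_eq[OF F t] f_def \<Phi>m_def)
qed

lemma has_RS_integral_0: "has_RS_integral (\<lambda>_. 0) G 0"
proof -
  have "rs_sum (\<lambda>_. 0) G = (\<lambda>p. 0)" by (auto simp: fun_eq_iff rs_sum_def)
  then show ?thesis unfolding has_RS_integral_def has_RS_integral_on_def
    by (intro exI[of _ "\<lambda>_ _. 0"]) (simp add: case_prod_beta')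
qed

lemma (in complete_measure) borel_measurable_AE_cong:
  fixes f g :: "'a \<Rightarrow> 'b::topological_space"
  assumes "f \<in> borel_measurable M" "AE x in M. f x = g x"
  shows "g \<in> borel_measurable M"
proof (rule measurableI)
  fix A :: "'b set" assume A: "A \<in> sets borel"
  have "f -` A \<inter> space M \<in> sets M" using assms(1) A by (rule measurable_sets)
  then show "g -` A \<inter> space M \<in> sets M"
    by (rule in_sets_AE[rotated]) (use assms(2) AE_space in \<open>auto elim: eventually_elim2\<close>)
qed simp

context subordinator begin

text \<open>A version of the process that is measurable on the original space. The process itself is only
  defined up to null sets and is measurable on the completion.\<close>

definition H_lim :: "(real \<Rightarrow> real) \<Rightarrow> real \<Rightarrow> 'a \<Rightarrow> ennreal" where
  "H_lim F t \<omega> = liminf (\<lambda>n. lower_sum (H_integrand F t) (\<lambda>s. enn2ereal (L s \<omega>)) n)"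

lemma rs_incr_measurable [measurable]:
  "0 \<le> u \<Longrightarrow> 0 \<le> v \<Longrightarrow> (\<lambda>\<omega>. rs_incr (\<lambda>s. enn2ereal (L s \<omega>)) u v) \<in> borel_measurable M"
  unfolding rs_incr_def by measurable

lemma lower_sum_measurable [measurable]:
  "(\<lambda>\<omega>. lower_sum g (\<lambda>s. enn2ereal (L s \<omega>)) n) \<in> borel_measurable M"
  unfolding lower_sum_def by measurable

lemma H_lim_measurable [measurable]: "H_lim F t \<in> borel_measurable M"
  unfolding H_lim_def by measurable

lemma AE_integrals:
  assumes F: "nonneg_cdf F" and t: "0 < t"
  shows "AE \<omega> in M. has_RS_integral (H_integrand F t) (\<lambda>s. enn2ereal (L s \<omega>)) (H_process F L t \<omega>) \<and>
    has_RS_integral (\<lambda>s. L (s * t) \<omega>) (\<lambda>s. elog (F s)) (H_process F L t \<omega>) \<and>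
    lower_sum (H_integrand F t) (\<lambda>s. enn2ereal (L s \<omega>)) \<longlonglongrightarrow> H_process F L t \<omega>"
  using AE_space AE_compatible_path[OF nonneg_cdf_scale[OF F t] zero_less_one] AE_compatible_path[OF F t]
proof eventually_elim
  fix \<omega> assume \<omega>: "\<omega> \<in> space M"
    and c1: "compatible_path (\<lambda>s. F (s / t)) (\<lambda>s. L (max 0 (1 * s)) \<omega>)"
    and c2: "compatible_path F (\<lambda>s. L (max 0 (t * s)) \<omega>)"
  interpret p1: compatible_path "\<lambda>s. F (s / t)" "\<lambda>s. L (max 0 s) \<omega>" using c1 by simp
  interpret p2: compatible_path F "\<lambda>s. L (max 0 (t * s)) \<omega>" by (rule c2)
  define I where "I = stieltjes p1.f p1.G"
  have f: "p1.f s = H_integrand F t s" if "0 < s" for s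
    using H_integrand_eq[OF F t that] by (simp add: p1.f_def p1.\<Phi>m_def)
  have G: "p1.G s = enn2ereal (L s \<omega>)" if "0 \<le> s" for s
    using that by (simp add: p1.G_def)
  have 1: "has_RS_integral (H_integrand F t) (\<lambda>s. enn2ereal (L s \<omega>)) I"
    using p1.has_RS_integral_wrt_path f G unfolding I_def
    by (subst has_RS_integral_cong[of _ p1.f _ p1.G]) simp_all
  then have I: "H_process F L t \<omega> = I" unfolding H_process_def by (rule RS_integral_eq)
  have "I = stieltjes (\<lambda>s. L (max 0 s) \<omega>) (\<lambda>s. p2.K (s / t))"
    using p1.integration_by_parts by (simp add: I_def p1.K_def[abs_def] p2.K_def)
  also have "\<dots> = stieltjes (\<lambda>s. L (max 0 (t * s)) \<omega>) p2.K"
    using stieltjes_scale[OF t, of "\<lambda>s. L (max 0 s) \<omega>" p2.K] by simp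
  finally have "has_RS_integral (\<lambda>s. L (max 0 (t * s)) \<omega>) p2.K I"
    using p2.has_RS_integral_wrt_log_cdf by simp
  then have 2: "has_RS_integral (\<lambda>s. L (s * t) \<omega>) (\<lambda>s. elog (F s)) I"
    by (subst has_RS_integral_cong[of _ "\<lambda>s. L (max 0 (t * s)) \<omega>" _ p2.K])
      (use t in \<open>simp_all add: p2.K_def mult.commute\<close>)
  have "lower_sum (H_integrand F t) (\<lambda>s. enn2ereal (L s \<omega>)) = lower_sum p1.f p1.G"
    by (auto simp: lower_sum_def fun_eq_iff f G rs_incr_def intro!: sum.cong)
  with 1 2 p1.lower_sum_tendsto_path show "has_RS_integral (H_integrand F t) (\<lambda>s. enn2ereal (L s \<omega>)) (H_process F L t \<omega>) \<and>
    has_RS_integral (\<lambda>s. L (s * t) \<omega>) (\<lambda>s. elog (F s)) (H_process F L t \<omega>) \<and>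
    lower_sum (H_integrand F t) (\<lambda>s. enn2ereal (L s \<omega>)) \<longlonglongrightarrow> H_process F L t \<omega>"
    by (simp add: I I_def)
qed

lemma AE_lower_sum_H:
  assumes F: "nonneg_cdf F" and t: "0 \<le> t"
  shows "AE \<omega> in M. lower_sum (H_integrand F t) (\<lambda>s. enn2ereal (L s \<omega>)) \<longlonglongrightarrow> H_process F L t \<omega>"
proof (cases "t = 0")
  case True
  have "has_RS_integral (H_integrand F 0) (\<lambda>s. enn2ereal (L s \<omega>)) 0" for \<omega>
    using has_RS_integral_0 by (subst has_RS_integral_cong[of _ "\<lambda>_. 0"]) (auto simp: H_integrand_0)
  then have "H_process F L 0 \<omega> = 0" for \<omega> unfolding H_process_def by (intro RS_integral_eq)
  moreover have "lower_sum (H_integrand F 0) (\<lambda>s. enn2ereal (L s \<omega>)) = (\<lambda>n. 0)" for \<omega>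
    by (simp add: lower_sum_def H_integrand_0 fun_eq_iff)
  ultimately show ?thesis using True by simp
next
  case False
  with t show ?thesis using AE_integrals[OF F, of t] by auto
qed

lemma AE_H_lim:
  assumes "nonneg_cdf F" "0 \<le> t" shows "AE \<omega> in M. H_lim F t \<omega> = H_process F L t \<omega>"
  using AE_lower_sum_H[OF assms] by eventually_elim (simp add: H_lim_def lim_imp_Liminf)

lemma H_process_measurable:
  assumes "nonneg_cdf F" "0 \<le> t" shows "H_process F L t \<in> borel_measurable (completion M)"
proof -
  show ?thesis
    by (rule completion.borel_measurable_AE_cong[of "H_lim F t"])
      (auto simp: AE_completion_iff AE_H_lim[OF assms] intro: measurable_completion)
qed

lemma increment_independent_set:
  assumes s: "0 \<le> s" "0 \<le> h" and A: "A \<in> past_algebra M L s" and A': "A \<in> sets M"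
    and \<phi>[measurable]: "\<phi> \<in> borel_measurable borel"
  shows "(\<integral>\<^sup>+\<omega>. indicator A \<omega> * (indicator {\<omega>. L s \<omega> < \<top>} \<omega> * \<phi> (L (s + h) \<omega> - L s \<omega>)) \<partial>M) =
     (\<integral>\<^sup>+\<omega>. indicator A \<omega> * indicator {\<omega>. L s \<omega> < \<top>} \<omega> \<partial>M) * (\<integral>\<^sup>+\<omega>. \<phi> (L h \<omega>) \<partial>M)"
proof -
  note [measurable] = A' meas_L[OF s(1)] meas_L[OF s(2)] meas_L[OF add_nonneg_nonneg[OF s]]
  define E where "E = {\<omega> \<in> space M. \<omega> \<in> A \<and> L s \<omega> < \<top>}"
  have [measurable]: "E \<in> sets M" unfolding E_def by measurable
  define D where "D \<omega> = L (s + h) \<omega> - L s \<omega>" for \<omega>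
  have [measurable]: "D \<in> borel_measurable M" unfolding D_def by measurable
  have "distr (density M (indicator E)) borel D = scale_measure (emeasure M E) (distr M borel (L h))"
  proof (rule measure_eqI)
    fix B assume "B \<in> sets (distr (density M (indicator E)) borel D)"
    then have B[measurable]: "B \<in> sets borel" by simp
    have "emeasure (distr (density M (indicator E)) borel D) B =
        (\<integral>\<^sup>+\<omega>. indicator E \<omega> * indicator (D -` B \<inter> space M) \<omega> \<partial>M)"
      by (simp add: emeasure_distr emeasure_density)
    also have "\<dots> = (\<integral>\<^sup>+\<omega>. indicator (E \<inter> (D -` B \<inter> space M)) \<omega> \<partial>M)"
      by (simp only: indicator_inter_arith)
    also have "\<dots> = emeasure M (E \<inter> (D -` B \<inter> space M))"
      by (rule nn_integral_indicator) measurable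
    also have "E \<inter> (D -` B \<inter> space M) = {\<omega>\<in>space M. \<omega> \<in> A \<and> L s \<omega> < \<infinity> \<and> L (s + h) \<omega> - L s \<omega> \<in> B}"
      by (auto simp: E_def D_def)
    also have "emeasure M \<dots> = ennreal (measure M {\<omega>\<in>space M. \<omega> \<in> A \<and> L s \<omega> < \<infinity>} * measure M {\<omega>\<in>space M. L h \<omega> \<in> B})"
      using levy s A B by (simp add: emeasure_eq_measure levy_subordinator_def indep_stat_increments_def)
    also have "\<dots> = emeasure M E * emeasure (distr M borel (L h)) B"
      by (simp add: emeasure_distr emeasure_eq_measure ennreal_mult E_def vimage_def Int_def conj_commute)
    finally show "emeasure (distr (density M (indicator E)) borel D) B =
        emeasure (scale_measure (emeasure M E) (distr M borel (L h))) B" by simp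
  qed simp
  then have "(\<integral>\<^sup>+x. \<phi> x \<partial>distr (density M (indicator E)) borel D) = emeasure M E * (\<integral>\<^sup>+x. \<phi> x \<partial>distr M borel (L h))"
    by (simp add: nn_integral_scale_measure)
  then have "(\<integral>\<^sup>+\<omega>. indicator E \<omega> * \<phi> (D \<omega>) \<partial>M) = emeasure M E * (\<integral>\<^sup>+\<omega>. \<phi> (L h \<omega>) \<partial>M)"
    by (simp add: nn_integral_distr nn_integral_density)
  moreover have "emeasure M E = (\<integral>\<^sup>+\<omega>. indicator A \<omega> * indicator {\<omega>. L s \<omega> < \<top>} \<omega> \<partial>M)"
  proof -
    have "(\<integral>\<^sup>+\<omega>. indicator A \<omega> * indicator {\<omega>. L s \<omega> < \<top>} \<omega> \<partial>M) = (\<integral>\<^sup>+\<omega>. indicator E \<omega> \<partial>M)"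
      by (intro nn_integral_cong) (auto simp: E_def indicator_def)
    then show ?thesis by simp
  qed
  moreover have "(\<integral>\<^sup>+\<omega>. indicator E \<omega> * \<phi> (D \<omega>) \<partial>M) =
     (\<integral>\<^sup>+\<omega>. indicator A \<omega> * (indicator {\<omega>. L s \<omega> < \<top>} \<omega> * \<phi> (L (s + h) \<omega> - L s \<omega>)) \<partial>M)"
    by (auto simp: E_def D_def indicator_def intro!: nn_integral_cong)
  ultimately show ?thesis by simp
qed

definition past :: "real \<Rightarrow> 'a measure" where
  "past s = sigma (space M) {L u -` B \<inter> space M | u B. u \<in> {0..s} \<and> B \<in> sets borel}"

lemma space_past [simp]: "space (past s) = space M"
  by (simp add: past_def space_measure_of_conv)

lemma sets_past: "sets (past s) = past_algebra M L s"
  unfolding past_def past_algebra_def by (rule sets_measure_of) auto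

lemma L_past: "0 \<le> u \<Longrightarrow> u \<le> s \<Longrightarrow> L u \<in> borel_measurable (past s)"
  by (rule measurableI) (auto simp: sets_past past_algebra_def intro!: sigma_sets.Basic)

lemma subalgebra_past: "subalgebra M (past s)"
proof -
  have "past_algebra M L s \<subseteq> sets M"
    unfolding past_algebra_def by (rule sets.sigma_sets_subset) (auto intro: measurable_sets)
  then show ?thesis by (simp add: subalgebra_def sets_past)
qed

text \<open>The passage from events to functions of the past: for fixed \<open>\<phi>\<close> both sides are measures on the
  past of \<open>s\<close>, evaluated at \<open>U\<close>.\<close>

lemma increment_independent:
  assumes s: "0 \<le> s" "0 \<le> h" and U[measurable]: "U \<in> borel_measurable (past s)"
    and \<phi>[measurable]: "\<phi> \<in> borel_measurable borel"
  shows "(\<integral>\<^sup>+\<omega>. U \<omega> * (indicator {\<omega>. L s \<omega> < \<top>} \<omega> * \<phi> (L (s + h) \<omega> - L s \<omega>)) \<partial>M) =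
     (\<integral>\<^sup>+\<omega>. U \<omega> * indicator {\<omega>. L s \<omega> < \<top>} \<omega> \<partial>M) * (\<integral>\<^sup>+\<omega>. \<phi> (L h \<omega>) \<partial>M)"
proof -
  note [measurable] = meas_L[OF s(1)] meas_L[OF s(2)] meas_L[OF add_nonneg_nonneg[OF s]]
  have UM[measurable]: "U \<in> borel_measurable M" by (rule measurable_from_subalg[OF subalgebra_past U])
  define w1 where "w1 \<omega> = indicator {\<omega>. L s \<omega> < \<top>} \<omega> * \<phi> (L (s + h) \<omega> - L s \<omega>)" for \<omega>
  define w2 :: "'a \<Rightarrow> ennreal" where "w2 \<omega> = indicator {\<omega>. L s \<omega> < \<top>} \<omega>" for \<omega>
  define c where "c = (\<integral>\<^sup>+\<omega>. \<phi> (L h \<omega>) \<partial>M)"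
  have w2': "w2 \<omega> = (if L s \<omega> < \<top> then 1 else 0)" for \<omega> by (simp add: w2_def)
  have [measurable]: "w2 \<in> borel_measurable M" unfolding w2' by measurable
  have [measurable]: "w1 \<in> borel_measurable M"
    unfolding w1_def w2_def[symmetric] by measurable
  have sub: "subalgebra (density M w) (past s)" for w :: "'a \<Rightarrow> ennreal"
    using subalgebra_past[of s] by (simp add: subalgebra_def)
  have "restr_to_subalg (density M w1) (past s) = scale_measure c (restr_to_subalg (density M w2) (past s))"
  proof (rule measure_eqI)
    show "sets (restr_to_subalg (density M w1) (past s)) = sets (scale_measure c (restr_to_subalg (density M w2) (past s)))"
      by (simp add: sets_restr_to_subalg[OF sub])
    fix A assume "A \<in> sets (restr_to_subalg (density M w1) (past s))"
    then have A: "A \<in> sets (past s)" by (simp add: sets_restr_to_subalg[OF sub])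
    then have A'[measurable]: "A \<in> sets M" using subalgebra_past[of s] by (auto simp: subalgebra_def)
    have "(\<integral>\<^sup>+\<omega>. indicator A \<omega> * w1 \<omega> \<partial>M) = (\<integral>\<^sup>+\<omega>. indicator A \<omega> * w2 \<omega> \<partial>M) * c"
      using increment_independent_set[OF s A[unfolded sets_past] A' \<phi>] by (simp only: w1_def w2_def c_def)
    then show "emeasure (restr_to_subalg (density M w1) (past s)) A = emeasure (scale_measure c (restr_to_subalg (density M w2) (past s))) A"
      by (simp add: emeasure_restr_to_subalg[OF sub A] emeasure_density mult.commute)
  qed
  then have "(\<integral>\<^sup>+\<omega>. U \<omega> \<partial>restr_to_subalg (density M w1) (past s)) = c * (\<integral>\<^sup>+\<omega>. U \<omega> \<partial>restr_to_subalg (density M w2) (past s))"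
    by (simp add: nn_integral_scale_measure measurable_in_subalg[OF sub])
  then have "(\<integral>\<^sup>+\<omega>. U \<omega> * w1 \<omega> \<partial>M) = (\<integral>\<^sup>+\<omega>. U \<omega> * w2 \<omega> \<partial>M) * c"
    by (simp add: nn_integral_subalgebra2[OF sub U] nn_integral_density mult.commute)
  then show ?thesis by (simp only: w1_def w2_def c_def)
qed

end

lemma lower_sum_ereal: "lower_sum p ereal n = (\<Sum>i<4 ^ n. p (real (Suc i) / 2 ^ n) * ennreal (1 / 2 ^ n))"
proof -
  have "rs_incr ereal (real i / 2 ^ n) (real (Suc i) / 2 ^ n) = ennreal (1 / 2 ^ n)" for i
  proof -
    have rs: "rs_incr ereal u v = ennreal (v - u)" if "u < v" for u v
      using that by (simp add: rs_incr_def flip: ennreal.abs_eq)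
    have "real (Suc i) / 2 ^ n - real i / 2 ^ n = 1 / 2 ^ n" by (simp add: diff_divide_distrib[symmetric])
    then show ?thesis by (subst rs) (simp_all only: divide_strict_right_mono of_nat_less_iff lessI zero_less_power zero_less_numeral)
  qed
  then show ?thesis by (simp add: lower_sum_def del: of_nat_Suc)
qed

lemma lower_sum_sum: "lower_sum (\<lambda>s. \<Sum>t\<in>J. x t * f t s) G n = (\<Sum>t\<in>J. x t * lower_sum (f t) G n)"
proof -
  have "lower_sum (\<lambda>s. \<Sum>t\<in>J. x t * f t s) G n = (\<Sum>i<4 ^ n. \<Sum>t\<in>J.
      x t * (f t (real (Suc i) / 2 ^ n) * rs_incr G (real i / 2 ^ n) (real (Suc i) / 2 ^ n)))"
    unfolding lower_sum_def by (simp only: sum_distrib_right mult.assoc)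
  also have "\<dots> = (\<Sum>t\<in>J. x t * lower_sum (f t) G n)"
    unfolding lower_sum_def sum_distrib_left by (rule sum.swap)
  finally show ?thesis .
qed

lemma gen_inv_ereal: "0 < y \<Longrightarrow> gen_inv ereal y = y"
proof -
  assume y: "0 < y"
  have m: "mono ereal" by (simp add: mono_def)
  have "gen_inv ereal y \<le> y"
  proof (rule dense_ge)
    fix z assume "y < z"
    then show "gen_inv ereal y \<le> z" using gen_inv_bounds(2)[OF m, of y y z] y by simp
  qed
  moreover have "y \<le> gen_inv ereal y" using gen_inv_bounds(1)[OF m, of y y "y + 1"] y by simp
  ultimately show ?thesis by simp
qed

lemma level_range_ereal: "level_range ereal = {0<..}"
proof -
  have "(\<exists>s>0. s \<le> y) \<and> (\<exists>s>0. y < s) \<longleftrightarrow> 0 < y" for y :: real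
    by (auto intro: exI[of _ "y + 1"])
  then show ?thesis by (auto simp: level_range_def)
qed

text \<open>For \<open>G s = s\<close> the lower sums are those of the Lebesgue integral over \<open>(0,\<infinity>)\<close>.\<close>

lemma lower_sum_ereal_tendsto:
  fixes p :: "real \<Rightarrow> real"
  assumes p: "\<And>s s'. 0 < s \<Longrightarrow> s \<le> s' \<Longrightarrow> p s' \<le> p s"
  defines "I \<equiv> (\<integral>\<^sup>+s. ennreal (p s) * indicator {0<..} s \<partial>lborel)"
  shows "lower_sum (\<lambda>s. ennreal (p s)) ereal n \<le> I" "lower_sum (\<lambda>s. ennreal (p s)) ereal \<longlonglongrightarrow> I"
proof -
  have m: "mono_on {0<..} (\<lambda>s. - p s)" using p by (auto simp: mono_on_def)
  then have "countable {s\<in>{0<..}. \<not> isCont (\<lambda>s. - p s) s}" by (intro mono_on_ctble_discont_open) auto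
  then have "AE s in lborel. s \<notin> {s\<in>{0<..}. \<not> isCont (\<lambda>s. - p s) s}"
    by (intro AE_not_in countable_imp_null_set_lborel)
  then have cont: "AE y in lborel. y \<in> level_range ereal \<longrightarrow> isCont (\<lambda>s. ennreal (p s)) (gen_inv ereal y)"
  proof eventually_elim
    fix y assume y: "y \<notin> {s\<in>{0<..}. \<not> isCont (\<lambda>s. - p s) s}"
    show "y \<in> level_range ereal \<longrightarrow> isCont (\<lambda>s. ennreal (p s)) (gen_inv ereal y)"
    proof
      assume "y \<in> level_range ereal"
      then have "0 < y" by (simp add: level_range_ereal)
      with y have "isCont (\<lambda>s. - p s) y" by auto
      from continuous_minus[OF this] have "isCont p y" by simp
      then show "isCont (\<lambda>s. ennreal (p s)) (gen_inv ereal y)"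
        using \<open>0 < y\<close> by (auto simp: gen_inv_ereal isCont_def intro: tendsto_ennrealI)
    qed
  qed
  have I: "stieltjes (\<lambda>s. ennreal (p s)) ereal = I"
    unfolding stieltjes_def I_def level_range_ereal
    by (intro nn_integral_cong) (auto simp: indicator_def gen_inv_ereal)
  have "(ereal \<longlongrightarrow> ereal 0) (at_right 0)" by (intro tendsto_intros)
  from lower_sum_tendsto[OF _ this _ cont] p
  show "lower_sum (\<lambda>s. ennreal (p s)) ereal n \<le> I" "lower_sum (\<lambda>s. ennreal (p s)) ereal \<longlonglongrightarrow> I"
    by (auto simp: I mono_def intro: ennreal_leI)
qed

context subordinator begin

lemma rs_incr_L:
  assumes \<omega>: "\<omega> \<in> space M" and u: "0 \<le> u" "u \<le> v" and fin: "L u \<omega> < \<top>"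
  shows "rs_incr (\<lambda>s. enn2ereal (L s \<omega>)) u v = L v \<omega> - L u \<omega>"
proof -
  obtain q where q: "0 \<le> q" "L u \<omega> = ennreal q" using fin by (cases "L u \<omega>") auto
  show ?thesis
  proof (cases "L v \<omega>")
    case (real r)
    have "ennreal q \<le> ennreal r" using mono_L[OF \<omega> u] q real by simp
    then have "q \<le> r" using real by (simp add: ennreal_le_iff)
    then show ?thesis using q real by (auto simp: rs_incr_def ennreal_minus simp flip: ennreal.abs_eq)
  next
    case top
    then show ?thesis using q by (simp add: rs_incr_def enn2ereal_ennreal)
  qed
qed

lemma laplace_nn:
  assumes "0 \<le> t"
  shows "(\<integral>\<^sup>+\<omega>. ennreal (exp_neg (x * L t \<omega>)) \<partial>M) = ennreal (exp_neg (ennreal t * Psi_ext \<nu> x))"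
proof -
  have [measurable]: "L t \<in> borel_measurable M" using assms by measurable
  have "integrable M (\<lambda>\<omega>. exp_neg (x * L t \<omega>))"
    by (rule integrable_const_bound[of _ 1]) auto
  then show ?thesis by (simp add: nn_integral_eq_integral laplace[OF assms])
qed

text \<open>Killing is harmless since \<open>g\<close> is non-increasing: if the path is killed before the last cell and
  the last weight is positive, then so is the weight of the cell of the killing, and the sum is
  already infinite. Hence the undefined increment after killing never matters.\<close>

lemma laplace_sum:
  fixes g :: "nat \<Rightarrow> ennreal"
  assumes h: "0 < h" and g: "\<And>i j. i \<le> j \<Longrightarrow> g j \<le> g i"
  shows "(\<integral>\<^sup>+\<omega>. ennreal (exp_neg (\<Sum>i<n. g i * rs_incr (\<lambda>s. enn2ereal (L s \<omega>)) (real i * h) (real (Suc i) * h))) \<partial>M) =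
    ennreal (exp_neg (\<Sum>i<n. ennreal h * Psi_ext \<nu> (g i)))"
proof (induction n)
  case 0
  then show ?case by (simp add: emeasure_space_1)
next
  case (Suc n)
  define \<Delta> where "\<Delta> i \<omega> = rs_incr (\<lambda>s. enn2ereal (L s \<omega>)) (real i * h) (real (Suc i) * h)" for i \<omega>
  define X where "X \<omega> = (\<Sum>i<n. g i * \<Delta> i \<omega>)" for \<omega>
  define s where "s = real n * h"
  have s: "0 \<le> s" "real (Suc n) * h = s + h" using h by (auto simp: s_def field_simps)
  show ?case
  proof (cases "g n = 0")
    case True
    then show ?thesis using Suc by (simp add: Psi_ext_def)
  next
    case False
    then have gpos: "0 < g n" by (simp add: zero_less_iff_neq_zero)
    have killed: "X \<omega> = \<top>" if \<omega>: "\<omega> \<in> space M" and k: "L s \<omega> = \<top>" for \<omega>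
    proof -
      \<comment> \<open>the path is killed in the cell before the grid point \<open>m\<close>, whose term of the sum is infinite\<close>
      define m where "m = (LEAST i. L (real i * h) \<omega> = \<top>)"
      have m: "L (real m * h) \<omega> = \<top>" unfolding m_def by (rule LeastI[of _ n]) (use k in \<open>simp add: s_def\<close>)
      have "m \<le> n" unfolding m_def by (rule Least_le) (use k in \<open>simp add: s_def\<close>)
      have "m \<noteq> 0" using m L_0[OF \<omega>] by (intro notI) simp
      then obtain i where i: "m = Suc i" by (cases m) auto
      then have "L (real i * h) \<omega> \<noteq> \<top>" using not_less_Least[of i "\<lambda>i. L (real i * h) \<omega> = \<top>"] by (simp add: m_def)
      then have fin: "L (real i * h) \<omega> < \<top>" by (simp add: top.not_eq_extremum)
      have "\<Delta> i \<omega> = L (real (Suc i) * h) \<omega> - L (real i * h) \<omega>"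
        unfolding \<Delta>_def by (rule rs_incr_L[OF \<omega> _ _ fin]) (use h in \<open>auto simp: field_simps\<close>)
      then have "\<Delta> i \<omega> = \<top>" using m i fin by (auto simp: ennreal_top_minus)
      moreover have "g i \<noteq> 0" using g[of i n] gpos i \<open>m \<le> n\<close> by auto
      moreover have "g i * \<Delta> i \<omega> \<le> X \<omega>" unfolding X_def
        using i \<open>m \<le> n\<close> by (intro member_le_sum) auto
      ultimately show ?thesis by (simp add: ennreal_mult_top top_unique)
    qed
    have X_past: "X \<in> borel_measurable (past s)"
      unfolding X_def
    proof (intro borel_measurable_sum borel_measurable_times_ennreal borel_measurable_const)
      fix i assume "i \<in> {..<n}"
      then have "real (Suc i) \<le> real n" by simp
      then have "real (Suc i) * h \<le> s" unfolding s_def using h by (intro mult_right_mono) auto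
      moreover from this have "real i * h \<le> s" using h by (simp add: distrib_right)
      ultimately have [measurable]: "L (real i * h) \<in> borel_measurable (past s)"
          "L (real (Suc i) * h) \<in> borel_measurable (past s)"
        using h by (auto intro!: L_past)
      show "\<Delta> i \<in> borel_measurable (past s)" unfolding \<Delta>_def rs_incr_def by measurable
    qed
    have "(\<integral>\<^sup>+\<omega>. ennreal (exp_neg (X \<omega> + g n * \<Delta> n \<omega>)) \<partial>M) =
      (\<integral>\<^sup>+\<omega>. ennreal (exp_neg (X \<omega>)) * (indicator {\<omega>. L s \<omega> < \<top>} \<omega> * ennreal (exp_neg (g n * (L (s + h) \<omega> - L s \<omega>)))) \<partial>M)"
    proof (rule nn_integral_cong)
      fix \<omega> assume \<omega>: "\<omega> \<in> space M"
      show "ennreal (exp_neg (X \<omega> + g n * \<Delta> n \<omega>)) =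
        ennreal (exp_neg (X \<omega>)) * (indicator {\<omega>. L s \<omega> < \<top>} \<omega> * ennreal (exp_neg (g n * (L (s + h) \<omega> - L s \<omega>))))"
      proof (cases "L s \<omega> = \<top>")
        case True
        then show ?thesis using killed[OF \<omega>] by simp
      next
        case False
        then have "L s \<omega> < \<top>" by (simp add: top.not_eq_extremum)
        moreover have "\<Delta> n \<omega> = L (s + h) \<omega> - L s \<omega>"
          unfolding \<Delta>_def s(2) s_def[symmetric] by (rule rs_incr_L) (use \<omega> s h \<open>L s \<omega> < \<top>\<close> in auto)
        ultimately show ?thesis by (simp add: exp_neg_add ennreal_mult)
      qed
    qed
    also have "\<dots> = (\<integral>\<^sup>+\<omega>. ennreal (exp_neg (X \<omega>)) * indicator {\<omega>. L s \<omega> < \<top>} \<omega> \<partial>M) *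
        (\<integral>\<^sup>+\<omega>. ennreal (exp_neg (g n * L h \<omega>)) \<partial>M)"
      using X_past h s by (intro increment_independent) auto
    also have "(\<integral>\<^sup>+\<omega>. ennreal (exp_neg (X \<omega>)) * indicator {\<omega>. L s \<omega> < \<top>} \<omega> \<partial>M) = (\<integral>\<^sup>+\<omega>. ennreal (exp_neg (X \<omega>)) \<partial>M)"
    proof (rule nn_integral_cong)
      fix \<omega> assume "\<omega> \<in> space M"
      then show "ennreal (exp_neg (X \<omega>)) * indicator {\<omega>. L s \<omega> < \<top>} \<omega> = ennreal (exp_neg (X \<omega>))"
        using killed[of \<omega>] by (cases "L s \<omega> = \<top>") (auto simp: top.not_eq_extremum)
    qed
    also have "\<dots> = ennreal (exp_neg (\<Sum>i<n. ennreal h * Psi_ext \<nu> (g i)))"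
      using Suc by (simp only: X_def \<Delta>_def)
    also have "(\<integral>\<^sup>+\<omega>. ennreal (exp_neg (g n * L h \<omega>)) \<partial>M) = ennreal (exp_neg (ennreal h * Psi_ext \<nu> (g n)))"
      using h by (intro laplace_nn) simp
    finally show ?thesis
      unfolding X_def \<Delta>_def by (simp add: exp_neg_add ennreal_mult)
  qed
qed

text \<open>The integral \<open>\<integral>\<^sub>0\<^sup>\<infinity> \<Psi>\<^sub>L (g s) ds\<close>, with the order of integration that the lower sums produce and
  that the comparison with the series needs.\<close>

definition H_exponent :: "(real \<Rightarrow> ennreal) \<Rightarrow> ennreal" where
  "H_exponent g = (\<integral>\<^sup>+u. (\<integral>\<^sup>+s. ennreal (1 - exp_neg (u * g s)) * indicator {0<..} s \<partial>lborel) \<partial>\<nu>)"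

lemma laplace_lower_sum:
  assumes g: "\<And>s s'. 0 < s \<Longrightarrow> s \<le> s' \<Longrightarrow> g s' \<le> g s"
  shows "(\<integral>\<^sup>+\<omega>. ennreal (exp_neg (lower_sum g (\<lambda>s. enn2ereal (L s \<omega>)) n)) \<partial>M) =
    ennreal (exp_neg (\<integral>\<^sup>+u. lower_sum (\<lambda>s. ennreal (1 - exp_neg (u * g s))) ereal n \<partial>\<nu>))"
proof -
  have "(\<Sum>i<4 ^ n. ennreal (1 / 2 ^ n) * Psi_ext \<nu> (g (real (Suc i) / 2 ^ n))) =
      (\<integral>\<^sup>+u. lower_sum (\<lambda>s. ennreal (1 - exp_neg (u * g s))) ereal n \<partial>\<nu>)"
    unfolding lower_sum_ereal Psi_ext_def
    by (subst nn_integral_sum) (auto simp: nn_integral_cmult mult.commute)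
  then show ?thesis
    using laplace_sum[of "1 / 2 ^ n" "\<lambda>i. g (real (Suc i) / 2 ^ n)" "4 ^ n"] g
    by (simp add: lower_sum_def divide_right_mono del: of_nat_Suc)
qed

text \<open>Lower sums are linear in the integrand and the grids do not depend on the integrand, so a
  single sequence of lower sums serves all times in \<open>J\<close>.\<close>

lemma laplace_H:
  assumes F: "nonneg_cdf F" and J: "finite J" "\<And>t. t \<in> J \<Longrightarrow> 0 \<le> t"
  shows "expectation (\<lambda>\<omega>. exp_neg (\<Sum>t\<in>J. ennreal (x t) * H_lim F t \<omega>)) =
    exp_neg (H_exponent (\<lambda>s. \<Sum>t\<in>J. ennreal (x t) * H_integrand F t s))"
proof -
  define g where "g s = (\<Sum>t\<in>J. ennreal (x t) * H_integrand F t s)" for s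
  have g: "g s' \<le> g s" if "0 < s" "s \<le> s'" for s s'
    unfolding g_def
  proof (intro sum_mono mult_left_mono)
    fix t assume "t \<in> J"
    then show "H_integrand F t s' \<le> H_integrand F t s"
      using H_integrand_antimono[OF F J(2) that] by simp
  qed simp
  have anti: "1 - exp_neg (u * g s') \<le> 1 - exp_neg (u * g s)" if "0 < s" "s \<le> s'" for u s s'
    using mult_left_mono[OF g[OF that], of u] by (simp add: exp_neg_le_iff)
  have low: "lower_sum (\<lambda>s. ennreal (1 - exp_neg (u * g s))) ereal n \<le> (\<integral>\<^sup>+s. ennreal (1 - exp_neg (u * g s)) * indicator {0<..} s \<partial>lborel)"
    "lower_sum (\<lambda>s. ennreal (1 - exp_neg (u * g s))) ereal \<longlonglongrightarrow> (\<integral>\<^sup>+s. ennreal (1 - exp_neg (u * g s)) * indicator {0<..} s \<partial>lborel)"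
    for u n
    by (rule lower_sum_ereal_tendsto[of "\<lambda>s. 1 - exp_neg (u * g s)", OF anti]; assumption)+
  have [measurable]: "(\<lambda>u. lower_sum (\<lambda>s. ennreal (1 - exp_neg (u * g s))) ereal n) \<in> borel_measurable \<nu>" for n
    unfolding lower_sum_def by measurable
  have "(\<lambda>n. \<integral>\<^sup>+u. lower_sum (\<lambda>s. ennreal (1 - exp_neg (u * g s))) ereal n \<partial>\<nu>) \<longlonglongrightarrow> H_exponent g"
    unfolding H_exponent_def
  proof (rule tendsto_of_le_liminf)
    show "(\<integral>\<^sup>+u. (\<integral>\<^sup>+s. ennreal (1 - exp_neg (u * g s)) * indicator {0<..} s \<partial>lborel) \<partial>\<nu>) \<le>
        liminf (\<lambda>n. \<integral>\<^sup>+u. lower_sum (\<lambda>s. ennreal (1 - exp_neg (u * g s))) ereal n \<partial>\<nu>)"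
      by (rule nn_integral_le_liminf_AE) (simp_all add: low(2))
  qed (intro nn_integral_mono low(1))
  then have lim: "(\<lambda>n. exp_neg (\<integral>\<^sup>+u. lower_sum (\<lambda>s. ennreal (1 - exp_neg (u * g s))) ereal n \<partial>\<nu>)) \<longlonglongrightarrow> exp_neg (H_exponent g)"
    by (rule tendsto_exp_neg)
  have int: "integrable M (\<lambda>\<omega>. exp_neg (lower_sum g (\<lambda>s. enn2ereal (L s \<omega>)) n))" for n
    by (rule integrable_const_bound[of _ 1]) auto
  have "expectation (\<lambda>\<omega>. exp_neg (lower_sum g (\<lambda>s. enn2ereal (L s \<omega>)) n)) =
      exp_neg (\<integral>\<^sup>+u. lower_sum (\<lambda>s. ennreal (1 - exp_neg (u * g s))) ereal n \<partial>\<nu>)" for n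
    using laplace_lower_sum[of g n, OF g] by (simp add: nn_integral_eq_integral[OF int] integral_nonneg)
  with lim have lim: "(\<lambda>n. expectation (\<lambda>\<omega>. exp_neg (lower_sum g (\<lambda>s. enn2ereal (L s \<omega>)) n))) \<longlonglongrightarrow> exp_neg (H_exponent g)"
    by simp
  have "AE \<omega> in M. \<forall>t\<in>J. lower_sum (H_integrand F t) (\<lambda>s. enn2ereal (L s \<omega>)) \<longlonglongrightarrow> H_lim F t \<omega>"
  proof (intro AE_finite_allI J)
    fix t assume "t \<in> J"
    with J have "0 \<le> t" by auto
    show "AE \<omega> in M. lower_sum (H_integrand F t) (\<lambda>s. enn2ereal (L s \<omega>)) \<longlonglongrightarrow> H_lim F t \<omega>"
      using AE_lower_sum_H[OF F \<open>0 \<le> t\<close>] AE_H_lim[OF F \<open>0 \<le> t\<close>] by eventually_elim simp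
  qed
  then have "AE \<omega> in M. (\<lambda>n. exp_neg (lower_sum g (\<lambda>s. enn2ereal (L s \<omega>)) n)) \<longlonglongrightarrow> exp_neg (\<Sum>t\<in>J. ennreal (x t) * H_lim F t \<omega>)"
  proof eventually_elim
    fix \<omega> assume *: "\<forall>t\<in>J. lower_sum (H_integrand F t) (\<lambda>s. enn2ereal (L s \<omega>)) \<longlonglongrightarrow> H_lim F t \<omega>"
    show "(\<lambda>n. exp_neg (lower_sum g (\<lambda>s. enn2ereal (L s \<omega>)) n)) \<longlonglongrightarrow> exp_neg (\<Sum>t\<in>J. ennreal (x t) * H_lim F t \<omega>)"
      unfolding g_def lower_sum_sum
      by (intro tendsto_exp_neg tendsto_sum ennreal_tendsto_cmult) (use * in auto)
  qed
  then have "(\<lambda>n. expectation (\<lambda>\<omega>. exp_neg (lower_sum g (\<lambda>s. enn2ereal (L s \<omega>)) n))) \<longlonglongrightarrow>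
      expectation (\<lambda>\<omega>. exp_neg (\<Sum>t\<in>J. ennreal (x t) * H_lim F t \<omega>))"
    by (intro integral_dominated_convergence[where w = "\<lambda>_. 1"]) auto
  with lim show ?thesis unfolding g_def by (rule LIMSEQ_unique[rotated])
qed

end

section \<open>Laplace transforms determine laws on powers of the extended half-line\<close>

text \<open>After the change of variables \<open>u = e\<^sup>-\<^sup>y\<close> the Laplace transform at the natural numbers gives the
  moments of a measure on the compact interval \<open>[0,1]\<close>, where the polynomials are dense. The point
  \<open>y = \<infinity>\<close> corresponds to \<open>u = 0\<close>.\<close>

lemma integral_continuous_eq_of_moments:
  fixes \<phi> :: "real \<Rightarrow> real"
  assumes "finite_measure M1" "finite_measure M2"
    and s: "sets M1 = sets borel" "sets M2 = sets (borel :: ennreal measure)"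
    and eq: "\<And>n::nat. (\<integral>y. exp_neg (of_nat n * y) \<partial>M1) = (\<integral>y. exp_neg (of_nat n * y) \<partial>M2)"
    and \<phi>: "continuous_on {0..1} \<phi>" "\<phi> \<in> borel_measurable borel"
  shows "(\<integral>y. \<phi> (exp_neg y) \<partial>M1) = (\<integral>y. \<phi> (exp_neg y) \<partial>M2)"
proof -
  interpret M1: finite_measure M1 by fact
  interpret M2: finite_measure M2 by fact
  have [measurable_cong, simp]: "sets M1 = sets borel" "sets M2 = sets borel" by fact+
  note [measurable] = \<phi>(2)
  define C where "C = measure M1 (space M1) + measure M2 (space M2) + 1"
  have C: "0 < C" by (simp add: C_def add_nonneg_pos)
  have "compact (\<phi> ` {0..1})" using \<phi>(1) by (rule compact_continuous_image) simp
  then have "bounded (\<phi> ` {0..1})" by (rule compact_imp_bounded)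
  then obtain b where "\<forall>x\<in>\<phi> ` {0..1}. norm x \<le> b" unfolding bounded_iff ..
  then have b: "\<bar>\<phi> u\<bar> \<le> b" if "u \<in> {0..1}" for u using that by auto
  have int: "integrable M1 (\<lambda>y. \<phi> (exp_neg y))" "integrable M2 (\<lambda>y. \<phi> (exp_neg y))"
    by (rule M1.integrable_const_bound[of _ b] M2.integrable_const_bound[of _ b]; auto intro!: b)+
  have "\<bar>(\<integral>y. \<phi> (exp_neg y) \<partial>M1) - (\<integral>y. \<phi> (exp_neg y) \<partial>M2)\<bar> \<le> e * C" if e: "0 < e" for e
  proof -
    obtain g where g: "real_polynomial_function g" "\<And>u. u \<in> {0..1} \<Longrightarrow> \<bar>\<phi> u - g u\<bar> < e"
      using Stone_Weierstrass_real_polynomial_function[OF compact_Icc \<phi>(1) e] by blast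
    then obtain a n where ga: "g = (\<lambda>x. \<Sum>i\<le>n. a i * x ^ i)"
      by (auto simp: real_polynomial_function_iff_sum)
    have ig: "integrable M1 (\<lambda>y. exp_neg (of_nat i * y))" "integrable M2 (\<lambda>y. exp_neg (of_nat i * y))" for i :: nat
      by (rule M1.integrable_const_bound[of _ 1] M2.integrable_const_bound[of _ 1]; auto)+
    have gE: "g (exp_neg y) = (\<Sum>i\<le>n. a i * exp_neg (of_nat i * y))" for y
      by (simp add: ga exp_neg_of_nat_mult)
    have ig': "integrable M1 (\<lambda>y. g (exp_neg y))" "integrable M2 (\<lambda>y. g (exp_neg y))"
      unfolding gE using ig by auto
    have geq: "(\<integral>y. g (exp_neg y) \<partial>M1) = (\<integral>y. g (exp_neg y) \<partial>M2)"
      unfolding gE using ig eq by (simp add: Bochner_Integration.integral_sum)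
    have diff: "\<bar>(\<integral>y. \<phi> (exp_neg y) \<partial>M) - (\<integral>y. g (exp_neg y) \<partial>M)\<bar> \<le> e * measure M (space M)"
      if M: "finite_measure M" "integrable M (\<lambda>y. \<phi> (exp_neg y))" "integrable M (\<lambda>y. g (exp_neg y))" for M
    proof -
      interpret finite_measure M by fact
      have "\<bar>(\<integral>y. \<phi> (exp_neg y) \<partial>M) - (\<integral>y. g (exp_neg y) \<partial>M)\<bar> = \<bar>\<integral>y. \<phi> (exp_neg y) - g (exp_neg y) \<partial>M\<bar>"
        using M by simp
      also have "\<dots> \<le> (\<integral>y. \<bar>\<phi> (exp_neg y) - g (exp_neg y)\<bar> \<partial>M)" by (rule integral_abs_bound)
      also have "\<dots> \<le> (\<integral>y. e \<partial>M)"
        using M by (intro integral_mono) (auto intro!: less_imp_le g(2))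
      finally show ?thesis by (simp add: mult.commute)
    qed
    note 1 = diff[OF assms(1) int(1) ig'(1)] and 2 = diff[OF assms(2) int(2) ig'(2)]
    have "e * C = e * measure M1 (space M1) + e * measure M2 (space M2) + e"
      by (simp add: C_def distrib_left)
    with 1 2 geq e show ?thesis by linarith
  qed
  from this[of "_ / C"] have "\<bar>(\<integral>y. \<phi> (exp_neg y) \<partial>M1) - (\<integral>y. \<phi> (exp_neg y) \<partial>M2)\<bar> \<le> e" if "0 < e" for e
    using C that by (auto dest: divide_pos_pos)
  then have "\<bar>(\<integral>y. \<phi> (exp_neg y) \<partial>M1) - (\<integral>y. \<phi> (exp_neg y) \<partial>M2)\<bar> \<le> 0"
    by (rule field_le_epsilon) simp
  then show ?thesis by simp
qed

lemma laplace_unique: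
  fixes M1 M2 :: "ennreal measure"
  assumes "finite_measure M1" "finite_measure M2"
    and s: "sets M1 = sets borel" "sets M2 = sets borel"
    and eq: "\<And>n::nat. (\<integral>\<^sup>+y. ennreal (exp_neg (of_nat n * y)) \<partial>M1) = (\<integral>\<^sup>+y. ennreal (exp_neg (of_nat n * y)) \<partial>M2)"
  shows "M1 = M2"
proof -
  interpret M1: finite_measure M1 by fact
  interpret M2: finite_measure M2 by fact
  have [measurable_cong, simp]: "sets M1 = sets borel" "sets M2 = sets borel" by fact+
  have sp[simp]: "space M1 = UNIV" "space M2 = UNIV" using sets_eq_imp_space_eq[OF s(1)] sets_eq_imp_space_eq[OF s(2)] by auto
  have eq': "(\<integral>y. exp_neg (of_nat n * y) \<partial>M1) = (\<integral>y. exp_neg (of_nat n * y) \<partial>M2)" for n :: nat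
    using eq[of n] by (simp add: integral_eq_nn_integral)
  have "distr M1 borel exp_neg = distr M2 borel exp_neg"
  proof (rule measure_eqI_lessThan)
    fix x :: real
    define \<phi> where "\<phi> m u = min 1 (max 0 (real m * (u - x)))" for m u
    have \<phi>: "continuous_on {0..1} (\<phi> m)" "\<phi> m \<in> borel_measurable borel" for m
      unfolding \<phi>_def by (auto intro!: continuous_intros)
    note [measurable] = \<phi>(2)
    have lim: "(\<lambda>m. \<phi> m u) \<longlonglongrightarrow> indicator {x<..} u" for u
    proof (cases "x < u")
      case True
      obtain N where N: "1 / (u - x) < real N" using reals_Archimedean2 by blast
      have "\<phi> m u = 1" if "N \<le> m" for m
      proof -
        have "1 / (u - x) \<le> real m" using N that by simp
        then have "1 \<le> real m * (u - x)" using True by (simp add: field_simps)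
        then show ?thesis by (simp add: \<phi>_def)
      qed
      then have "\<forall>\<^sub>F m in sequentially. \<phi> m u = 1" by (auto simp: eventually_sequentially)
      then show ?thesis using True by (auto intro: tendsto_eventually)
    next
      case False
      then have "\<phi> m u = 0" for m by (simp add: \<phi>_def mult_nonneg_nonpos)
      then show ?thesis using False by simp
    qed
    have \<phi>01: "\<bar>\<phi> m u\<bar> \<le> 1" for m u by (auto simp: \<phi>_def)
    have "(\<lambda>m. \<integral>y. \<phi> m (exp_neg y) \<partial>M1) \<longlonglongrightarrow> (\<integral>y. indicator {x<..} (exp_neg y) \<partial>M1)"
      by (rule integral_dominated_convergence[where w = "\<lambda>_. 1"]) (use \<phi>01 lim in auto)
    moreover have "(\<lambda>m. \<integral>y. \<phi> m (exp_neg y) \<partial>M2) \<longlonglongrightarrow> (\<integral>y. indicator {x<..} (exp_neg y) \<partial>M2)"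
      by (rule integral_dominated_convergence[where w = "\<lambda>_. 1"]) (use \<phi>01 lim in auto)
    moreover have "(\<integral>y. \<phi> m (exp_neg y) \<partial>M1) = (\<integral>y. \<phi> m (exp_neg y) \<partial>M2)" for m
      by (rule integral_continuous_eq_of_moments[OF assms(1,2) s eq' \<phi>])
    ultimately have eqi: "(\<integral>y. indicator {x<..} (exp_neg y) \<partial>M1) = (\<integral>y. (indicator {x<..} (exp_neg y) :: real) \<partial>M2)"
      by (simp add: LIMSEQ_unique)
    have ind: "(indicator {x<..} (exp_neg y) :: real) = indicator (exp_neg -` {x<..}) y" for y
      by (simp add: indicator_def)
    have [measurable]: "exp_neg -` {x<..} \<in> sets borel"
      using measurable_sets[OF borel_measurable_exp_neg, of "{x<..}"] by simp
    from eqi have "measure M1 (exp_neg -` {x<..}) = measure M2 (exp_neg -` {x<..})"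
      unfolding ind by simp
    then show "emeasure (distr M1 borel exp_neg) {x<..} = emeasure (distr M2 borel exp_neg) {x<..}"
      by (simp add: emeasure_distr M1.emeasure_eq_measure M2.emeasure_eq_measure)
    show "emeasure (distr M1 borel exp_neg) {x<..} < \<infinity>"
      by (simp add: emeasure_distr M1.emeasure_eq_measure)
  qed simp_all
  then have "distr (distr M1 borel exp_neg) borel neg_log = distr (distr M2 borel exp_neg) borel neg_log"
    by simp
  then have "distr M1 borel (\<lambda>y. y) = distr M2 borel (\<lambda>y. y)"
    by (simp add: distr_distr comp_def)
  then show ?thesis by (simp add: distr_id2 s)
qed

text \<open>Exponentials are replaced by indicators one coordinate at a time. When all other factors are
  fixed, their product is the density of a finite measure, and the one-dimensional result applies
  to its image under the coordinate in question.\<close>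

lemma joint_laplace_unique_indicators:
  fixes X :: "'i \<Rightarrow> 'a \<Rightarrow> ennreal" and Y :: "'i \<Rightarrow> 'b \<Rightarrow> ennreal"
  assumes P: "finite_measure P" "finite_measure Q" and J: "finite J"
    and X: "\<And>j. j \<in> J \<Longrightarrow> X j \<in> borel_measurable P" and Y: "\<And>j. j \<in> J \<Longrightarrow> Y j \<in> borel_measurable Q"
    and eq: "\<And>n :: 'i \<Rightarrow> nat. (\<integral>\<^sup>+\<omega>. (\<Prod>j\<in>J. ennreal (exp_neg (of_nat (n j) * X j \<omega>))) \<partial>P) =
       (\<integral>\<^sup>+\<omega>. (\<Prod>j\<in>J. ennreal (exp_neg (of_nat (n j) * Y j \<omega>))) \<partial>Q)"
    and B: "\<And>j. j \<in> J \<Longrightarrow> B j \<in> sets borel" and A: "A \<subseteq> J"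
  shows "(\<integral>\<^sup>+\<omega>. (\<Prod>j\<in>A. indicator (B j) (X j \<omega>)) * (\<Prod>j\<in>J - A. ennreal (exp_neg (of_nat (n j) * X j \<omega>))) \<partial>P) =
       (\<integral>\<^sup>+\<omega>. (\<Prod>j\<in>A. indicator (B j) (Y j \<omega>)) * (\<Prod>j\<in>J - A. ennreal (exp_neg (of_nat (n j) * Y j \<omega>))) \<partial>Q)"
proof -
  have "finite A" using A J by (rule finite_subset)
  then show ?thesis using A
  proof (induction A arbitrary: n rule: finite_induct)
    case empty
    then show ?case using eq by simp
  next
    case (insert a A)
    define R where "R = J - insert a A"
    have JA: "J - A = insert a R" "a \<notin> R" "finite R" "R \<subseteq> J" "a \<in> J" "A \<subseteq> J"
      using insert J by (auto simp: R_def)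
    define w where "w \<omega> = (\<Prod>j\<in>A. indicator (B j) (X j \<omega>)) * (\<Prod>j\<in>R. ennreal (exp_neg (of_nat (n j) * X j \<omega>)))" for \<omega>
    define w' where "w' \<omega> = (\<Prod>j\<in>A. indicator (B j) (Y j \<omega>)) * (\<Prod>j\<in>R. ennreal (exp_neg (of_nat (n j) * Y j \<omega>)))" for \<omega>
    have [measurable]: "\<And>j. j \<in> A \<Longrightarrow> X j \<in> borel_measurable P" "\<And>j. j \<in> R \<Longrightarrow> X j \<in> borel_measurable P" "X a \<in> borel_measurable P"
        "\<And>j. j \<in> A \<Longrightarrow> Y j \<in> borel_measurable Q" "\<And>j. j \<in> R \<Longrightarrow> Y j \<in> borel_measurable Q" "Y a \<in> borel_measurable Q"
        "\<And>j. j \<in> A \<Longrightarrow> B j \<in> sets borel" "B a \<in> sets borel"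
      using JA X Y B by auto
    have [measurable]: "w \<in> borel_measurable P" "w' \<in> borel_measurable Q"
      unfolding w_def w'_def by measurable
    have w1: "w \<omega> \<le> 1" "w' \<omega>' \<le> 1" for \<omega> \<omega>'
      unfolding w_def w'_def by (auto intro!: mult_le_one prod_le_1 simp: indicator_def)
    have fin: "finite_measure (distr (density P w) borel (X a))" "finite_measure (distr (density Q w') borel (Y a))"
    proof -
      have "(\<integral>\<^sup>+\<omega>. w \<omega> \<partial>P) \<le> (\<integral>\<^sup>+\<omega>. 1 \<partial>P)" "(\<integral>\<^sup>+\<omega>. w' \<omega> \<partial>Q) \<le> (\<integral>\<^sup>+\<omega>. 1 \<partial>Q)"
        by (intro nn_integral_mono w1)+
      then have "(\<integral>\<^sup>+\<omega>. w \<omega> \<partial>P) \<noteq> \<infinity>" "(\<integral>\<^sup>+\<omega>. w' \<omega> \<partial>Q) \<noteq> \<infinity>"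
        using finite_measure.emeasure_finite[OF P(1)] finite_measure.emeasure_finite[OF P(2)]
        by (auto simp: top_unique)
      then have "finite_measure (density P w)" "finite_measure (density Q w')"
        by (auto intro!: finite_measureI simp: emeasure_density cong: nn_integral_cong)
      then show "finite_measure (distr (density P w) borel (X a))" "finite_measure (distr (density Q w') borel (Y a))"
        by (auto intro!: finite_measure.finite_measure_distr)
    qed
    have "distr (density P w) borel (X a) = distr (density Q w') borel (Y a)"
    proof (rule laplace_unique[OF fin])
      fix m :: nat
      have n: "(\<Prod>j\<in>R. ennreal (exp_neg (of_nat ((n(a := m)) j) * Z j))) = (\<Prod>j\<in>R. ennreal (exp_neg (of_nat (n j) * Z j)))" for Z
        using JA(2) by (intro prod.cong) auto
      have "(\<integral>\<^sup>+y. ennreal (exp_neg (of_nat m * y)) \<partial>distr (density P w) borel (X a)) =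
         (\<integral>\<^sup>+\<omega>. w \<omega> * ennreal (exp_neg (of_nat m * X a \<omega>)) \<partial>P)"
        by (simp add: nn_integral_distr nn_integral_density)
      also have "\<dots> = (\<integral>\<^sup>+\<omega>. w' \<omega> * ennreal (exp_neg (of_nat m * Y a \<omega>)) \<partial>Q)"
      proof -
        have "(\<Prod>j\<in>A. indicator (B j) (X j \<omega>)) * (\<Prod>j\<in>J - A. ennreal (exp_neg (of_nat ((n(a := m)) j) * X j \<omega>))) =
            w \<omega> * ennreal (exp_neg (of_nat m * X a \<omega>))" for \<omega>
          unfolding JA(1) prod.insert[OF JA(3,2)] n w_def fun_upd_same by (simp only: mult_ac)
        moreover have "(\<Prod>j\<in>A. indicator (B j) (Y j \<omega>)) * (\<Prod>j\<in>J - A. ennreal (exp_neg (of_nat ((n(a := m)) j) * Y j \<omega>))) =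
            w' \<omega> * ennreal (exp_neg (of_nat m * Y a \<omega>))" for \<omega>
          unfolding JA(1) prod.insert[OF JA(3,2)] n w'_def fun_upd_same by (simp only: mult_ac)
        ultimately show ?thesis using insert.IH[OF JA(6), of "n(a := m)"] by (simp del: fun_upd_apply)
      qed
      also have "\<dots> = (\<integral>\<^sup>+y. ennreal (exp_neg (of_nat m * y)) \<partial>distr (density Q w') borel (Y a))"
        by (simp add: nn_integral_distr nn_integral_density)
      finally show "(\<integral>\<^sup>+y. ennreal (exp_neg (of_nat m * y)) \<partial>distr (density P w) borel (X a)) =
        (\<integral>\<^sup>+y. ennreal (exp_neg (of_nat m * y)) \<partial>distr (density Q w') borel (Y a))" .
    qed simp_all
    then have "(\<integral>\<^sup>+y. indicator (B a) y \<partial>distr (density P w) borel (X a)) = (\<integral>\<^sup>+y. indicator (B a) y \<partial>distr (density Q w') borel (Y a))"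
      by simp
    then have "(\<integral>\<^sup>+\<omega>. w \<omega> * indicator (B a) (X a \<omega>) \<partial>P) = (\<integral>\<^sup>+\<omega>. w' \<omega> * indicator (B a) (Y a \<omega>) \<partial>Q)"
      by (simp add: nn_integral_distr nn_integral_density del: nn_integral_indicator)
    then show ?case
      using insert.hyps by (simp add: w_def w'_def R_def mult_ac)
  qed
qed

lemma prod_indicator: "finite J \<Longrightarrow> (\<Prod>j\<in>J. indicator (B j) (X j)) = (if \<forall>j\<in>J. X j \<in> B j then 1 else 0 :: ennreal)"
  by (induction J rule: finite_induct) auto

lemma emeasure_distr_PiE:
  fixes X :: "'i \<Rightarrow> 'a \<Rightarrow> ennreal"
  assumes J: "finite J" and X: "\<And>j. j \<in> J \<Longrightarrow> X j \<in> borel_measurable P" and B: "\<And>j. j \<in> J \<Longrightarrow> B j \<in> sets borel"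
  shows "emeasure (distr P (\<Pi>\<^sub>M j\<in>J. borel) (\<lambda>\<omega>. \<lambda>j\<in>J. X j \<omega>)) (Pi\<^sub>E J B) =
    (\<integral>\<^sup>+\<omega>. (\<Prod>j\<in>J. indicator (B j) (X j \<omega>)) \<partial>P)"
proof -
  have PB: "Pi\<^sub>E J B \<in> sets (\<Pi>\<^sub>M j\<in>J. borel)" using B J by (intro sets_PiM_I_finite) auto
  have XP: "(\<lambda>\<omega>. \<lambda>j\<in>J. X j \<omega>) \<in> P \<rightarrow>\<^sub>M (\<Pi>\<^sub>M j\<in>J. borel)" using X by (auto intro!: measurable_restrict)
  have "emeasure (distr P (\<Pi>\<^sub>M j\<in>J. borel) (\<lambda>\<omega>. \<lambda>j\<in>J. X j \<omega>)) (Pi\<^sub>E J B) =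
    (\<integral>\<^sup>+x. indicator (Pi\<^sub>E J B) x \<partial>distr P (\<Pi>\<^sub>M j\<in>J. borel) (\<lambda>\<omega>. \<lambda>j\<in>J. X j \<omega>))" using PB by simp
  also have "\<dots> = (\<integral>\<^sup>+\<omega>. indicator (Pi\<^sub>E J B) (\<lambda>j\<in>J. X j \<omega>) \<partial>P)"
    using PB XP by (intro nn_integral_distr) auto
  also have "\<dots> = (\<integral>\<^sup>+\<omega>. (\<Prod>j\<in>J. indicator (B j) (X j \<omega>)) \<partial>P)"
    by (intro nn_integral_cong) (auto simp: prod_indicator[OF J] J indicator_def PiE_iff)
  finally show ?thesis .
qed

lemma joint_laplace_unique:
  fixes X :: "'i \<Rightarrow> 'a \<Rightarrow> ennreal" and Y :: "'i \<Rightarrow> 'b \<Rightarrow> ennreal"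
  assumes P: "finite_measure P" "finite_measure Q" and J: "finite J"
    and X: "\<And>j. j \<in> J \<Longrightarrow> X j \<in> borel_measurable P" and Y: "\<And>j. j \<in> J \<Longrightarrow> Y j \<in> borel_measurable Q"
    and eq: "\<And>n :: 'i \<Rightarrow> nat. (\<integral>\<^sup>+\<omega>. (\<Prod>j\<in>J. ennreal (exp_neg (of_nat (n j) * X j \<omega>))) \<partial>P) =
       (\<integral>\<^sup>+\<omega>. (\<Prod>j\<in>J. ennreal (exp_neg (of_nat (n j) * Y j \<omega>))) \<partial>Q)"
  shows "distr P (\<Pi>\<^sub>M j\<in>J. borel) (\<lambda>\<omega>. \<lambda>j\<in>J. X j \<omega>) = distr Q (\<Pi>\<^sub>M j\<in>J. borel) (\<lambda>\<omega>. \<lambda>j\<in>J. Y j \<omega>)"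
proof (rule measure_eqI_PiM_finite[OF J, where A = "\<lambda>_. space (\<Pi>\<^sub>M j\<in>J. borel)"])
  have XY: "(\<lambda>\<omega>. \<lambda>j\<in>J. X j \<omega>) \<in> P \<rightarrow>\<^sub>M (\<Pi>\<^sub>M j\<in>J. borel)" "(\<lambda>\<omega>. \<lambda>j\<in>J. Y j \<omega>) \<in> Q \<rightarrow>\<^sub>M (\<Pi>\<^sub>M j\<in>J. borel)"
    using X Y by (auto intro!: measurable_restrict)
  show "range (\<lambda>_. space (\<Pi>\<^sub>M j\<in>J. borel)) \<subseteq> prod_algebra J (\<lambda>_. borel :: ennreal measure)"
    using space_in_prod_algebra[of J "\<lambda>_. borel :: ennreal measure"] by (auto simp: space_PiM)
  show "emeasure (distr P (\<Pi>\<^sub>M j\<in>J. borel) (\<lambda>\<omega>. \<lambda>j\<in>J. X j \<omega>)) (space (\<Pi>\<^sub>M j\<in>J. borel)) \<noteq> \<infinity>"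
    using finite_measure.emeasure_finite[OF finite_measure.finite_measure_distr[OF P(1) XY(1)]] by simp
  fix B :: "'i \<Rightarrow> ennreal set" assume B: "\<And>j. j \<in> J \<Longrightarrow> B j \<in> sets borel"
  show "emeasure (distr P (\<Pi>\<^sub>M j\<in>J. borel) (\<lambda>\<omega>. \<lambda>j\<in>J. X j \<omega>)) (Pi\<^sub>E J B) =
    emeasure (distr Q (\<Pi>\<^sub>M j\<in>J. borel) (\<lambda>\<omega>. \<lambda>j\<in>J. Y j \<omega>)) (Pi\<^sub>E J B)"
    using joint_laplace_unique_indicators[where n = "\<lambda>_. 0" and B = B, OF P J X Y eq B order_refl]
    by (simp add: emeasure_distr_PiE[where X = X and B = B, OF J X B] emeasure_distr_PiE[where X = Y and B = B, OF J Y B])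
qed simp_all

section \<open>The Laplace transform of a marked Poisson series\<close>

lemma constant_of_quadratic_bound:
  fixes D :: "real \<Rightarrow> real"
  assumes "\<And>x y. a \<le> x \<Longrightarrow> x \<le> y \<Longrightarrow> \<bar>D y - D x\<bar> \<le> (y - x)\<^sup>2" "a \<le> b"
  shows "D b = D a"
proof -
  have bound: "\<bar>D b - D a\<bar> \<le> (b - a)\<^sup>2 / real (Suc n)" for n
  proof -
    define d where "d = (b - a) / real (Suc n)"
    have d: "0 \<le> d" using assms by (simp add: d_def)
    have nd: "real (Suc n) * d = b - a" by (simp add: d_def)
    have "D b - D a = (\<Sum>i<Suc n. D (a + real (Suc i) * d) - D (a + real i * d))"
      by (subst sum_lessThan_telescope[of "\<lambda>i. D (a + real i * d)"]) (simp add: nd del: of_nat_Suc)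
    also have "\<bar>\<dots>\<bar> \<le> (\<Sum>i<Suc n. d\<^sup>2)"
    proof (rule order_trans[OF sum_abs sum_mono])
      fix i assume "i \<in> {..<Suc n}"
      have "a + real (Suc i) * d - (a + real i * d) = d" by (simp add: distrib_right)
      then show "\<bar>D (a + real (Suc i) * d) - D (a + real i * d)\<bar> \<le> d\<^sup>2"
        using assms(1)[of "a + real i * d" "a + real (Suc i) * d"] d by (simp add: distrib_right)
    qed
    also have "\<dots> = (real (Suc n) * d) * d" by (simp add: power2_eq_square)
    also have "\<dots> = (b - a)\<^sup>2 / real (Suc n)" unfolding nd by (simp add: d_def power2_eq_square)
    finally show ?thesis .
  qed
  have "(\<lambda>n. (b - a)\<^sup>2 / real (Suc n)) \<longlonglongrightarrow> 0"
    by (rule LIMSEQ_Suc[OF lim_const_over_n])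
  then have "\<bar>D b - D a\<bar> \<le> 0" by (rule LIMSEQ_le_const) (use bound in auto)
  then show ?thesis by simp
qed

lemma exp_second_order:
  fixes m :: real assumes "0 \<le> m" shows "exp (- m) - 1 + m \<le> m\<^sup>2" "- m\<^sup>2 \<le> exp (- m) - 1 + m * exp (- m)"
proof -
  have "(1 + m) * exp (- m) \<le> 1"
    using mult_right_mono[OF exp_ge_add_one_self[of m], of "exp (- m)"] by (simp add: exp_minus field_simps)
  moreover have "1 \<le> (1 + m) * (1 - m + m\<^sup>2)" using assms by (simp add: algebra_simps power2_eq_square)
  ultimately have "(1 + m) * exp (- m) \<le> (1 + m) * (1 - m + m\<^sup>2)" by linarith
  then have "exp (- m) \<le> 1 - m + m\<^sup>2" using assms by (subst (asm) mult_le_cancel_left_pos) auto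
  then show "exp (- m) - 1 + m \<le> m\<^sup>2" by simp
  have "1 - m \<le> exp (- m)" using exp_ge_add_one_self[of "- m"] by simp
  then have "(1 - m) * (1 + m) \<le> exp (- m) * (1 + m)" using assms by (intro mult_right_mono) auto
  then show "- m\<^sup>2 \<le> exp (- m) - 1 + m * exp (- m)" by (simp add: algebra_simps power2_eq_square)
qed

text \<open>Let \<open>q \<gamma>\<close> be the probability that a point at \<open>\<gamma>\<close> is retained. The aim is the probability
  \<open>exp (-\<integral> (1 - q))\<close> that all points of a unit rate Poisson process are retained.\<close>

locale thinning =
  fixes q :: "real \<Rightarrow> real"
  assumes q_meas [measurable]: "q \<in> borel_measurable borel" and q_bounds: "\<And>x. 0 \<le> q x" "\<And>x. q x \<le> 1"
begin

text \<open>With \<open>W = e\<^sup>-\<^sup>\<Theta>\<close>, \<open>\<Theta> x = \<integral>\<^sub>0\<^sup>x q\<close>, the function \<open>v x = e\<^sup>x W x\<close> below is a multiple of the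
  probability that all points after \<open>x\<close> are retained.\<close>

definition \<Theta> :: "real \<Rightarrow> real" where "\<Theta> x = (LINT r:{0<..x}|lborel. q r)"
definition W :: "real \<Rightarrow> real" where "W x = exp (- \<Theta> x)"

lemma set_integrable_bounded:
  assumes "g \<in> borel_measurable borel" "\<And>r. \<bar>g r\<bar> \<le> (1::real)" shows "set_integrable lborel {a<..b::real} g"
  unfolding set_integrable_def
proof (rule integrableI_bounded_set_indicator[where B = "1::real"])
  show "emeasure lborel {a<..b} < \<infinity>" by (cases "a \<le> b") auto
qed (use assms in auto)

lemma set_integral_split:
  assumes g: "g \<in> borel_measurable borel" "\<And>r. \<bar>g r\<bar> \<le> (1::real)" and xy: "(0::real) \<le> x" "x \<le> y"
  shows "(LINT r:{0<..y}|lborel. g r) = (LINT r:{0<..x}|lborel. g r) + (LINT r:{x<..y}|lborel. g r)"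
proof -
  have "{0<..y} = {0<..x} \<union> {x<..y}" using xy by auto
  then show ?thesis
    by (simp only:) (rule set_integral_Un, use g in \<open>auto intro: set_integrable_bounded\<close>)
qed

lemma set_integral_le:
  assumes g: "g \<in> borel_measurable borel" "\<And>r. \<bar>g r\<bar> \<le> (1::real)" and h: "h \<in> borel_measurable borel" "\<And>r. \<bar>h r\<bar> \<le> (1::real)"
    and "\<And>r::real. x < r \<Longrightarrow> r \<le> y \<Longrightarrow> g r \<le> h r"
  shows "(LINT r:{x<..y}|lborel. g r) \<le> (LINT r:{x<..y}|lborel. h r)"
  by (rule set_integral_mono) (use assms in \<open>auto intro: set_integrable_bounded\<close>)

lemma \<Theta>_diff:
  assumes "0 \<le> x" "x \<le> y"
  shows "\<Theta> y - \<Theta> x = (LINT r:{x<..y}|lborel. q r)" "0 \<le> \<Theta> y - \<Theta> x" "\<Theta> y - \<Theta> x \<le> y - x"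
proof -
  have q1: "\<bar>q r\<bar> \<le> 1" for r using q_bounds[of r] by simp
  show *: "\<Theta> y - \<Theta> x = (LINT r:{x<..y}|lborel. q r)"
    using set_integral_split[OF q_meas q1 assms] by (simp add: \<Theta>_def)
  have "(LINT r:{x<..y}|lborel. 0) \<le> (LINT r:{x<..y}|lborel. q r)"
    by (rule set_integral_le) (use q1 q_bounds in auto)
  then show "0 \<le> \<Theta> y - \<Theta> x" unfolding * by (simp add: set_lebesgue_integral_def)
  have "(LINT r:{x<..y}|lborel. q r) \<le> (LINT r:{x<..y}|lborel. 1)"
    by (rule set_integral_le) (use q1 q_bounds in auto)
  also have "\<dots> = y - x" using assms by (simp add: set_lebesgue_integral_def)
  finally show "\<Theta> y - \<Theta> x \<le> y - x" unfolding * .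
qed

lemma \<Theta>_neg: "x \<le> 0 \<Longrightarrow> \<Theta> x = 0"
  by (simp add: \<Theta>_def set_lebesgue_integral_def)

lemma mono_\<Theta>: "mono \<Theta>"
proof (rule monoI)
  fix x y :: real assume "x \<le> y"
  then show "\<Theta> x \<le> \<Theta> y"
    using \<Theta>_diff(2)[of x y] \<Theta>_diff(2)[of 0 y] \<Theta>_neg[of x] \<Theta>_neg[of y] \<Theta>_neg[of 0]
    by (cases "0 \<le> x"; cases "0 \<le> y") auto
qed

lemma \<Theta>_nonneg: "0 \<le> \<Theta> x"
  using monoD[OF mono_\<Theta>, of "min x 0" x] \<Theta>_neg[of "min x 0"] by simp

lemma \<Theta>_meas [measurable]: "\<Theta> \<in> borel_measurable borel"
  by (rule borel_measurable_mono[OF mono_\<Theta>])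

lemma W_meas [measurable]: "W \<in> borel_measurable borel"
  unfolding W_def by measurable

lemma W_bounds: "0 < W x" "W x \<le> 1"
  using \<Theta>_nonneg[of x] by (auto simp: W_def)

lemma qW_le: "\<bar>q r * W r\<bar> \<le> 1"
  using q_bounds[of r] W_bounds[of r] by (auto simp: abs_mult intro!: mult_le_one)

text \<open>The chain rule for the absolutely continuous function \<open>W\<close>: the defect has increments of
  second order and is therefore constant.\<close>

lemma W_diff:
  assumes xy: "0 \<le> x" "x \<le> y"
  shows "W x - W y = (LINT r:{x<..y}|lborel. q r * W r)"
proof -
  define D where "D x = W x + (LINT r:{0<..x}|lborel. q r * W r)" for x
  have Dd: "D y - D x = W y - W x + (LINT r:{x<..y}|lborel. q r * W r)" if "0 \<le> x" "x \<le> y" for x y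
    using set_integral_split[of "\<lambda>r. q r * W r", OF _ qW_le that] by (simp add: D_def)
  have "\<bar>D y - D x\<bar> \<le> (y - x)\<^sup>2" if "0 \<le> x" "x \<le> y" for x y
  proof -
    define m where "m = \<Theta> y - \<Theta> x"
    have m: "0 \<le> m" "m \<le> y - x" using \<Theta>_diff[OF that] by (auto simp: m_def)
    have Wy: "W y = W x * exp (- m)" by (simp add: W_def m_def flip: exp_add)
    have W_anti: "r \<le> s \<Longrightarrow> W s \<le> W r" for r s using monoD[OF mono_\<Theta>] by (simp add: W_def)
    have qc: "(LINT r:{x<..y}|lborel. q r * c) = m * c" for c
      using \<Theta>_diff(1)[OF that] by (simp add: m_def)
    have c1: "\<bar>q r * W s\<bar> \<le> 1" for r s using q_bounds[of r] W_bounds[of s] by (auto simp: abs_mult intro!: mult_le_one)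
    have "(LINT r:{x<..y}|lborel. q r * W r) \<le> (LINT r:{x<..y}|lborel. q r * W x)"
      by (rule set_integral_le) (use c1 q_bounds in \<open>auto intro!: mult_left_mono W_anti\<close>)
    then have up: "D y - D x \<le> W x * (exp (- m) - 1 + m)"
      unfolding qc Dd[OF that] Wy by (simp add: algebra_simps)
    have "(LINT r:{x<..y}|lborel. q r * W y) \<le> (LINT r:{x<..y}|lborel. q r * W r)"
      by (rule set_integral_le) (use c1 q_bounds in \<open>auto intro!: mult_left_mono W_anti\<close>)
    then have lo: "W x * (exp (- m) - 1 + m * exp (- m)) \<le> D y - D x"
      unfolding qc Dd[OF that] Wy by (simp add: algebra_simps)
    have "W x * (exp (- m) - 1 + m) \<le> W x * m\<^sup>2" "W x * (- m\<^sup>2) \<le> W x * (exp (- m) - 1 + m * exp (- m))"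
      by (rule mult_left_mono; use exp_second_order[OF m(1)] less_imp_le[OF W_bounds(1)[of x]] in simp)+
    moreover have "W x * m\<^sup>2 \<le> 1 * m\<^sup>2" using W_bounds[of x] by (intro mult_right_mono) auto
    moreover have "m\<^sup>2 \<le> (y - x)\<^sup>2" using m by (intro power_mono) auto
    ultimately show ?thesis using up lo by (simp add: abs_le_iff)
  qed
  then have "D y = D x" using xy by (intro constant_of_quadratic_bound[of x]) auto
  with Dd[OF xy] show ?thesis by simp
qed

definition v :: "real \<Rightarrow> real" where "v x = exp x * W x"

lemma v_meas [measurable]: "v \<in> borel_measurable borel"
  unfolding v_def by measurable

text \<open>The retention probability after \<open>x\<close> is found by conditioning on the next point. As \<open>q = 1\<close>
  beyond \<open>T\<close>, \<open>W\<close> decays exponentially, and no constant remains at infinity.\<close>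

lemma v_invariant:
  assumes T: "0 \<le> T" "\<And>r. T < r \<Longrightarrow> q r = 1" and x: "0 \<le> x"
  shows "(\<integral>\<^sup>+s. ennreal (exponential_density 1 s) * ennreal (q (x + s) * v (x + s)) \<partial>lborel) = ennreal (v x)"
proof -
  have W_lim: "(\<lambda>n. W (x + real n)) \<longlonglongrightarrow> 0"
  proof -
    have bound: "W y \<le> exp T * exp (- y)" if "T \<le> y" for y
    proof -
      have "\<Theta> y - \<Theta> T = (LINT r:{T<..y}|lborel. q r)" using T that by (intro \<Theta>_diff) auto
      also have "\<dots> = (LINT r:{T<..y}|lborel. 1)" by (rule set_lebesgue_integral_cong) (auto simp: T)
      also have "\<dots> = y - T" using that by (simp add: set_lebesgue_integral_def)
      finally have "y - T \<le> \<Theta> y" using \<Theta>_nonneg[of T] by linarith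
      then show ?thesis by (simp add: W_def flip: exp_add)
    qed
    have "\<forall>\<^sub>F n in sequentially. W (x + real n) \<le> exp T * exp (- (x + real n))"
      using eventually_ge_at_top[of "nat \<lceil>T\<rceil>"]
      by eventually_elim (use x in \<open>intro bound, simp add: nat_le_iff ceiling_le_iff\<close>)
    moreover have "(\<lambda>n. exp T * exp (- (x + real n))) \<longlonglongrightarrow> 0"
      by real_asymp
    ultimately show ?thesis
      by (rule tendsto_sandwich[OF always_eventually _ tendsto_const, rotated 1]) (auto intro: less_imp_le W_bounds)
  qed
  have part: "(\<integral>\<^sup>+r. ennreal (q r * W r) * indicator {x<..x + real n} r \<partial>lborel) = ennreal (W x - W (x + real n))" for n
  proof -
    have "(\<integral>\<^sup>+r. ennreal (q r * W r) * indicator {x<..x + real n} r \<partial>lborel) =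
        (\<integral>\<^sup>+r. ennreal (indicator {x<..x + real n} r *\<^sub>R (q r * W r)) \<partial>lborel)"
      by (intro nn_integral_cong) (auto simp: indicator_def)
    also have "\<dots> = ennreal (LINT r:{x<..x + real n}|lborel. q r * W r)"
      unfolding set_lebesgue_integral_def
      using set_integrable_bounded[of "\<lambda>r. q r * W r", OF _ qW_le] q_bounds W_bounds
      by (intro nn_integral_eq_integral) (auto simp: set_integrable_def less_imp_le intro!: AE_I2 mult_nonneg_nonneg)
    finally show ?thesis using W_diff[OF x, of "x + real n"] by simp
  qed
  have "(\<integral>\<^sup>+r. ennreal (q r * W r) * indicator {x<..} r \<partial>lborel) = ennreal (W x)"
  proof (rule LIMSEQ_unique)
    show "(\<lambda>n. \<integral>\<^sup>+r. ennreal (q r * W r) * indicator {x<..x + real n} r \<partial>lborel) \<longlonglongrightarrow>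
       (\<integral>\<^sup>+r. ennreal (q r * W r) * indicator {x<..} r \<partial>lborel)"
    proof (rule nn_integral_LIMSEQ)
      show "incseq (\<lambda>n r. ennreal (q r * W r) * indicator {x<..x + real n} r)"
        by (intro incseq_SucI le_funI) (auto simp: indicator_def)
      show "(\<lambda>n. ennreal (q r * W r) * indicator {x<..x + real n} r) \<longlonglongrightarrow> ennreal (q r * W r) * indicator {x<..} r" for r
      proof (rule tendsto_eventually)
        show "\<forall>\<^sub>F n in sequentially. ennreal (q r * W r) * indicator {x<..x + real n} r = ennreal (q r * W r) * indicator {x<..} r"
          using eventually_ge_at_top[of "nat \<lceil>r - x\<rceil>"] by eventually_elim (auto simp: indicator_def nat_le_iff ceiling_le_iff)
      qed
    qed measurable
    show "(\<lambda>n. \<integral>\<^sup>+r. ennreal (q r * W r) * indicator {x<..x + real n} r \<partial>lborel) \<longlonglongrightarrow> ennreal (W x)"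
      unfolding part using tendsto_diff[OF tendsto_const[of "W x"] W_lim] by (intro tendsto_ennrealI) simp
  qed
  then have "ennreal (exp x) * (\<integral>\<^sup>+r. ennreal (q r * W r) * indicator {x<..} r \<partial>lborel) = ennreal (v x)"
    by (simp add: v_def ennreal_mult W_bounds less_imp_le)
  moreover have "(\<integral>\<^sup>+s. ennreal (exponential_density 1 s) * ennreal (q (x + s) * v (x + s)) \<partial>lborel) =
      ennreal (exp x) * (\<integral>\<^sup>+r. ennreal (q r * W r) * indicator {x<..} r \<partial>lborel)"
  proof -
    have "ennreal (exp x) * (\<integral>\<^sup>+r. ennreal (q r * W r) * indicator {x<..} r \<partial>lborel) =
      (\<integral>\<^sup>+r. ennreal (exp x) * (ennreal (q r * W r) * indicator {x<..} r) \<partial>lborel)"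
      by (simp add: nn_integral_cmult)
    also have "\<dots> = (\<integral>\<^sup>+s. ennreal (exp x) * (ennreal (q (x + 1 * s) * W (x + 1 * s)) * indicator {x<..} (x + 1 * s)) \<partial>lborel)"
      using nn_integral_real_affine[of "\<lambda>r. ennreal (exp x) * (ennreal (q r * W r) * indicator {x<..} r)" 1 x] by simp
    also have "\<dots> = (\<integral>\<^sup>+s. ennreal (exponential_density 1 s) * ennreal (q (x + s) * v (x + s)) \<partial>lborel)"
    proof (rule nn_integral_cong_AE)
      show "AE s in lborel. ennreal (exp x) * (ennreal (q (x + 1 * s) * W (x + 1 * s)) * indicator {x<..} (x + 1 * s)) =
         ennreal (exponential_density 1 s) * ennreal (q (x + s) * v (x + s))"
        using AE_lborel_singleton[of 0]
      proof eventually_elim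
        fix s :: real assume "s \<noteq> 0"
        have "exp (- s) * (q (x + s) * (exp (x + s) * W (x + s))) = exp x * (q (x + s) * W (x + s))"
          by (simp add: exp_add exp_minus field_simps)
        then show "ennreal (exp x) * (ennreal (q (x + 1 * s) * W (x + 1 * s)) * indicator {x<..} (x + 1 * s)) =
         ennreal (exponential_density 1 s) * ennreal (q (x + s) * v (x + s))"
          using \<open>s \<noteq> 0\<close> q_bounds[of "x + s"] W_bounds[of "x + s"]
          by (auto simp: exponential_density_def v_def indicator_def simp flip: ennreal_mult)
      qed
    qed
    finally show ?thesis by simp
  qed
  ultimately show ?thesis by simp
qed

end

lemma (in thinning) v_0: "v 0 = 1"
  by (simp add: v_def W_def \<Theta>_neg)

lemma (in thinning) v_bound:
  assumes T: "0 \<le> T" "\<And>r. T < r \<Longrightarrow> q r = 1" and x: "0 \<le> x"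
  shows "0 \<le> v x" "v x \<le> v T" "v T - v x \<le> v T * exp (T - x)"
proof -
  have v: "v y = exp (y - \<Theta> y)" for y by (simp add: v_def W_def exp_diff exp_minus field_simps)
  show "0 \<le> v x" by (simp add: v)
  have mono: "v y \<le> v z" if "0 \<le> y" "y \<le> z" for y z
    using \<Theta>_diff(3)[OF that] by (simp add: v)
  have const: "v x = v T" if "T \<le> x"
  proof -
    have "\<Theta> x - \<Theta> T = (LINT r:{T<..x}|lborel. q r)" using T that by (intro \<Theta>_diff) auto
    also have "\<dots> = (LINT r:{T<..x}|lborel. 1)" by (rule set_lebesgue_integral_cong) (auto simp: T)
    also have "\<dots> = x - T" using that by (simp add: set_lebesgue_integral_def)
    finally show ?thesis by (simp add: v)
  qed
  show "v x \<le> v T" using const mono[OF x, of T] by (cases "T \<le> x") auto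
  show "v T - v x \<le> v T * exp (T - x)"
  proof (cases "T \<le> x")
    case True
    then show ?thesis using const by (simp add: v)
  next
    case False
    then have "v T * 1 \<le> v T * exp (T - x)" by (intro mult_left_mono) (auto simp: v)
    then show ?thesis using \<open>0 \<le> v x\<close> by simp
  qed
qed

locale iid_exponential = prob_space N for N :: "'b measure" +
  fixes \<epsilon> :: "nat \<Rightarrow> 'b \<Rightarrow> real"
  assumes indep_\<epsilon>: "indep_vars (\<lambda>_. borel) \<epsilon> UNIV"
    and dist_\<epsilon>: "\<And>k. distributed N lborel (\<epsilon> k) (exponential_density 1)"
begin

definition S :: "nat \<Rightarrow> 'b \<Rightarrow> real" where "S n \<omega> = (\<Sum>i<n. \<epsilon> i \<omega>)"

lemma meas_\<epsilon> [measurable]: "\<epsilon> k \<in> borel_measurable N"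
  using indep_\<epsilon> by (auto simp: indep_vars_def)

lemma meas_S [measurable]: "S n \<in> borel_measurable N"
  unfolding S_def by measurable

lemma S_0 [simp]: "S 0 \<omega> = 0" and S_Suc: "S (Suc n) \<omega> = S n \<omega> + \<epsilon> n \<omega>"
  by (simp_all add: S_def)

lemma AE_\<epsilon>_pos: "AE \<omega> in N. \<forall>k. 0 < \<epsilon> k \<omega>"
proof (subst AE_all_countable, intro allI)
  fix k
  have "(AE x in N. 0 < \<epsilon> k x) \<longleftrightarrow> (AE x in lborel. 0 < ennreal (exponential_density 1 x) \<longrightarrow> (0::real) < x)"
    by (rule distributed_AE2[OF dist_\<epsilon>]) measurable
  moreover have "AE x in lborel. 0 < ennreal (exponential_density 1 x) \<longrightarrow> (0::real) < x"
    using AE_lborel_singleton[of "0::real"]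
    by eventually_elim (auto simp: exponential_density_def)
  ultimately show "AE x in N. 0 < \<epsilon> k x" by simp
qed

lemma AE_S_pos: "AE \<omega> in N. \<forall>n. 0 \<le> S n \<omega> \<and> 0 < S (Suc n) \<omega>"
  using AE_\<epsilon>_pos
proof eventually_elim
  fix \<omega> assume pos: "\<forall>k. 0 < \<epsilon> k \<omega>"
  have "0 \<le> S n \<omega>" for n unfolding S_def using pos by (intro sum_nonneg) (auto intro: less_imp_le)
  with pos show "\<forall>n. 0 \<le> S n \<omega> \<and> 0 < S (Suc n) \<omega>" by (auto simp: S_Suc intro: add_nonneg_pos)
qed

text \<open>The next waiting time is independent of the earlier ones.\<close>

lemma next_step:
  assumes [measurable]: "U \<in> borel_measurable (PiM {..<n} (\<lambda>_. borel))" "g \<in> borel_measurable borel"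
  shows "(\<integral>\<^sup>+\<omega>. U (\<lambda>i\<in>{..<n}. \<epsilon> i \<omega>) * g (S (Suc n) \<omega>) \<partial>N) =
    (\<integral>\<^sup>+\<omega>. U (\<lambda>i\<in>{..<n}. \<epsilon> i \<omega>) * (\<integral>\<^sup>+s. ennreal (exponential_density 1 s) * g (S n \<omega> + s) \<partial>lborel) \<partial>N)"
proof -
  define A where "A = PiM {..<n} (\<lambda>_. borel :: real measure)"
  define B where "B = PiM {n} (\<lambda>_. borel :: real measure)"
  define X1 where "X1 \<omega> = (\<lambda>i\<in>{..<n}. \<epsilon> i \<omega>)" for \<omega>
  define X2 where "X2 \<omega> = (\<lambda>i\<in>{n}. \<epsilon> i \<omega>)" for \<omega>
  define \<sigma> where "\<sigma> x = (\<Sum>i<n. x i)" for x :: "nat \<Rightarrow> real"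
  have "indep_var A X1 B X2"
    unfolding A_def B_def X1_def X2_def by (rule indep_var_restrict[OF indep_\<epsilon>]) auto
  then have X[measurable]: "X1 \<in> N \<rightarrow>\<^sub>M A" "X2 \<in> N \<rightarrow>\<^sub>M B"
    and joint: "distr N A X1 \<Otimes>\<^sub>M distr N B X2 = distr N (A \<Otimes>\<^sub>M B) (\<lambda>x. (X1 x, X2 x))"
    by (auto simp: indep_var_distribution_eq)
  interpret D2: prob_space "distr N B X2" by (rule prob_space_distr) simp
  have [measurable]: "U \<in> borel_measurable A" "\<sigma> \<in> borel_measurable A" "(\<lambda>y. y n) \<in> borel_measurable B"
    unfolding A_def B_def \<sigma>_def by measurable
  define G where "G p = U (fst p) * g (\<sigma> (fst p) + snd p n)" for p :: "(nat \<Rightarrow> real) \<times> (nat \<Rightarrow> real)"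
  have [measurable]: "G \<in> borel_measurable (A \<Otimes>\<^sub>M B)" unfolding G_def by measurable
  have \<sigma>: "\<sigma> (X1 \<omega>) = S n \<omega>" and X2n: "X2 \<omega> n = \<epsilon> n \<omega>" for \<omega>
    by (simp_all add: \<sigma>_def X1_def X2_def S_def)
  have "(\<integral>\<^sup>+\<omega>. U (X1 \<omega>) * g (S (Suc n) \<omega>) \<partial>N) = (\<integral>\<^sup>+p. G p \<partial>distr N (A \<Otimes>\<^sub>M B) (\<lambda>x. (X1 x, X2 x)))"
    by (simp add: nn_integral_distr G_def \<sigma> X2n S_Suc)
  also have "\<dots> = (\<integral>\<^sup>+x. \<integral>\<^sup>+y. G (x, y) \<partial>distr N B X2 \<partial>distr N A X1)"
    unfolding joint[symmetric] by (subst D2.nn_integral_fst[symmetric]) auto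
  also have "\<dots> = (\<integral>\<^sup>+\<omega>. \<integral>\<^sup>+y. G (X1 \<omega>, y) \<partial>distr N B X2 \<partial>N)"
    by (rule nn_integral_distr) measurable
  also have "\<dots> = (\<integral>\<^sup>+\<omega>. U (X1 \<omega>) * (\<integral>\<^sup>+s. ennreal (exponential_density 1 s) * g (S n \<omega> + s) \<partial>lborel) \<partial>N)"
  proof (rule nn_integral_cong)
    fix \<omega> assume \<omega>: "\<omega> \<in> space N"
    then have X1: "X1 \<omega> \<in> space A" using measurable_space[OF X(1)] by simp
    have [measurable]: "(\<lambda>y. G (X1 \<omega>, y)) \<in> borel_measurable B"
      using measurable_compose[OF measurable_Pair1'[OF X1] \<open>G \<in> borel_measurable (A \<Otimes>\<^sub>M B)\<close>] .
    have "(\<integral>\<^sup>+y. G (X1 \<omega>, y) \<partial>distr N B X2) = (\<integral>\<^sup>+\<omega>'. U (X1 \<omega>) * g (S n \<omega> + \<epsilon> n \<omega>') \<partial>N)"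
    proof -
      have "(\<integral>\<^sup>+y. G (X1 \<omega>, y) \<partial>distr N B X2) = (\<integral>\<^sup>+\<omega>'. G (X1 \<omega>, X2 \<omega>') \<partial>N)"
        by (rule nn_integral_distr[OF X(2)]) measurable
      then show ?thesis by (simp add: G_def \<sigma> X2n)
    qed
    also have "\<dots> = U (X1 \<omega>) * (\<integral>\<^sup>+\<omega>'. g (S n \<omega> + \<epsilon> n \<omega>') \<partial>N)"
      by (intro nn_integral_cmult measurable_compose[OF _ assms(2)] borel_measurable_add meas_\<epsilon> borel_measurable_const)
    also have "(\<integral>\<^sup>+\<omega>'. g (S n \<omega> + \<epsilon> n \<omega>') \<partial>N) = (\<integral>\<^sup>+s. ennreal (exponential_density 1 s) * g (S n \<omega> + s) \<partial>lborel)"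
      using distributed_nn_integral[OF dist_\<epsilon>, of "\<lambda>s. g (S n \<omega> + s)" n] measurable_compose[OF _ assms(2), of "\<lambda>s. S n \<omega> + s" lborel]
      by simp
    finally show "(\<integral>\<^sup>+y. G (X1 \<omega>, y) \<partial>distr N B X2) =
      U (X1 \<omega>) * (\<integral>\<^sup>+s. ennreal (exponential_density 1 s) * g (S n \<omega> + s) \<partial>lborel)" .
  qed
  finally show ?thesis by (simp add: X1_def)
qed

lemma laplace_S: "(\<integral>\<^sup>+\<omega>. ennreal (exp (- S n \<omega>)) \<partial>N) = ennreal ((1 / 2) ^ n)"
proof (induction n)
  case 0
  then show ?case by (simp add: emeasure_space_1)
next
  case (Suc n)
  have e: "(\<integral>\<^sup>+s. ennreal (exponential_density 1 s) * ennreal (exp (- (x + s))) \<partial>lborel) = ennreal (1 / 2) * ennreal (exp (- x))" for x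
  proof -
    interpret E2: prob_space "density lborel (exponential_density 2)" by (rule prob_space_exponential_density) simp
    have "(\<integral>\<^sup>+s. ennreal (exponential_density 2 s) \<partial>lborel) = 1"
      using E2.emeasure_space_1 by (simp add: emeasure_density)
    moreover have "ennreal (exponential_density 1 s) * ennreal (exp (- (x + s))) =
       ennreal (1 / 2) * ennreal (exp (- x)) * ennreal (exponential_density 2 s)" for s
    proof -
      have "ennreal (exponential_density 1 s) * ennreal (exp (- (x + s))) = ennreal (exponential_density 1 s * exp (- (x + s)))"
        by (rule ennreal_mult[symmetric]) (auto simp: exponential_density_def)
      also have "exponential_density 1 s * exp (- (x + s)) = (1 / 2 * exp (- x)) * exponential_density 2 s"
        by (auto simp: exponential_density_def mult_exp_exp)
      also have "ennreal \<dots> = ennreal (1 / 2 * exp (- x)) * ennreal (exponential_density 2 s)"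
        by (rule ennreal_mult) (auto simp: exponential_density_def)
      also have "ennreal (1 / 2 * exp (- x)) = ennreal (1 / 2) * ennreal (exp (- x))"
        by (rule ennreal_mult) auto
      finally show ?thesis .
    qed
    ultimately show ?thesis by (simp add: nn_integral_cmult)
  qed
  have "(\<integral>\<^sup>+\<omega>. ennreal (exp (- S (Suc n) \<omega>)) \<partial>N) =
     (\<integral>\<^sup>+\<omega>. 1 * (\<integral>\<^sup>+s. ennreal (exponential_density 1 s) * ennreal (exp (- (S n \<omega> + s))) \<partial>lborel) \<partial>N)"
    using next_step[of "\<lambda>_. 1" n "\<lambda>r. ennreal (exp (- r))"] by simp
  also have "\<dots> = ennreal (1 / 2) * (\<integral>\<^sup>+\<omega>. ennreal (exp (- S n \<omega>)) \<partial>N)"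
    unfolding e by (simp add: nn_integral_cmult)
  also have "\<dots> = ennreal (1 / 2 * (1 / 2) ^ n)" unfolding Suc by (rule ennreal_mult[symmetric]) auto
  finally show ?case by simp
qed

end

locale thinned_poisson = iid_exponential N \<epsilon> + thinning q for N :: "'b measure" and \<epsilon> and q +
  fixes T :: real
  assumes T: "0 \<le> T" "\<And>r. T < r \<Longrightarrow> q r = 1"
begin

text \<open>The invariance of \<open>v\<close>, iterated along the points.\<close>

lemma martingale: "(\<integral>\<^sup>+\<omega>. (\<Prod>k<n. ennreal (q (S (Suc k) \<omega>))) * ennreal (v (S n \<omega>)) \<partial>N) = 1"
proof (induction n)
  case 0
  then show ?case by (simp add: v_0 emeasure_space_1)
next
  case (Suc n)
  define U where "U x = (\<Prod>k<n. ennreal (q (\<Sum>i<Suc k. x i)))" for x :: "nat \<Rightarrow> real"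
  have [measurable]: "U \<in> borel_measurable (PiM {..<n} (\<lambda>_. borel))"
    unfolding U_def
  proof (intro borel_measurable_prod_ennreal measurable_compose[OF _ measurable_ennreal] measurable_compose[OF _ q_meas] borel_measurable_sum)
    fix k i assume "k \<in> {..<n}" "i \<in> {..<Suc k}"
    then show "(\<lambda>x. x i) \<in> borel_measurable (PiM {..<n} (\<lambda>_. borel))"
      by (intro measurable_component_singleton) auto
  qed
  have U: "U (\<lambda>i\<in>{..<n}. \<epsilon> i \<omega>) = (\<Prod>k<n. ennreal (q (S (Suc k) \<omega>)))" for \<omega>
    unfolding U_def S_def by (intro prod.cong refl arg_cong[where f = ennreal] arg_cong[where f = q] sum.cong) auto
  have "(\<integral>\<^sup>+\<omega>. (\<Prod>k<Suc n. ennreal (q (S (Suc k) \<omega>))) * ennreal (v (S (Suc n) \<omega>)) \<partial>N) =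
    (\<integral>\<^sup>+\<omega>. U (\<lambda>i\<in>{..<n}. \<epsilon> i \<omega>) * (\<lambda>r. ennreal (q r * v r)) (S (Suc n) \<omega>) \<partial>N)"
    by (intro nn_integral_cong) (simp add: U ennreal_mult q_bounds v_def W_bounds less_imp_le mult.assoc)
  also have "\<dots> = (\<integral>\<^sup>+\<omega>. U (\<lambda>i\<in>{..<n}. \<epsilon> i \<omega>) *
      (\<integral>\<^sup>+s. ennreal (exponential_density 1 s) * (\<lambda>r. ennreal (q r * v r)) (S n \<omega> + s) \<partial>lborel) \<partial>N)"
    by (rule next_step) measurable
  also have "\<dots> = (\<integral>\<^sup>+\<omega>. (\<Prod>k<n. ennreal (q (S (Suc k) \<omega>))) * ennreal (v (S n \<omega>)) \<partial>N)"
  proof (rule nn_integral_cong_AE)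
    show "AE \<omega> in N. U (\<lambda>i\<in>{..<n}. \<epsilon> i \<omega>) *
      (\<integral>\<^sup>+s. ennreal (exponential_density 1 s) * (\<lambda>r. ennreal (q r * v r)) (S n \<omega> + s) \<partial>lborel) =
      (\<Prod>k<n. ennreal (q (S (Suc k) \<omega>))) * ennreal (v (S n \<omega>))"
      using AE_S_pos
    proof eventually_elim
      fix \<omega> assume "\<forall>n. 0 \<le> S n \<omega> \<and> 0 < S (Suc n) \<omega>"
      then show "U (\<lambda>i\<in>{..<n}. \<epsilon> i \<omega>) *
        (\<integral>\<^sup>+s. ennreal (exponential_density 1 s) * (\<lambda>r. ennreal (q r * v r)) (S n \<omega> + s) \<partial>lborel) =
        (\<Prod>k<n. ennreal (q (S (Suc k) \<omega>))) * ennreal (v (S n \<omega>))"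
        using v_invariant[OF T, of "S n \<omega>"] by (simp add: U)
    qed
  qed
  finally show ?case using Suc by simp
qed

text \<open>Once the points have passed \<open>T\<close>, \<open>v\<close> is the constant \<open>v T = exp (T - \<Theta> T)\<close>. The points before
  \<open>T\<close> are controlled by \<open>E e\<^sup>-\<^sup>S\<^sup>(\<^sup>n\<^sup>) = 2\<^sup>-\<^sup>n\<close>.\<close>

lemma thinned_limit: "(\<lambda>n. \<integral>\<^sup>+\<omega>. (\<Prod>k<n. ennreal (q (S (Suc k) \<omega>))) \<partial>N) \<longlonglongrightarrow> ennreal (exp (\<Theta> T - T))"
proof -
  define a where "a n \<omega> = (\<Prod>k<n. q (S (Suc k) \<omega>))" for n \<omega>
  have a: "0 \<le> a n \<omega>" "a n \<omega> \<le> 1" for n \<omega>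
    unfolding a_def by (auto intro!: prod_nonneg prod_le_1 q_bounds)
  have [measurable]: "a n \<in> borel_measurable N" for n unfolding a_def by measurable
  have int_a: "integrable N (a n)" for n by (rule integrable_const_bound[of _ 1]) (use a in auto)
  have v0: "0 \<le> v x" for x by (simp add: v_def W_bounds less_imp_le)
  have vT: "0 < v T" by (simp add: v_def W_bounds)
  have int_av: "integrable N (\<lambda>\<omega>. a n \<omega> * v (S n \<omega>))" for n
  proof (rule integrable_const_bound[of _ "v T"])
    show "AE \<omega> in N. norm (a n \<omega> * v (S n \<omega>)) \<le> v T"
      using AE_S_pos
    proof eventually_elim
      fix \<omega> assume "\<forall>n. 0 \<le> S n \<omega> \<and> 0 < S (Suc n) \<omega>"
      then have "v (S n \<omega>) \<le> v T" using v_bound(2)[OF T] by simp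
      then have "a n \<omega> * v (S n \<omega>) \<le> 1 * v T" using a v0 by (intro mult_mono) auto
      then show "norm (a n \<omega> * v (S n \<omega>)) \<le> v T" using a v0 by simp
    qed
  qed measurable
  have pr: "(\<Prod>k<n. ennreal (q (S (Suc k) \<omega>))) = ennreal (a n \<omega>)" for n \<omega>
    unfolding a_def by (rule prod_ennreal) (simp add: q_bounds)
  have E1: "expectation (\<lambda>\<omega>. a n \<omega> * v (S n \<omega>)) = 1" for n
    using martingale[of n] nn_integral_eq_integral[OF int_av, of n] a v0
    by (simp add: pr ennreal_mult)
  have int_e: "integrable N (\<lambda>\<omega>. exp (- S n \<omega>))" and E2: "expectation (\<lambda>\<omega>. exp (- S n \<omega>)) = (1 / 2) ^ n" for n
  proof -
    show i: "integrable N (\<lambda>\<omega>. exp (- S n \<omega>))"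
      by (rule integrableI_bounded) (use laplace_S[of n] in auto)
    show "expectation (\<lambda>\<omega>. exp (- S n \<omega>)) = (1 / 2) ^ n"
      using nn_integral_eq_integral[OF i] laplace_S[of n] by simp
  qed
  have bound: "\<bar>v T * expectation (a n) - 1\<bar> \<le> v T * exp T * (1 / 2) ^ n" for n
  proof -
    have "v T * expectation (a n) - 1 = expectation (\<lambda>\<omega>. v T * a n \<omega> - a n \<omega> * v (S n \<omega>))"
      using int_a[of n] int_av[of n] by (simp add: E1)
    also have "\<bar>\<dots>\<bar> \<le> expectation (\<lambda>\<omega>. \<bar>v T * a n \<omega> - a n \<omega> * v (S n \<omega>)\<bar>)" by (rule integral_abs_bound)
    also have "\<dots> \<le> expectation (\<lambda>\<omega>. v T * exp T * exp (- S n \<omega>))"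
    proof (rule integral_mono_AE)
      show "AE \<omega> in N. \<bar>v T * a n \<omega> - a n \<omega> * v (S n \<omega>)\<bar> \<le> v T * exp T * exp (- S n \<omega>)"
        using AE_S_pos
      proof eventually_elim
        fix \<omega> assume "\<forall>n. 0 \<le> S n \<omega> \<and> 0 < S (Suc n) \<omega>"
        then have *: "v (S n \<omega>) \<le> v T" "v T - v (S n \<omega>) \<le> v T * exp (T - S n \<omega>)"
          using v_bound[OF T, of "S n \<omega>"] by auto
        have "\<bar>v T * a n \<omega> - a n \<omega> * v (S n \<omega>)\<bar> = a n \<omega> * (v T - v (S n \<omega>))"
        proof -
          have "v T * a n \<omega> - a n \<omega> * v (S n \<omega>) = a n \<omega> * (v T - v (S n \<omega>))" by (simp add: algebra_simps)
          then show ?thesis using * a[of n \<omega>] by simp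
        qed
        also have "\<dots> \<le> 1 * (v T * exp (T - S n \<omega>))" using * a by (intro mult_mono) auto
        also have "\<dots> = v T * exp T * exp (- S n \<omega>)" by (simp add: exp_diff exp_minus field_simps)
        finally show "\<bar>v T * a n \<omega> - a n \<omega> * v (S n \<omega>)\<bar> \<le> v T * exp T * exp (- S n \<omega>)" .
      qed
    qed (use int_a int_av int_e in auto)
    finally show ?thesis by (simp add: E2)
  qed
  have "(\<lambda>n. v T * exp T * (1 / 2) ^ n) \<longlonglongrightarrow> v T * exp T * 0"
    by (intro tendsto_intros LIMSEQ_power_zero) simp
  then have geo: "(\<lambda>n. v T * exp T * (1 / 2) ^ n) \<longlonglongrightarrow> 0" by simp
  have "(\<lambda>n. v T * expectation (a n) - 1) \<longlonglongrightarrow> 0"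
  proof (rule Lim_null_comparison[OF _ geo])
    show "\<forall>\<^sub>F n in sequentially. norm (v T * expectation (a n) - 1) \<le> v T * exp T * (1 / 2) ^ n"
      unfolding real_norm_def by (intro always_eventually allI bound)
  qed
  then have "(\<lambda>n. v T * expectation (a n)) \<longlonglongrightarrow> 1" by (simp add: LIM_zero_iff)
  then have "(\<lambda>n. (1 / v T) * (v T * expectation (a n))) \<longlonglongrightarrow> 1 / v T * 1" by (rule tendsto_mult_left)
  moreover have "1 / v T * 1 = exp (\<Theta> T - T)"
    by (simp add: v_def W_def exp_diff exp_minus field_simps)
  moreover have "(1 / v T) * (v T * y) = y" for y using vT by simp
  ultimately have "(\<lambda>n. expectation (a n)) \<longlonglongrightarrow> exp (\<Theta> T - T)" by (simp only:)
  then have "(\<lambda>n. ennreal (expectation (a n))) \<longlonglongrightarrow> ennreal (exp (\<Theta> T - T))" by (rule tendsto_ennrealI)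
  then show ?thesis unfolding pr using nn_integral_eq_integral[OF int_a] a by simp
qed

end

locale marked_poisson = iid_exponential N \<epsilon> for N :: "'b measure" and \<epsilon> +
  fixes Z :: "nat \<Rightarrow> 'b \<Rightarrow> ennreal" and \<kappa> :: "ennreal measure"
  assumes indep_Z: "indep_vars (\<lambda>_. borel) Z UNIV"
    and dist_Z: "\<And>k. distr N borel (Z k) = \<kappa>"
    and indep_Z_\<epsilon>: "indep_sequences N Z \<epsilon>"
begin

lemma meas_Z [measurable]: "Z k \<in> borel_measurable N"
  using indep_Z by (auto simp: indep_vars_def)

lemma sets_\<kappa> [measurable_cong, simp]: "sets \<kappa> = sets borel"
  using dist_Z[of 0] by (metis sets_distr)

lemma prob_\<kappa>: "prob_space \<kappa>"
  unfolding dist_Z[of 0, symmetric] by (rule prob_space_distr) simp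

sublocale \<kappa>: prob_space \<kappa> by (rule prob_\<kappa>)

lemma marks_independent:
  fixes \<Phi> :: "(nat \<Rightarrow> ennreal) \<times> (nat \<Rightarrow> real) \<Rightarrow> ennreal"
  assumes [measurable]: "\<Phi> \<in> borel_measurable (PiM UNIV (\<lambda>_. borel) \<Otimes>\<^sub>M PiM UNIV (\<lambda>_. borel))"
  shows "(\<integral>\<^sup>+\<omega>. \<Phi> (\<lambda>k. Z k \<omega>, \<lambda>k. \<epsilon> k \<omega>) \<partial>N) = (\<integral>\<^sup>+\<omega>'. \<integral>\<^sup>+\<omega>. \<Phi> (\<lambda>k. Z k \<omega>, \<lambda>k. \<epsilon> k \<omega>') \<partial>N \<partial>N)"
proof -
  define A where "A = PiM (UNIV :: nat set) (\<lambda>_. borel :: ennreal measure)"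
  define B where "B = PiM (UNIV :: nat set) (\<lambda>_. borel :: real measure)"
  define X where "X \<omega> = (\<lambda>k. Z k \<omega>)" for \<omega>
  define Y where "Y \<omega> = (\<lambda>k. \<epsilon> k \<omega>)" for \<omega>
  have [measurable]: "X \<in> N \<rightarrow>\<^sub>M A" "Y \<in> N \<rightarrow>\<^sub>M B"
    unfolding A_def B_def X_def Y_def by (auto intro!: measurable_PiM_single')
  have [measurable]: "\<Phi> \<in> borel_measurable (A \<Otimes>\<^sub>M B)" unfolding A_def B_def by measurable
  interpret DX: prob_space "distr N A X" by (rule prob_space_distr) simp
  interpret DY: prob_space "distr N B Y" by (rule prob_space_distr) simp
  interpret P: pair_sigma_finite "distr N A X" "distr N B Y" ..
  have joint: "distr N A X \<Otimes>\<^sub>M distr N B Y = distr N (A \<Otimes>\<^sub>M B) (\<lambda>\<omega>. (X \<omega>, Y \<omega>))"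
  proof (rule pair_measure_eqI)
    show "sigma_finite_measure (distr N A X)" "sigma_finite_measure (distr N B Y)" by unfold_locales
    fix a b assume "a \<in> sets (distr N A X)" "b \<in> sets (distr N B Y)"
    then have ab[measurable]: "a \<in> sets A" "b \<in> sets B" by auto
    have "indep_set (sets (vimage_algebra (space N) X A)) (sets (vimage_algebra (space N) Y B))"
      using indep_Z_\<epsilon> by (simp add: indep_sequences_def A_def B_def X_def[abs_def] Y_def[abs_def])
    from indep_setD[OF this in_vimage_algebra[OF ab(1)] in_vimage_algebra[OF ab(2)]]
    have "prob ((X -` a \<inter> space N) \<inter> (Y -` b \<inter> space N)) = prob (X -` a \<inter> space N) * prob (Y -` b \<inter> space N)" .
    moreover have "(X -` a \<inter> space N) \<inter> (Y -` b \<inter> space N) = (\<lambda>\<omega>. (X \<omega>, Y \<omega>)) -` (a \<times> b) \<inter> space N" by auto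
    ultimately show "emeasure (distr N A X) a * emeasure (distr N B Y) b = emeasure (distr N (A \<Otimes>\<^sub>M B) (\<lambda>\<omega>. (X \<omega>, Y \<omega>))) (a \<times> b)"
      by (simp add: emeasure_distr emeasure_eq_measure ennreal_mult)
  qed simp
  have "(\<integral>\<^sup>+\<omega>. \<Phi> (X \<omega>, Y \<omega>) \<partial>N) = (\<integral>\<^sup>+p. \<Phi> p \<partial>distr N (A \<Otimes>\<^sub>M B) (\<lambda>\<omega>. (X \<omega>, Y \<omega>)))"
    by (simp add: nn_integral_distr)
  also have "\<dots> = (\<integral>\<^sup>+y. \<integral>\<^sup>+x. \<Phi> (x, y) \<partial>distr N A X \<partial>distr N B Y)"
    unfolding joint[symmetric] by (rule P.nn_integral_snd[symmetric]) simp
  also have "\<dots> = (\<integral>\<^sup>+\<omega>'. \<integral>\<^sup>+x. \<Phi> (x, Y \<omega>') \<partial>distr N A X \<partial>N)"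
    by (rule nn_integral_distr) measurable
  also have "\<dots> = (\<integral>\<^sup>+\<omega>'. \<integral>\<^sup>+\<omega>. \<Phi> (X \<omega>, Y \<omega>') \<partial>N \<partial>N)"
  proof (rule nn_integral_cong)
    fix \<omega>' assume "\<omega>' \<in> space N"
    then have "Y \<omega>' \<in> space B" using measurable_space[OF \<open>Y \<in> N \<rightarrow>\<^sub>M B\<close>] by simp
    from measurable_compose[OF measurable_Pair2'[OF this] \<open>\<Phi> \<in> borel_measurable (A \<Otimes>\<^sub>M B)\<close>]
    show "(\<integral>\<^sup>+x. \<Phi> (x, Y \<omega>') \<partial>distr N A X) = (\<integral>\<^sup>+\<omega>. \<Phi> (X \<omega>, Y \<omega>') \<partial>N)"
      by (intro nn_integral_distr) simp_all
  qed
  finally show ?thesis by (simp add: X_def Y_def)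
qed

context
  fixes h :: "real \<Rightarrow> ennreal \<Rightarrow> ennreal"
  assumes h [measurable]: "case_prod h \<in> borel_measurable (borel \<Otimes>\<^sub>M borel)"
begin

definition retention :: "real \<Rightarrow> real" where
  "retention \<gamma> = (\<integral>z. exp_neg (h \<gamma> z) \<partial>\<kappa>)"

lemma h_section: "h \<gamma> \<in> borel_measurable borel"
  using measurable_Pair2[OF h, of \<gamma>] by simp

lemma retention_meas: "retention \<in> borel_measurable borel"
  unfolding retention_def by (rule \<kappa>.borel_measurable_lebesgue_integral) measurable

lemma integrable_retention: "integrable \<kappa> (\<lambda>z. exp_neg (h \<gamma> z))"
  using h_section by (intro \<kappa>.integrable_const_bound[of _ 1]) auto

lemma retention_bounds: "0 \<le> retention \<gamma>" "retention \<gamma> \<le> 1"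
proof -
  show "0 \<le> retention \<gamma>" unfolding retention_def by (rule Bochner_Integration.integral_nonneg) simp
  have "retention \<gamma> \<le> (\<integral>z. 1 \<partial>\<kappa>)"
    unfolding retention_def by (rule integral_mono[OF integrable_retention]) auto
  then show "retention \<gamma> \<le> 1" by (simp add: \<kappa>.prob_space)
qed

text \<open>Given the points, the marks are independent, and integrating them turns the exponentials into
  retention probabilities.\<close>

lemma integrate_marks:
  "(\<integral>\<^sup>+\<omega>. ennreal (exp_neg (\<Sum>k<n. h (S (Suc k) \<omega>) (Z k \<omega>))) \<partial>N) =
   (\<integral>\<^sup>+\<omega>. (\<Prod>k<n. ennreal (retention (S (Suc k) \<omega>))) \<partial>N)"
proof -
  note [measurable] = h_section
  define \<Phi> where "\<Phi> p = (\<Prod>k<n. ennreal (exp_neg (h (\<Sum>i<Suc k. snd p i) (fst p k))))" for p :: "(nat \<Rightarrow> ennreal) \<times> (nat \<Rightarrow> real)"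
  have [measurable]: "\<Phi> \<in> borel_measurable (PiM UNIV (\<lambda>_. borel) \<Otimes>\<^sub>M PiM UNIV (\<lambda>_. borel))"
    unfolding \<Phi>_def by measurable
  have "(\<integral>\<^sup>+\<omega>. ennreal (exp_neg (\<Sum>k<n. h (S (Suc k) \<omega>) (Z k \<omega>))) \<partial>N) = (\<integral>\<^sup>+\<omega>. \<Phi> (\<lambda>k. Z k \<omega>, \<lambda>k. \<epsilon> k \<omega>) \<partial>N)"
    by (intro nn_integral_cong) (simp add: \<Phi>_def S_def exp_neg_sum prod_ennreal)
  also have "\<dots> = (\<integral>\<^sup>+\<omega>'. \<integral>\<^sup>+\<omega>. \<Phi> (\<lambda>k. Z k \<omega>, \<lambda>k. \<epsilon> k \<omega>') \<partial>N \<partial>N)"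
    by (rule marks_independent) simp
  also have "\<dots> = (\<integral>\<^sup>+\<omega>'. (\<Prod>k<n. ennreal (retention (S (Suc k) \<omega>'))) \<partial>N)"
  proof (rule nn_integral_cong)
    fix \<omega>'
    have "indep_vars (\<lambda>_. borel) (\<lambda>k \<omega>. ennreal (exp_neg (h (S (Suc k) \<omega>') (Z k \<omega>)))) {..<n}"
      by (rule indep_vars_compose2[OF indep_vars_subset[OF indep_Z]]) auto
    then have "(\<integral>\<^sup>+\<omega>. (\<Prod>k<n. ennreal (exp_neg (h (S (Suc k) \<omega>') (Z k \<omega>)))) \<partial>N) =
       (\<Prod>k<n. \<integral>\<^sup>+\<omega>. ennreal (exp_neg (h (S (Suc k) \<omega>') (Z k \<omega>))) \<partial>N)"
      by (intro indep_vars_nn_integral) auto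
    also have "\<dots> = (\<Prod>k<n. ennreal (retention (S (Suc k) \<omega>')))"
    proof (rule prod.cong[OF refl])
      fix k
      have "(\<integral>\<^sup>+\<omega>. ennreal (exp_neg (h (S (Suc k) \<omega>') (Z k \<omega>))) \<partial>N) = (\<integral>\<^sup>+z. ennreal (exp_neg (h (S (Suc k) \<omega>') z)) \<partial>distr N borel (Z k))"
        by (simp add: nn_integral_distr)
      then show "(\<integral>\<^sup>+\<omega>. ennreal (exp_neg (h (S (Suc k) \<omega>') (Z k \<omega>))) \<partial>N) = ennreal (retention (S (Suc k) \<omega>'))"
        unfolding dist_Z retention_def by (simp add: nn_integral_eq_integral integrable_retention)
    qed
    finally show "(\<integral>\<^sup>+\<omega>. \<Phi> (\<lambda>k. Z k \<omega>, \<lambda>k. \<epsilon> k \<omega>') \<partial>N) = (\<Prod>k<n. ennreal (retention (S (Suc k) \<omega>')))"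
      by (simp add: \<Phi>_def S_def)
  qed
  finally show ?thesis .
qed

text \<open>The truncation makes the exponent finite and lets only finitely many points matter.\<close>

lemma laplace_truncated:
  assumes T: "0 \<le> T" "\<And>\<gamma> z. T < \<gamma> \<Longrightarrow> h \<gamma> z = 0"
  shows "(\<integral>\<^sup>+\<omega>. ennreal (exp_neg (\<Sum>k. h (S (Suc k) \<omega>) (Z k \<omega>))) \<partial>N) =
    ennreal (exp_neg (\<integral>\<^sup>+\<gamma>. ennreal (1 - retention \<gamma>) * indicator {0<..T} \<gamma> \<partial>lborel))"
proof (rule LIMSEQ_unique)
  note [measurable] = h_section retention_meas
  have ret: "retention r = 1" if "T < r" for r
    unfolding retention_def T(2)[OF that] by (simp add: \<kappa>.prob_space)
  have "thinned_poisson N \<epsilon> retention T"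
  proof (intro thinned_poisson.intro thinning.intro thinned_poisson_axioms.intro)
    show "iid_exponential N \<epsilon>" by (rule iid_exponential_axioms)
  qed (fact retention_meas retention_bounds T(1) ret)+
  then interpret tp: thinned_poisson N \<epsilon> retention T .
  show "(\<lambda>n. \<integral>\<^sup>+\<omega>. ennreal (exp_neg (\<Sum>k<n. h (S (Suc k) \<omega>) (Z k \<omega>))) \<partial>N) \<longlonglongrightarrow>
    (\<integral>\<^sup>+\<omega>. ennreal (exp_neg (\<Sum>k. h (S (Suc k) \<omega>) (Z k \<omega>))) \<partial>N)"
    by (rule nn_integral_dominated_convergence[where w = "\<lambda>_. 1"])
      (auto simp: emeasure_space_1 intro!: tendsto_ennrealI tendsto_exp_neg summable_LIMSEQ)
  have q1: "\<bar>1 - retention r\<bar> \<le> 1" "\<bar>retention r\<bar> \<le> 1" for r using retention_bounds[of r] by auto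
  have int: "set_integrable lborel {0<..T} (\<lambda>r. 1 - retention r)" "set_integrable lborel {0<..T} retention"
    "set_integrable lborel {0<..T} (\<lambda>r. 1 :: real)"
    by (rule tp.set_integrable_bounded; use q1 in simp)+
  have "T - tp.\<Theta> T = (LINT r:{0<..T}|lborel. 1 - retention r)"
    using set_integral_diff(2)[OF int(3,2)] T by (simp add: tp.\<Theta>_def set_lebesgue_integral_def)
  also have "ennreal \<dots> = (\<integral>\<^sup>+\<gamma>. ennreal (1 - retention \<gamma>) * indicator {0<..T} \<gamma> \<partial>lborel)"
    unfolding set_lebesgue_integral_def
    using int(1) retention_bounds
    by (subst nn_integral_eq_integral[symmetric])
      (auto simp: set_integrable_def indicator_def intro!: nn_integral_cong)
  finally have e: "ennreal (T - tp.\<Theta> T) = (\<integral>\<^sup>+\<gamma>. ennreal (1 - retention \<gamma>) * indicator {0<..T} \<gamma> \<partial>lborel)" .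
  have "0 \<le> T - tp.\<Theta> T" using tp.\<Theta>_diff(3)[of 0 T] T by (simp add: tp.\<Theta>_neg)
  then have "exp (tp.\<Theta> T - T) = exp_neg (\<integral>\<^sup>+\<gamma>. ennreal (1 - retention \<gamma>) * indicator {0<..T} \<gamma> \<partial>lborel)"
    unfolding e[symmetric] by (simp add: exp_neg_ennreal)
  then show "(\<lambda>n. \<integral>\<^sup>+\<omega>. ennreal (exp_neg (\<Sum>k<n. h (S (Suc k) \<omega>) (Z k \<omega>))) \<partial>N) \<longlonglongrightarrow>
     ennreal (exp_neg (\<integral>\<^sup>+\<gamma>. ennreal (1 - retention \<gamma>) * indicator {0<..T} \<gamma> \<partial>lborel))"
    using tp.thinned_limit unfolding integrate_marks by simp
qed

end

text \<open>The truncation is removed by monotone convergence on both sides, so the exponent may be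
  infinite.\<close>

theorem laplace_marked:
  assumes h: "case_prod h \<in> borel_measurable (borel \<Otimes>\<^sub>M borel)"
  shows "(\<integral>\<^sup>+\<omega>. ennreal (exp_neg (\<Sum>k. h (S (Suc k) \<omega>) (Z k \<omega>))) \<partial>N) =
    ennreal (exp_neg (\<integral>\<^sup>+\<gamma>. ennreal (1 - (\<integral>z. exp_neg (h \<gamma> z) \<partial>\<kappa>)) * indicator {0<..} \<gamma> \<partial>lborel))"
proof (rule LIMSEQ_unique)
  define hT where "hT m \<gamma> z = (if \<gamma> \<le> real m then h \<gamma> z else 0)" for m \<gamma> z
  have hT: "case_prod (hT m) \<in> borel_measurable (borel \<Otimes>\<^sub>M borel)" for m
  proof -
    have "case_prod (hT m) = (\<lambda>p. if fst p \<le> real m then case_prod h p else 0)" by (auto simp: fun_eq_iff hT_def)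
    also have "\<dots> \<in> borel_measurable (borel \<Otimes>\<^sub>M borel)"
      by (intro measurable_If h measurable_const) measurable
    finally show ?thesis .
  qed
  have meas: "(\<lambda>\<omega>. g (S (Suc k) \<omega>) (Z k \<omega>)) \<in> borel_measurable N"
    if g: "case_prod g \<in> borel_measurable (borel \<Otimes>\<^sub>M borel)" for g :: "real \<Rightarrow> ennreal \<Rightarrow> ennreal" and k
    using measurable_compose[OF measurable_Pair[OF meas_S[of "Suc k"] meas_Z[of k]] g] unfolding prod.case .
  have meas': "(\<lambda>\<omega>. ennreal (exp_neg (\<Sum>k. g (S (Suc k) \<omega>) (Z k \<omega>)))) \<in> borel_measurable N"
    if "case_prod g \<in> borel_measurable (borel \<Otimes>\<^sub>M borel)" for g :: "real \<Rightarrow> ennreal \<Rightarrow> ennreal"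
    by (intro measurable_compose[OF _ measurable_ennreal] measurable_compose[OF _ borel_measurable_exp_neg]
        borel_measurable_suminf_order meas that)
  have inc: "incseq (\<lambda>m. hT m \<gamma> z)" for \<gamma> z by (auto simp: incseq_def hT_def)
  have sup: "(SUP m. hT m \<gamma> z) = h \<gamma> z" for \<gamma> z
  proof -
    obtain m where "\<gamma> \<le> real m" using real_arch_simple by blast
    then have "h \<gamma> z \<le> (SUP m. hT m \<gamma> z)" by (intro SUP_upper2[of m]) (auto simp: hT_def)
    moreover have "(SUP m. hT m \<gamma> z) \<le> h \<gamma> z" by (intro SUP_least) (simp add: hT_def)
    ultimately show ?thesis by simp
  qed
  have lim: "(\<lambda>m. \<Sum>k. hT m (S (Suc k) \<omega>) (Z k \<omega>)) \<longlonglongrightarrow> (\<Sum>k. h (S (Suc k) \<omega>) (Z k \<omega>))" for \<omega>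
  proof -
    have "(\<lambda>m. \<Sum>k. hT m (S (Suc k) \<omega>) (Z k \<omega>)) \<longlonglongrightarrow> (SUP m. \<Sum>k. hT m (S (Suc k) \<omega>) (Z k \<omega>))"
      by (rule LIMSEQ_SUP) (auto simp: incseq_def intro!: suminf_le incseqD[OF inc])
    also have "(SUP m. \<Sum>k. hT m (S (Suc k) \<omega>) (Z k \<omega>)) = (\<Sum>k. SUP m. hT m (S (Suc k) \<omega>) (Z k \<omega>))"
      by (rule ennreal_suminf_SUP_eq[symmetric]) (rule inc)
    finally show ?thesis by (simp add: sup)
  qed
  show "(\<lambda>m. \<integral>\<^sup>+\<omega>. ennreal (exp_neg (\<Sum>k. hT m (S (Suc k) \<omega>) (Z k \<omega>))) \<partial>N) \<longlonglongrightarrow>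
    (\<integral>\<^sup>+\<omega>. ennreal (exp_neg (\<Sum>k. h (S (Suc k) \<omega>) (Z k \<omega>))) \<partial>N)"
  proof (rule nn_integral_dominated_convergence[where w = "\<lambda>_. 1"])
    show "AE \<omega> in N. (\<lambda>m. ennreal (exp_neg (\<Sum>k. hT m (S (Suc k) \<omega>) (Z k \<omega>)))) \<longlonglongrightarrow>
        ennreal (exp_neg (\<Sum>k. h (S (Suc k) \<omega>) (Z k \<omega>)))"
      by (intro AE_I2 tendsto_ennrealI tendsto_exp_neg lim)
  qed (intro meas' hT h, intro meas' hT h, simp_all add: emeasure_space_1)
  have tr: "(\<integral>\<^sup>+\<omega>. ennreal (exp_neg (\<Sum>k. hT m (S (Suc k) \<omega>) (Z k \<omega>))) \<partial>N) =
    ennreal (exp_neg (\<integral>\<^sup>+\<gamma>. ennreal (1 - retention h \<gamma>) * indicator {0<..real m} \<gamma> \<partial>lborel))" for m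
  proof -
    have "(\<integral>\<^sup>+\<omega>. ennreal (exp_neg (\<Sum>k. hT m (S (Suc k) \<omega>) (Z k \<omega>))) \<partial>N) =
      ennreal (exp_neg (\<integral>\<^sup>+\<gamma>. ennreal (1 - retention (hT m) \<gamma>) * indicator {0<..real m} \<gamma> \<partial>lborel))"
      by (rule laplace_truncated[OF hT]) (auto simp: hT_def)
    also have "(\<integral>\<^sup>+\<gamma>. ennreal (1 - retention (hT m) \<gamma>) * indicator {0<..real m} \<gamma> \<partial>lborel) =
       (\<integral>\<^sup>+\<gamma>. ennreal (1 - retention h \<gamma>) * indicator {0<..real m} \<gamma> \<partial>lborel)"
      by (intro nn_integral_cong) (auto simp: indicator_def retention_def[OF hT] retention_def[OF h] hT_def)
    finally show ?thesis .
  qed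
  have [measurable]: "retention h \<in> borel_measurable borel" by (rule retention_meas[OF h])
  have "(\<lambda>m. \<integral>\<^sup>+\<gamma>. ennreal (1 - retention h \<gamma>) * indicator {0<..real m} \<gamma> \<partial>lborel) \<longlonglongrightarrow>
    (\<integral>\<^sup>+\<gamma>. ennreal (1 - retention h \<gamma>) * indicator {0<..} \<gamma> \<partial>lborel)"
  proof (rule nn_integral_LIMSEQ)
    show "incseq (\<lambda>m \<gamma>. ennreal (1 - retention h \<gamma>) * indicator {0<..real m} \<gamma>)"
      by (intro incseq_SucI le_funI) (auto simp: indicator_def)
    show "(\<lambda>m. ennreal (1 - retention h \<gamma>) * indicator {0<..real m} \<gamma>) \<longlonglongrightarrow> ennreal (1 - retention h \<gamma>) * indicator {0<..} \<gamma>" for \<gamma>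
    proof (rule tendsto_eventually)
      show "\<forall>\<^sub>F m in sequentially. ennreal (1 - retention h \<gamma>) * indicator {0<..real m} \<gamma> = ennreal (1 - retention h \<gamma>) * indicator {0<..} \<gamma>"
        using eventually_ge_at_top[of "nat \<lceil>\<gamma>\<rceil>"] by eventually_elim (auto simp: indicator_def nat_le_iff ceiling_le_iff)
    qed
  qed measurable
  then show "(\<lambda>m. \<integral>\<^sup>+\<omega>. ennreal (exp_neg (\<Sum>k. hT m (S (Suc k) \<omega>) (Z k \<omega>))) \<partial>N) \<longlonglongrightarrow>
    ennreal (exp_neg (\<integral>\<^sup>+\<gamma>. ennreal (1 - (\<integral>z. exp_neg (h \<gamma> z) \<partial>\<kappa>)) * indicator {0<..} \<gamma> \<partial>lborel))"
    unfolding tr by (intro tendsto_ennrealI tendsto_exp_neg) (simp add: retention_def[OF h])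
qed

end

section \<open>The LePage representation\<close>

lemma nonneg_cdf_bounds: assumes "nonneg_cdf F" shows "0 \<le> F s" "F s \<le> 1"
proof -
  interpret compatible_path F "\<lambda>_. 0"
    by unfold_locales (use assms in \<open>auto simp: nonneg_cdf_def mono_def intro: gt_ex\<close>)
  show "0 \<le> F s" "F s \<le> 1" by (rule \<Phi>_nonneg, rule \<Phi>_le_1)
qed

lemma nonneg_cdf_measurable: assumes "nonneg_cdf F" shows "F \<in> borel_measurable borel"
  using assms by (intro borel_measurable_mono) (simp add: nonneg_cdf_def)

lemma df_left_measurable:
  assumes F: "nonneg_cdf F" shows "df_left F \<in> borel_measurable borel"
proof -
  interpret compatible_path F "\<lambda>_. 0"
    by unfold_locales (use assms in \<open>auto simp: nonneg_cdf_def mono_def intro: gt_ex\<close>)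
  have "df_left F = (\<lambda>x. if x = \<top> then 1 else \<Phi>m (enn2real x))"
    by (auto simp: df_left_def \<Phi>m_def fun_eq_iff)
  then show ?thesis by simp
qed

lemma dist_fun_less_1: assumes "dist_fun F" shows "F 0 < 1"
proof (rule ccontr)
  assume *: "\<not> F 0 < 1"
  obtain \<mu> where \<mu>: "real_distribution \<mu>" "F = cdf \<mu>" "0 < (\<integral>\<^sup>+x. ennreal x \<partial>\<mu>)"
    using assms by (auto simp: dist_fun_def)
  interpret real_distribution \<mu> by fact
  have "prob {..0} = 1" using * prob_le_1[of "{..0}"] by (simp add: \<mu>(2) cdf_def)
  then have "AE x in \<mu>. x \<in> {..0}" using AE_in_set_eq_1[of "{..0}"] by simp
  then have "(\<integral>\<^sup>+x. ennreal x \<partial>\<mu>) = (\<integral>\<^sup>+x. 0 \<partial>\<mu>)"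
    by (intro nn_integral_cong_AE, eventually_elim) (simp add: ennreal_neg)
  with \<mu>(3) show False by simp
qed

definition Psi_int :: "(real \<Rightarrow> real) \<Rightarrow> ennreal \<Rightarrow> ennreal" where
  "Psi_int F z = (\<integral>\<^sup>+s. ennreal (1 - exp_neg (z * neg_log (F s))) * indicator {0..} s \<partial>lborel)"

text \<open>The formula for finite arguments extends to \<open>z = \<infinity>\<close> by monotone convergence.\<close>

lemma Psi_eq_int:
  assumes F: "nonneg_cdf F" shows "Psi F z = Psi_int F z"
proof -
  note [measurable] = nonneg_cdf_measurable[OF F]
  have fin: "Psi_fin F x = Psi_int F (ennreal x)" for x
    by (simp add: Psi_fin_def Psi_int_def df_power_def)
  have mono: "Psi_int F x \<le> Psi_int F y" if "x \<le> y" for x y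
    unfolding Psi_int_def using that
    by (intro nn_integral_mono mult_right_mono ennreal_leI diff_left_mono) (auto simp: exp_neg_le_iff mult_right_mono)
  show ?thesis
  proof (cases z)
    case (real r)
    then show ?thesis by (simp add: Psi_def fin)
  next
    case top
    have lim: "(\<lambda>n. Psi_int F (ennreal (real n))) \<longlonglongrightarrow> Psi_int F \<top>"
      unfolding Psi_int_def
    proof (rule nn_integral_LIMSEQ)
      show "incseq (\<lambda>n s. ennreal (1 - exp_neg (ennreal (real n) * neg_log (F s))) * indicator {0..} s)"
        by (intro incseq_SucI le_funI mult_right_mono ennreal_leI diff_left_mono)
          (auto simp: exp_neg_le_iff intro!: mult_right_mono ennreal_leI)
      show "(\<lambda>n. ennreal (1 - exp_neg (ennreal (real n) * neg_log (F s))) * indicator {0..} s) \<longlonglongrightarrow>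
        ennreal (1 - exp_neg (\<top> * neg_log (F s))) * indicator {0..} s" for s
        by (cases "0 \<le> s") (auto intro!: tendsto_ennrealI tendsto_diff tendsto_const exp_neg_nat_tendsto)
    qed measurable
    have "(Psi_fin F \<longlongrightarrow> Psi_int F \<top>) at_top"
    proof (rule increasing_tendsto)
      show "\<forall>\<^sub>F x in at_top. Psi_fin F x \<le> Psi_int F \<top>" by (intro always_eventually allI) (simp add: fin mono)
      fix x assume "x < Psi_int F \<top>"
      from order_tendstoD(1)[OF lim this] obtain n where n: "x < Psi_int F (ennreal (real n))"
        by (auto dest: eventually_happens)
      show "\<forall>\<^sub>F y in at_top. x < Psi_fin F y"
        using eventually_ge_at_top[of "real n"]
        by eventually_elim (auto simp: fin intro!: less_le_trans[OF n] mono ennreal_leI)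
    qed
    then show ?thesis using top by (simp add: Psi_def tendsto_Lim)
  qed
qed

lemma Psi_measurable: assumes F: "nonneg_cdf F" shows "Psi F \<in> borel_measurable borel"
proof -
  note [measurable] = nonneg_cdf_measurable[OF F]
  have "Psi F = Psi_int F" using Psi_eq_int[OF F] by (rule ext)
  also have "\<dots> \<in> borel_measurable borel"
    unfolding Psi_int_def by measurable
  finally show ?thesis .
qed

lemma Psi_pos:
  assumes F: "nonneg_cdf F" "F 0 < 1" and z: "0 < z" shows "0 < Psi F z"
proof (rule ccontr)
  note [measurable] = nonneg_cdf_measurable[OF F(1)]
  assume "\<not> 0 < Psi F z"
  then have "Psi_int F z = 0" by (simp add: Psi_eq_int[OF F(1)])
  then have ae: "AE s in lborel. ennreal (1 - exp_neg (z * neg_log (F s))) * indicator {0..} s = 0"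
    unfolding Psi_int_def by (subst (asm) nn_integral_0_iff_AE) auto
  have "(F \<longlongrightarrow> F 0) (at_right 0)" using F by (simp add: nonneg_cdf_def continuous_within)
  from order_tendstoD(2)[OF this F(2)] obtain b where b: "0 < b" "\<And>s. 0 < s \<Longrightarrow> s < b \<Longrightarrow> F s < 1"
    by (auto simp: eventually_at_right_field)
  have pos: "ennreal (1 - exp_neg (z * neg_log (F s))) * indicator {0..} s \<noteq> 0" if s: "0 < s" "s < b" for s
  proof -
    have "0 < neg_log (F s)"
      using b(2)[OF s] less_exp_neg_iff[OF nonneg_cdf_bounds[OF F(1), of s], of 0] by simp
    with z have "0 < z * neg_log (F s)" by (simp add: ennreal_zero_less_mult_iff)
    then have "exp_neg (z * neg_log (F s)) < 1" using exp_neg_less_iff[of _ 0] by simp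
    then show ?thesis using s by (simp add: ennreal_eq_0_iff)
  qed
  have "AE s in lborel. s \<notin> {0<..<b}" using ae by eventually_elim (use pos in auto)
  then have "emeasure lborel {0<..<b} = 0" using AE_iff_null_sets[of "{0<..<b}" lborel] by auto
  with b(1) show False by simp
qed

context subordinator begin

text \<open>The left limit \<open>F(s-)\<close> differs from \<open>F s\<close> at countably many points only.\<close>

lemma H_exponent_eq_Psi:
  assumes F: "nonneg_cdf F" shows "H_exponent (H_integrand F 1) = (\<integral>\<^sup>+z. Psi F z \<partial>\<nu>)"
proof -
  interpret compatible_path F "\<lambda>_. 0"
    by unfold_locales (use assms in \<open>auto simp: nonneg_cdf_def mono_def intro: gt_ex\<close>)
  have "AE s in lborel. s \<notin> {c. \<not> isCont F c}"
    by (intro AE_not_in countable_imp_null_set_lborel countable_discont_\<Phi>)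
  then have ae: "AE s in lborel. 0 < s \<longrightarrow> H_integrand F 1 s = neg_log (F s)"
  proof eventually_elim
    fix s assume "s \<notin> {c. \<not> isCont F c}"
    then show "0 < s \<longrightarrow> H_integrand F 1 s = neg_log (F s)"
      using \<Phi>m_eq[of s] H_integrand_eq[OF F zero_less_one, of s] by (auto simp: \<Phi>m_def)
  qed
  have "(\<integral>\<^sup>+s. ennreal (1 - exp_neg (z * H_integrand F 1 s)) * indicator {0<..} s \<partial>lborel) = Psi F z" for z
    unfolding Psi_eq_int[OF F] Psi_int_def
  proof (rule nn_integral_cong_AE)
    show "AE s in lborel. ennreal (1 - exp_neg (z * H_integrand F 1 s)) * indicator {0<..} s =
      ennreal (1 - exp_neg (z * neg_log (F s))) * indicator {0..} s"
      using ae AE_lborel_singleton[of 0] by eventually_elim (auto simp: indicator_def)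
  qed
  then show ?thesis by (simp add: H_exponent_def)
qed

lemma Psi_H_eq:
  assumes F: "nonneg_cdf F" shows "Psi_H M F L 1 = (\<integral>\<^sup>+z. Psi F z \<partial>\<nu>)"
proof -
  have "(\<integral>\<omega>. exp_neg (ennreal 1 * H_process F L 1 \<omega>) \<partial>completion M) = (\<integral>\<omega>. exp_neg (H_lim F 1 \<omega>) \<partial>completion M)"
  proof (rule integral_cong_AE)
    show "(\<lambda>\<omega>. exp_neg (ennreal 1 * H_process F L 1 \<omega>)) \<in> borel_measurable (completion M)"
      using measurable_compose[OF H_process_measurable[OF F, of 1] borel_measurable_exp_neg] by simp
    show "(\<lambda>\<omega>. exp_neg (H_lim F 1 \<omega>)) \<in> borel_measurable (completion M)" by (rule measurable_completion) measurable
    show "AE \<omega> in completion M. exp_neg (ennreal 1 * H_process F L 1 \<omega>) = exp_neg (H_lim F 1 \<omega>)"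
      unfolding AE_completion_iff using AE_H_lim[OF F, of 1] by auto
  qed
  also have "\<dots> = expectation (\<lambda>\<omega>. exp_neg (H_lim F 1 \<omega>))" by (rule integral_completion) measurable
  also have "\<dots> = exp_neg (\<integral>\<^sup>+z. Psi F z \<partial>\<nu>)"
    using laplace_H[OF F, of "{1}" "\<lambda>_. 1"] by (simp add: H_exponent_eq_Psi[OF F])
  finally show ?thesis by (simp add: Psi_H_def)
qed

end

text \<open>In terms of \<open>s = \<gamma> p / c\<close> a term of the series is \<open>z\<close> times the integrand of \<open>H\<close> at \<open>s\<close>. The
  assumptions exclude the indeterminate quotients, so \<open>t = 0\<close> is covered.\<close>

lemma lepage_term:
  assumes "0 \<le> t" "0 < \<gamma>" "0 < p" "p < \<top>" "0 < c" "c < \<top>"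
  shows "neg_log (df_power (df_left F (ennreal \<gamma> * p / (ennreal t * c))) z) =
    z * H_integrand F t (enn2real (ennreal \<gamma> * p / c))" "0 < enn2real (ennreal \<gamma> * p / c)"
proof -
  obtain p' where p: "p = ennreal p'" "0 < p'" using assms by (cases p) (auto simp: ennreal_less_zero_iff)
  obtain c' where c: "c = ennreal c'" "0 < c'" using assms by (cases c) (auto simp: ennreal_less_zero_iff)
  have s: "ennreal \<gamma> * p / c = ennreal (\<gamma> * p' / c')"
    using p c assms by (simp add: divide_ennreal flip: ennreal_mult)
  show "0 < enn2real (ennreal \<gamma> * p / c)" using p c assms unfolding s by simp
  have "ennreal \<gamma> * p / (ennreal t * c) = ennreal (\<gamma> * p' / c') / ennreal t"
  proof (cases "t = 0")
    case True
    have "ennreal (\<gamma> * p') \<noteq> 0" "ennreal (\<gamma> * p' / c') \<noteq> 0" using p c assms by (simp_all add: ennreal_eq_0_iff not_le)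
    then show ?thesis using True p assms by (simp add: ennreal_divide_zero flip: ennreal_mult)
  next
    case False
    then show ?thesis using p c assms by (simp add: divide_ennreal field_simps flip: ennreal_mult)
  qed
  moreover have "enn2real (ennreal (\<gamma> * p' / c')) = \<gamma> * p' / c'" using p c assms by (intro enn2real_ennreal) simp
  ultimately show "neg_log (df_power (df_left F (ennreal \<gamma> * p / (ennreal t * c))) z) =
    z * H_integrand F t (enn2real (ennreal \<gamma> * p / c))"
    unfolding df_power_def H_integrand_def neg_log_exp_neg s by (simp only:)
qed

lemma lepage_series_measurable:
  assumes F: "nonneg_cdf F" and [measurable]: "\<And>k. Z k \<in> borel_measurable N" "\<And>k. \<epsilon> k \<in> borel_measurable N"
  shows "lepage_series F c Z \<epsilon> t \<in> borel_measurable N"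
proof -
  note [measurable] = df_left_measurable[OF F] Psi_measurable[OF F]
  show ?thesis unfolding lepage_series_def df_power_def by measurable
qed

theorem lepage_fdd:
  fixes N :: "'b measure" and M :: "'a measure"
  assumes sub: "subordinator M L \<nu>" and F: "nonneg_cdf F" "F 0 < 1"
    and \<nu>: "emeasure \<nu> (space \<nu>) \<noteq> 0" and adm: "(\<integral>\<^sup>+y. Psi F y \<partial>\<nu>) < \<infinity>"
    and N: "marked_poisson N \<epsilon> Z (density \<nu> (\<lambda>z. Psi F z / Psi_H M F L 1))"
  shows "same_fdd {0..} (completion M) (H_process F L) N (lepage_series F (Psi_H M F L 1) Z \<epsilon>)"
proof -
  define c where "c = Psi_H M F L 1"
  define \<kappa> where "\<kappa> = density \<nu> (\<lambda>z. Psi F z / c)"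
  interpret M: subordinator M L \<nu> by (rule sub)
  interpret N: marked_poisson N \<epsilon> Z \<kappa> using N by (simp add: \<kappa>_def c_def)
  note [measurable] = Psi_measurable[OF F(1)] df_left_measurable[OF F(1)]
  have [measurable]: "Psi F \<in> borel_measurable \<nu>" using Psi_measurable[OF F(1)] by (simp add: measurable_cong_sets[OF M.sets_\<nu> refl])
  have c: "c = (\<integral>\<^sup>+z. Psi F z \<partial>\<nu>)" using M.Psi_H_eq[OF F(1)] by (simp add: c_def)
  have \<nu>0: "AE z in \<nu>. 0 < z"
  proof -
    have "{0} \<in> null_sets \<nu>" using M.levy by (auto simp: levy_subordinator_def levy_measure_def null_sets_def)
    from AE_not_in[OF this] show ?thesis by eventually_elim (auto simp: zero_less_iff_neq_zero)
  qed
  have c_fin: "c < \<top>" using adm c by simp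
  have c_pos: "0 < c"
  proof (rule ccontr)
    assume "\<not> 0 < c"
    then have "(\<integral>\<^sup>+z. Psi F z \<partial>\<nu>) = 0" using c by simp
    then have "AE z in \<nu>. Psi F z = 0" by (subst (asm) nn_integral_0_iff_AE) auto
    with \<nu>0 have "AE z in \<nu>. z \<notin> space \<nu>" by eventually_elim (use Psi_pos[OF F] in force)
    then have "space \<nu> \<in> null_sets \<nu>" by (simp only: AE_iff_null_sets[OF sets.top])
    then have "emeasure \<nu> (space \<nu>) = 0" by (rule null_setsD1)
    with \<nu> show False ..
  qed
  have \<nu>fin: "AE z in \<nu>. Psi F z < \<top>"
    using nn_integral_PInf_AE[of "Psi F" \<nu>] adm by (auto simp: top.not_eq_extremum)
  have \<kappa>AE: "AE z in \<kappa>. 0 < Psi F z \<and> Psi F z < \<top>"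
  proof -
    have "AE z in \<nu>. 0 < Psi F z / c \<longrightarrow> 0 < Psi F z \<and> Psi F z < \<top>"
      using \<nu>fin \<nu>0 by eventually_elim (use Psi_pos[OF F] in auto)
    then show ?thesis unfolding \<kappa>_def by (subst AE_density) auto
  qed
  have AE_N: "AE \<omega> in N. \<forall>k. 0 < N.S (Suc k) \<omega> \<and> 0 < Psi F (Z k \<omega>) \<and> Psi F (Z k \<omega>) < \<top>"
  proof -
    have "AE \<omega> in N. 0 < Psi F (Z k \<omega>) \<and> Psi F (Z k \<omega>) < \<top>" for k
      using \<kappa>AE unfolding N.dist_Z[of k, symmetric] by (subst (asm) AE_distr_iff) auto
    then have "AE \<omega> in N. \<forall>k. 0 < Psi F (Z k \<omega>) \<and> Psi F (Z k \<omega>) < \<top>" by (simp add: AE_all_countable)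
    with N.AE_S_pos show ?thesis by eventually_elim auto
  qed
  have H_meas [measurable]: "H_integrand F t \<in> borel_measurable borel" for t
    unfolding H_integrand_def by measurable
  have Y_meas: "lepage_series F c Z \<epsilon> t \<in> borel_measurable N" for t
    by (rule lepage_series_measurable[OF F(1)]) auto
  have laplace_Y: "(\<integral>\<^sup>+\<omega>. ennreal (exp_neg (\<Sum>t\<in>J. ennreal (x t) * lepage_series F c Z \<epsilon> t \<omega>)) \<partial>N) =
      ennreal (exp_neg (M.H_exponent (\<lambda>s. \<Sum>t\<in>J. ennreal (x t) * H_integrand F t s)))"
    if J: "finite J" "J \<subseteq> {0..}" for J and x :: "real \<Rightarrow> real"
  proof -
    define g where "g s = (\<Sum>t\<in>J. ennreal (x t) * H_integrand F t s)" for s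
    have [measurable]: "g \<in> borel_measurable borel" unfolding g_def by measurable
    define h where "h \<gamma> z = z * g (enn2real (ennreal \<gamma> * Psi F z / c))" for \<gamma> z
    have h: "case_prod h \<in> borel_measurable (borel \<Otimes>\<^sub>M borel)"
      unfolding h_def by measurable
    have "(\<integral>\<^sup>+\<omega>. ennreal (exp_neg (\<Sum>t\<in>J. ennreal (x t) * lepage_series F c Z \<epsilon> t \<omega>)) \<partial>N) =
      (\<integral>\<^sup>+\<omega>. ennreal (exp_neg (\<Sum>k. h (N.S (Suc k) \<omega>) (Z k \<omega>))) \<partial>N)"
    proof (rule nn_integral_cong_AE)
      show "AE \<omega> in N. ennreal (exp_neg (\<Sum>t\<in>J. ennreal (x t) * lepage_series F c Z \<epsilon> t \<omega>)) =
        ennreal (exp_neg (\<Sum>k. h (N.S (Suc k) \<omega>) (Z k \<omega>)))"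
        using AE_N
      proof eventually_elim
        fix \<omega> assume \<omega>: "\<forall>k. 0 < N.S (Suc k) \<omega> \<and> 0 < Psi F (Z k \<omega>) \<and> Psi F (Z k \<omega>) < \<top>"
        have S: "(\<Sum>i\<le>k. \<epsilon> i \<omega>) = N.S (Suc k) \<omega>" for k
          by (simp add: N.S_def lessThan_Suc_atMost)
        have "ennreal (x t) * lepage_series F c Z \<epsilon> t \<omega> =
            (\<Sum>k. ennreal (x t) * (Z k \<omega> * H_integrand F t (enn2real (ennreal (N.S (Suc k) \<omega>) * Psi F (Z k \<omega>) / c))))"
          if "t \<in> J" for t
        proof -
          have "0 \<le> t" using that J by auto
          then show ?thesis unfolding lepage_series_def S
            using lepage_term(1)[OF \<open>0 \<le> t\<close> _ _ _ c_pos c_fin] \<omega> by (simp add: ennreal_suminf_cmult)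
        qed
        then have "(\<Sum>t\<in>J. ennreal (x t) * lepage_series F c Z \<epsilon> t \<omega>) =
          (\<Sum>t\<in>J. \<Sum>k. ennreal (x t) * (Z k \<omega> * H_integrand F t (enn2real (ennreal (N.S (Suc k) \<omega>) * Psi F (Z k \<omega>) / c))))"
          by simp
        also have "\<dots> = (\<Sum>k. \<Sum>t\<in>J. ennreal (x t) * (Z k \<omega> * H_integrand F t (enn2real (ennreal (N.S (Suc k) \<omega>) * Psi F (Z k \<omega>) / c))))"
          by (rule suminf_sum[symmetric]) simp
        also have "\<dots> = (\<Sum>k. h (N.S (Suc k) \<omega>) (Z k \<omega>))"
          unfolding h_def g_def sum_distrib_left by (simp only: mult.left_commute)
        finally show "ennreal (exp_neg (\<Sum>t\<in>J. ennreal (x t) * lepage_series F c Z \<epsilon> t \<omega>)) =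
          ennreal (exp_neg (\<Sum>k. h (N.S (Suc k) \<omega>) (Z k \<omega>)))" by simp
      qed
    qed
    also have "\<dots> = ennreal (exp_neg (\<integral>\<^sup>+\<gamma>. ennreal (1 - (\<integral>z. exp_neg (h \<gamma> z) \<partial>\<kappa>)) * indicator {0<..} \<gamma> \<partial>lborel))"
      by (rule N.laplace_marked[OF h])
    also have "(\<integral>\<^sup>+\<gamma>. ennreal (1 - (\<integral>z. exp_neg (h \<gamma> z) \<partial>\<kappa>)) * indicator {0<..} \<gamma> \<partial>lborel) = M.H_exponent g"
    proof -
      \<comment> \<open>the order of integration is exchanged for \<open>\<kappa>\<close> instead of \<open>\<nu>\<close>, as \<open>\<kappa>\<close> is finite\<close>
      interpret P: pair_sigma_finite lborel \<kappa> ..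
      have h1: "h \<gamma> \<in> borel_measurable borel" for \<gamma> using measurable_Pair2[OF h, of \<gamma>] by simp
      have int: "integrable \<kappa> (\<lambda>z. exp_neg (h \<gamma> z))" for \<gamma>
        using h1 by (intro N.\<kappa>.integrable_const_bound[of _ 1]) auto
      have "ennreal (1 - (\<integral>z. exp_neg (h \<gamma> z) \<partial>\<kappa>)) = (\<integral>\<^sup>+z. ennreal (1 - exp_neg (h \<gamma> z)) \<partial>\<kappa>)" for \<gamma>
        using int[of \<gamma>] by (subst nn_integral_eq_integral) (auto simp: N.\<kappa>.prob_space)
      moreover have "(\<lambda>z. ennreal (1 - exp_neg (h \<gamma> z))) \<in> borel_measurable \<kappa>" for \<gamma>
        using h1[of \<gamma>] by simp
      ultimately have "(\<integral>\<^sup>+\<gamma>. ennreal (1 - (\<integral>z. exp_neg (h \<gamma> z) \<partial>\<kappa>)) * indicator {0<..} \<gamma> \<partial>lborel) =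
        (\<integral>\<^sup>+\<gamma>. \<integral>\<^sup>+z. ennreal (1 - exp_neg (h \<gamma> z)) * indicator {0<..} \<gamma> \<partial>\<kappa> \<partial>lborel)"
        by (simp add: nn_integral_multc)
      also have "\<dots> = (\<integral>\<^sup>+z. \<integral>\<^sup>+\<gamma>. ennreal (1 - exp_neg (h \<gamma> z)) * indicator {0<..} \<gamma> \<partial>lborel \<partial>\<kappa>)"
      proof (rule P.Fubini'[symmetric])
        have [measurable]: "case_prod h \<in> borel_measurable (lborel \<Otimes>\<^sub>M \<kappa>)"
          using h by (simp add: measurable_cong_sets[OF sets_pair_measure_cong[OF sets_lborel N.sets_\<kappa>] refl])
        have "case_prod (\<lambda>\<gamma> z. ennreal (1 - exp_neg (h \<gamma> z)) * indicator {0<..} \<gamma>) =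
          (\<lambda>p. ennreal (1 - exp_neg (case_prod h p)) * indicator {0<..} (fst p))" by (auto simp: fun_eq_iff)
        also have "\<dots> \<in> borel_measurable (lborel \<Otimes>\<^sub>M \<kappa>)" by measurable
        finally show "case_prod (\<lambda>\<gamma> z. ennreal (1 - exp_neg (h \<gamma> z)) * indicator {0<..} \<gamma>) \<in> borel_measurable (lborel \<Otimes>\<^sub>M \<kappa>)" .
      qed
      also have "\<dots> = (\<integral>\<^sup>+z. Psi F z / c * (\<integral>\<^sup>+\<gamma>. ennreal (1 - exp_neg (h \<gamma> z)) * indicator {0<..} \<gamma> \<partial>lborel) \<partial>\<nu>)"
        unfolding \<kappa>_def
      proof (rule nn_integral_density)
        have [measurable]: "(\<lambda>p. h (snd p) (fst p)) \<in> borel_measurable (\<nu> \<Otimes>\<^sub>M lborel)"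
          unfolding h_def by measurable
        show "(\<lambda>z. \<integral>\<^sup>+\<gamma>. ennreal (1 - exp_neg (h \<gamma> z)) * indicator {0<..} \<gamma> \<partial>lborel) \<in> borel_measurable \<nu>"
        proof (rule lborel.borel_measurable_nn_integral)
          have "case_prod (\<lambda>z \<gamma>. ennreal (1 - exp_neg (h \<gamma> z)) * indicator {0<..} \<gamma>) =
            (\<lambda>p. ennreal (1 - exp_neg (h (snd p) (fst p))) * indicator {0<..} (snd p))" by (auto simp: fun_eq_iff)
          also have "\<dots> \<in> borel_measurable (\<nu> \<Otimes>\<^sub>M lborel)" by measurable
          finally show "case_prod (\<lambda>z \<gamma>. ennreal (1 - exp_neg (h \<gamma> z)) * indicator {0<..} \<gamma>) \<in> borel_measurable (\<nu> \<Otimes>\<^sub>M lborel)" .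
        qed
      qed measurable
      also have "\<dots> = M.H_exponent g"
        unfolding M.H_exponent_def
      proof (rule nn_integral_cong_AE)
        show "AE z in \<nu>. Psi F z / c * (\<integral>\<^sup>+\<gamma>. ennreal (1 - exp_neg (h \<gamma> z)) * indicator {0<..} \<gamma> \<partial>lborel) =
          (\<integral>\<^sup>+s. ennreal (1 - exp_neg (z * g s)) * indicator {0<..} s \<partial>lborel)"
          using \<nu>0 \<nu>fin
        proof eventually_elim
          fix z assume z: "0 < z" "Psi F z < \<top>"
          obtain p where p: "Psi F z = ennreal p" "0 < p" using z Psi_pos[OF F z(1)] by (cases "Psi F z") (auto simp: ennreal_less_zero_iff)
          obtain c' where c': "c = ennreal c'" "0 < c'" using c_pos c_fin by (cases c) (auto simp: ennreal_less_zero_iff)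
          define b where "b = p / c'"
          have b: "0 < b" using p c' by (simp add: b_def)
          have pc: "Psi F z / c = ennreal b" using p c' by (simp add: b_def divide_ennreal)
          have arg: "enn2real (ennreal \<gamma> * Psi F z / c) = b * \<gamma>" if "0 < \<gamma>" for \<gamma>
            using p c' that by (simp add: b_def divide_ennreal field_simps flip: ennreal_mult)
          have "(\<integral>\<^sup>+s. ennreal (1 - exp_neg (z * g s)) * indicator {0<..} s \<partial>lborel) =
            ennreal \<bar>b\<bar> * (\<integral>\<^sup>+\<gamma>. ennreal (1 - exp_neg (z * g (0 + b * \<gamma>))) * indicator {0<..} (0 + b * \<gamma>) \<partial>lborel)"
            by (rule nn_integral_real_affine) (use b in auto)
          also have "(\<integral>\<^sup>+\<gamma>. ennreal (1 - exp_neg (z * g (0 + b * \<gamma>))) * indicator {0<..} (0 + b * \<gamma>) \<partial>lborel) =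
            (\<integral>\<^sup>+\<gamma>. ennreal (1 - exp_neg (h \<gamma> z)) * indicator {0<..} \<gamma> \<partial>lborel)"
            using b by (intro nn_integral_cong) (auto simp: indicator_def h_def arg zero_less_mult_iff)
          finally show "Psi F z / c * (\<integral>\<^sup>+\<gamma>. ennreal (1 - exp_neg (h \<gamma> z)) * indicator {0<..} \<gamma> \<partial>lborel) =
            (\<integral>\<^sup>+s. ennreal (1 - exp_neg (z * g s)) * indicator {0<..} s \<partial>lborel)"
            using b by (simp add: pc)
        qed
      qed
      finally show ?thesis .
    qed
    finally show ?thesis by (simp add: g_def[abs_def])
  qed
  show ?thesis unfolding same_fdd_def c_def[symmetric]
  proof (intro conjI ballI allI impI)
    show "H_process F L t \<in> borel_measurable (completion M)" if "t \<in> {0..}" for t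
      using M.H_process_measurable[OF F(1)] that by simp
    show "lepage_series F c Z \<epsilon> t \<in> borel_measurable N" for t by (rule Y_meas)
    fix J :: "real set" assume J: "finite J \<and> J \<subseteq> {0..}"
    have HH: "(\<lambda>\<omega>. \<lambda>t\<in>J. M.H_lim F t \<omega>) \<in> M \<rightarrow>\<^sub>M (\<Pi>\<^sub>M t\<in>J. borel)" by (rule measurable_restrict) measurable
    have "distr (completion M) (\<Pi>\<^sub>M t\<in>J. borel) (\<lambda>\<omega>. \<lambda>t\<in>J. H_process F L t \<omega>) =
      distr (completion M) (\<Pi>\<^sub>M t\<in>J. borel) (\<lambda>\<omega>. \<lambda>t\<in>J. M.H_lim F t \<omega>)"
    proof (rule distr_cong_AE)
      have "AE \<omega> in M. \<forall>t\<in>J. M.H_lim F t \<omega> = H_process F L t \<omega>"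
        using J by (intro AE_finite_allI M.AE_H_lim[OF F(1)]) auto
      then show "AE \<omega> in completion M. (\<lambda>t\<in>J. H_process F L t \<omega>) = (\<lambda>t\<in>J. M.H_lim F t \<omega>)"
        unfolding AE_completion_iff by eventually_elim (auto simp: restrict_def fun_eq_iff)
      show "(\<lambda>\<omega>. \<lambda>t\<in>J. H_process F L t \<omega>) \<in> completion M \<rightarrow>\<^sub>M (\<Pi>\<^sub>M t\<in>J. borel)"
        using J by (intro measurable_restrict M.H_process_measurable[OF F(1)]) auto
      show "(\<lambda>\<omega>. \<lambda>t\<in>J. M.H_lim F t \<omega>) \<in> completion M \<rightarrow>\<^sub>M (\<Pi>\<^sub>M t\<in>J. borel)"
        by (rule measurable_completion[OF HH])
    qed simp_all
    also have "\<dots> = distr M (\<Pi>\<^sub>M t\<in>J. borel) (\<lambda>\<omega>. \<lambda>t\<in>J. M.H_lim F t \<omega>)"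
      by (rule distr_completion[OF HH])
    also have "\<dots> = distr N (\<Pi>\<^sub>M t\<in>J. borel) (\<lambda>\<omega>. \<lambda>t\<in>J. lepage_series F c Z \<epsilon> t \<omega>)"
    proof (rule joint_laplace_unique)
      show "finite_measure M" "finite_measure N" by unfold_locales
      fix n :: "real \<Rightarrow> nat"
      have prod: "(\<Prod>t\<in>J. ennreal (exp_neg (of_nat (n t) * Y t))) = ennreal (exp_neg (\<Sum>t\<in>J. ennreal (real (n t)) * Y t))" for Y
        using J by (simp add: exp_neg_sum prod_ennreal ennreal_of_nat_eq_real_of_nat)
      have int: "integrable M (\<lambda>\<omega>. exp_neg (\<Sum>t\<in>J. ennreal (real (n t)) * M.H_lim F t \<omega>))"
        by (rule M.integrable_const_bound[of _ 1]) auto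
      have "(\<integral>\<^sup>+\<omega>. ennreal (exp_neg (\<Sum>t\<in>J. ennreal (real (n t)) * M.H_lim F t \<omega>)) \<partial>M) =
        ennreal (exp_neg (M.H_exponent (\<lambda>s. \<Sum>t\<in>J. ennreal (real (n t)) * H_integrand F t s)))"
        using J by (subst nn_integral_eq_integral[OF int]) (auto intro!: arg_cong[where f = ennreal] M.laplace_H[OF F(1)])
      then show "(\<integral>\<^sup>+\<omega>. (\<Prod>t\<in>J. ennreal (exp_neg (of_nat (n t) * M.H_lim F t \<omega>))) \<partial>M) =
        (\<integral>\<^sup>+\<omega>. (\<Prod>t\<in>J. ennreal (exp_neg (of_nat (n t) * lepage_series F c Z \<epsilon> t \<omega>))) \<partial>N)"
        unfolding prod using laplace_Y[of J "\<lambda>t. real (n t)"] J by simp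
    qed (use J Y_meas in auto)
    finally show "distr (completion M) (\<Pi>\<^sub>M t\<in>J. borel) (\<lambda>\<omega>. \<lambda>t\<in>J. H_process F L t \<omega>) =
      distr N (\<Pi>\<^sub>M t\<in>J. borel) (\<lambda>\<omega>. \<lambda>t\<in>J. lepage_series F c Z \<epsilon> t \<omega>)" .
  qed
qed

theorem lemma2p6:
  fixes M :: "'a measure" and L :: "real \<Rightarrow> 'a \<Rightarrow> ennreal"
    and \<nu> :: "ennreal measure" and F :: "real \<Rightarrow> real"
  assumes "dist_fun F"
    and "levy_subordinator M L \<nu>"
    and "emeasure \<nu> (space \<nu>) \<noteq> 0"
    and "dist_fun_L \<nu> F"
  shows "(\<forall>t>0. AE \<omega> in M.
            has_RS_integral (\<lambda>s. neg_log (df_left F (ennreal s / ennreal t)))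
              (\<lambda>s. enn2ereal (L s \<omega>)) (H_process F L t \<omega>) \<and>
            has_RS_integral (\<lambda>s. L (s * t) \<omega>) (\<lambda>s. elog (F s)) (H_process F L t \<omega>)) \<and>
         (\<forall>(N :: 'b measure) (Z :: nat \<Rightarrow> 'b \<Rightarrow> ennreal) (\<epsilon> :: nat \<Rightarrow> 'b \<Rightarrow> real).
            prob_space N \<and>
            prob_space.indep_vars N (\<lambda>k. borel) Z UNIV \<and>
            (\<forall>k. distr N borel (Z k) = density \<nu> (\<lambda>z. Psi F z / Psi_H M F L 1)) \<and>
            prob_space.indep_vars N (\<lambda>k. borel) \<epsilon> UNIV \<and>
            (\<forall>k. distributed N lborel (\<epsilon> k) (exponential_density 1)) \<and>
            indep_sequences N Z \<epsilon> \<longrightarrow>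
            same_fdd {0..} (completion M) (H_process F L)
              N (lepage_series F (Psi_H M F L 1) Z \<epsilon>))"
proof (intro conjI allI impI)
  have F: "nonneg_cdf F" using assms(1) by (rule nonneg_cdf_dist_fun)
  have sub: "subordinator M L \<nu>" using assms(2) by (rule subordinator.intro)
  fix t :: real assume "0 < t"
  with subordinator.AE_integrals[OF sub F this] show "AE \<omega> in M.
      has_RS_integral (\<lambda>s. neg_log (df_left F (ennreal s / ennreal t))) (\<lambda>s. enn2ereal (L s \<omega>)) (H_process F L t \<omega>) \<and>
      has_RS_integral (\<lambda>s. L (s * t) \<omega>) (\<lambda>s. elog (F s)) (H_process F L t \<omega>)"
    unfolding H_integrand_def[abs_def] by (auto elim: eventually_mono)
next
  fix N :: "'b measure" and Z :: "nat \<Rightarrow> 'b \<Rightarrow> ennreal" and \<epsilon> :: "nat \<Rightarrow> 'b \<Rightarrow> real"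
  assume N: "prob_space N \<and>
            prob_space.indep_vars N (\<lambda>k. borel) Z UNIV \<and>
            (\<forall>k. distr N borel (Z k) = density \<nu> (\<lambda>z. Psi F z / Psi_H M F L 1)) \<and>
            prob_space.indep_vars N (\<lambda>k. borel) \<epsilon> UNIV \<and>
            (\<forall>k. distributed N lborel (\<epsilon> k) (exponential_density 1)) \<and>
            indep_sequences N Z \<epsilon>"
  show "same_fdd {0..} (completion M) (H_process F L) N (lepage_series F (Psi_H M F L 1) Z \<epsilon>)"
  proof (rule lepage_fdd)
    show "subordinator M L \<nu>" using assms(2) by (rule subordinator.intro)
    show "nonneg_cdf F" "F 0 < 1" using assms(1) by (rule nonneg_cdf_dist_fun, rule dist_fun_less_1)
    show "(\<integral>\<^sup>+y. Psi F y \<partial>\<nu>) < \<infinity>" using assms(4) by (simp add: dist_fun_L_def)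
    show "marked_poisson N \<epsilon> Z (density \<nu> (\<lambda>z. Psi F z / Psi_H M F L 1))"
      using N by (intro marked_poisson.intro iid_exponential.intro iid_exponential_axioms.intro marked_poisson_axioms.intro) auto
  qed fact
qed

end
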